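(* Let $E$ be an infinite-dimensional separable real Hilbert space and let $\mathcal E=\{e_i\}$, $\mathcal F=\{f_j\}$ be orthonormal bases of $E$ such that $$\prod_{j=1}^\infty\Bigl(\sum_{i=1}^\infty|(e_i,f_j)|\Bigr)<+\infty .$$ If $Q\in\mathcal K_{\mathcal F}$, then $Q\in\mathcal R_{\mathcal E}$ and $\lambda_{\mathcal E}(Q)=\lambda_{\mathcal F}(Q)$. Conversely, if $P\in\mathcal K_{\mathcal E}$, then $P\in\mathcal R_{\mathcal F}$ and $\lambda_{\mathcal F}(P)=\lambda_{\mathcal E}(P)$.
   Context: For an orthonormal basis $\mathcal E=\{e_j\}_{j\in\mathbb N}$ of $E$, $\mathcal K_{\mathcal E}$ denotes the collection consisting of $\varnothing$ and of all nonempty sets $\Pi=\{x\in E:\ (x,e_j)\in[a_j,b_j)\ \forall j\in\mathbb N\}$ with $a,b\in\ell_\infty$ and $\sum_{j=1}^\infty\max\{0,\ln(b_j-a_j)\}<\infty$ (measurable rectangles). Put $\lambda_{\mathcal E}(\varnothing)=0$ and $\lambda_{\mathcal E}(\Pi)=\exp\bigl[\sum_{j=1}^\infty\ln(b_j-a_j)\bigr]\in[0,+\infty)$ (equal to $0$ if the sum is $-\infty$). It is known that $\lambda_{\mathcal E}$ extends uniquely to a finitely additive shift-invariant measure on the ring $r_{\mathcal E}$ (closed under finite unions and differences) generated by $\mathcal K_{\mathcal E}$. $\mathcal R_{\mathcal E}$ is the ring of all $A\subset E$ such that for every $\epsilon>0$ there are $A_*,A^*\in r_{\mathcal E}$ with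 $A_*\subset A\subset A^*$ and $\lambda_{\mathcal E}(A^*\setminus A_* )<\epsilon$, and $\lambda_{\mathcal E}(A)=\inf\{\lambda_{\mathcal E}(A^* ):A^*\in r_{\mathcal E},A^*\supset A\}$ for $A\in\mathcal R_{\mathcal E}$. *)

theory Defs
  imports "HOL-Analysis.Analysis"
begin

definition orthonormal_basis :: "(nat \<Rightarrow> 'a::real_inner) \<Rightarrow> bool" where
  "orthonormal_basis e \<longleftrightarrow>
     (\<forall>i j. e i \<bullet> e j = (if i = j then 1 else 0)) \<and> closure (span (range e)) = UNIV"

definition rectangle :: "(nat \<Rightarrow> 'a::real_inner) \<Rightarrow> (nat \<Rightarrow> real) \<Rightarrow> (nat \<Rightarrow> real) \<Rightarrow> 'a set" where
  "rectangle e a b = {x. \<forall>j. x \<bullet> e j \<in> {a j..<b j}}"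

definition measurable_params :: "(nat \<Rightarrow> real) \<Rightarrow> (nat \<Rightarrow> real) \<Rightarrow> bool" where
  "measurable_params a b \<longleftrightarrow>
     bounded (range a) \<and> bounded (range b) \<and> summable (\<lambda>j. max 0 (ln (b j - a j)))"

definition measurable_rectangles :: "(nat \<Rightarrow> 'a::real_inner) \<Rightarrow> 'a set set" where
  "measurable_rectangles e =
     insert {} {rectangle e a b | a b. measurable_params a b \<and> rectangle e a b \<noteq> {}}"

text \<open>For parameters of a nonempty measurable rectangle, \<open>a j < b j\<close> for all \<open>j\<close> and the positive
  parts of the logarithms are summable, so the series of logarithms either converges or
  diverges to minus infinity; the second case gives volume 0.\<close>

definition rectangle_volume :: "(nat \<Rightarrow> real) \<Rightarrow> (nat \<Rightarrow> real) \<Rightarrow> real" where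
  "rectangle_volume a b =
     (if summable (\<lambda>j. ln (b j - a j)) then exp (\<Sum>j. ln (b j - a j)) else 0)"

definition rectangle_ring :: "(nat \<Rightarrow> 'a::real_inner) \<Rightarrow> 'a set set" where
  "rectangle_ring e = ring_of_sets UNIV hull measurable_rectangles e"

definition extends_volume :: "(nat \<Rightarrow> 'a::real_inner) \<Rightarrow> ('a set \<Rightarrow> real) \<Rightarrow> bool" where
  "extends_volume e \<mu> \<longleftrightarrow>
     (\<forall>A\<in>rectangle_ring e. 0 \<le> \<mu> A) \<and>
     additive (rectangle_ring e) \<mu> \<and>
     (\<forall>A\<in>rectangle_ring e. \<forall>x. \<mu> ((+) x ` A) = \<mu> A) \<and>
     \<mu> {} = 0 \<and>
     (\<forall>a b. measurable_params a b \<and> rectangle e a b \<noteq> {} \<longrightarrow>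
        \<mu> (rectangle e a b) = rectangle_volume a b)"

text \<open>Uniqueness of the extension holds on \<^term>\<open>rectangle_ring e\<close> only, so the values outside it
  are fixed by \<^const>\<open>extensional\<close>.\<close>

definition ring_measure :: "(nat \<Rightarrow> 'a::real_inner) \<Rightarrow> 'a set \<Rightarrow> real" where
  "ring_measure e = (THE \<mu>. \<mu> \<in> extensional (rectangle_ring e) \<and> extends_volume e \<mu>)"

definition completed_ring :: "(nat \<Rightarrow> 'a::real_inner) \<Rightarrow> 'a set set" where
  "completed_ring e =
     {A. \<forall>\<epsilon>>0. \<exists>B\<in>rectangle_ring e. \<exists>C\<in>rectangle_ring e.
        B \<subseteq> A \<and> A \<subseteq> C \<and> ring_measure e (C - B) < \<epsilon>}"

definition completed_measure :: "(nat \<Rightarrow> 'a::real_inner) \<Rightarrow> 'a set \<Rightarrow> real" where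
  "completed_measure e A = Inf {ring_measure e C | C. C \<in> rectangle_ring e \<and> A \<subseteq> C}"

end

theory Submission
  imports Defs
begin

text \<open>The entries of the matrix \<open>f j \<bullet> e i\<close> satisfy \<open>(\<Sum>i. \<bar>f j \<bullet> e i\<bar>) \<ge> 1\<close>, so finiteness of the product
  means that the excess over 1 is summable. This makes the matrix, up to a permutation of one
  basis, absolutely summable off the diagonal, a condition that is symmetric in \<open>e\<close> and \<open>f\<close>.
  A rotation in a coordinate plane is a product of three shears, and slicing shows that shears
  preserve the measure of rectangles. Hence the first \<open>N\<close> vectors of \<open>e\<close> may be rotated without
  changing the measure, and rotating them so that the leading block of the matrix becomes lower
  triangular makes the total off-diagonal mass as small as we like. A rectangle of \<open>f\<close> is then
  squeezed between two rectangles of the rotated basis whose edges differ from the original ones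
  by small summable amounts.\<close>

section \<open>Jordan completion of a content\<close>

text \<open>The measure is only finitely additive, so no limit theorem is available and every
  approximation has to be an inclusion of sets from both sides. The relation
  \<open>refines e g\<close> is transitive, which is what allows shears, rotations and permutations
  to be chained. Finite off-diagonal mass alone does not suffice, because the edges would then move
  by amounts that do not shrink. Finitely many shears reach only finitely many vectors, and they act
  on one side of the matrix, as in a QR factorisation. The leading block need not be orthogonal, so
  a triangular form is all that this yields; the orthogonality of the vectors of \<open>f\<close>,
  together with the small mass outside the block, then forces it to be nearly diagonal. A
  permutation is needed because the product ignores the order of the bases, whereas small
  off-diagonal mass requires the dominant entries to sit on the diagonal. The edges of a rectangle
  of volume 0 may tend to 0, so its inner approximation is taken to be empty; positive volume keeps
  the edges away from 0.\<close>

definition sandwiched :: "'a set set \<Rightarrow> ('a set \<Rightarrow> real) \<Rightarrow> 'a set \<Rightarrow> real \<Rightarrow> bool" where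
  "sandwiched R \<mu> A v \<longleftrightarrow>
     (\<forall>\<epsilon>>0. \<exists>B\<in>R. \<exists>C\<in>R. B \<subseteq> A \<and> A \<subseteq> C \<and> v - \<epsilon> < \<mu> B \<and> \<mu> C < v + \<epsilon>)"

lemma sandwichedE:
  assumes "sandwiched R \<mu> A v" "\<epsilon> > 0"
  obtains B C where "B \<in> R" "C \<in> R" "B \<subseteq> A" "A \<subseteq> C" "v - \<epsilon> < \<mu> B" "\<mu> C < v + \<epsilon>"
  using assms unfolding sandwiched_def by blast

locale content =
  fixes R :: "'a set set" and \<mu> :: "'a set \<Rightarrow> real"
  assumes ring: "ring_of_sets UNIV R"
    and nonneg: "A \<in> R \<Longrightarrow> 0 \<le> \<mu> A"
    and add: "A \<in> R \<Longrightarrow> B \<in> R \<Longrightarrow> A \<inter> B = {} \<Longrightarrow> \<mu> (A \<union> B) = \<mu> A + \<mu> B"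
begin

lemma empty_mem: "{} \<in> R"
  and Un_mem: "A \<in> R \<Longrightarrow> B \<in> R \<Longrightarrow> A \<union> B \<in> R"
  and Diff_mem: "A \<in> R \<Longrightarrow> B \<in> R \<Longrightarrow> A - B \<in> R"
  using ring by (simp_all add: ring_of_sets_iff)

lemma content_empty: "\<mu> {} = 0"
  using add[of "{}" "{}"] empty_mem by auto

lemma content_diff:
  assumes "A \<in> R" "B \<in> R" "B \<subseteq> A"
  shows "\<mu> (A - B) = \<mu> A - \<mu> B"
proof -
  have "\<mu> (B \<union> (A - B)) = \<mu> B + \<mu> (A - B)"
    using assms by (intro add) (auto simp: Un_mem Diff_mem)
  then show ?thesis
    using assms by (simp add: Un_absorb1)
qed

lemma content_mono: "A \<in> R \<Longrightarrow> B \<in> R \<Longrightarrow> B \<subseteq> A \<Longrightarrow> \<mu> B \<le> \<mu> A"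
  using content_diff[of A B] nonneg[of "A - B"] Diff_mem by auto

lemma content_Un_le:
  assumes "A \<in> R" "B \<in> R"
  shows "\<mu> (A \<union> B) \<le> \<mu> A + \<mu> B"
proof -
  have "\<mu> (A \<union> (B - A)) = \<mu> A + \<mu> (B - A)"
    using assms by (intro add) (auto simp: Un_mem Diff_mem)
  moreover have "\<mu> (B - A) \<le> \<mu> B"
    using assms by (intro content_mono) (auto simp: Un_mem Diff_mem)
  ultimately show ?thesis by simp
qed

lemma content_diff_ge:
  assumes "A \<in> R" "B \<in> R"
  shows "\<mu> A - \<mu> B \<le> \<mu> (A - B)"
proof -
  have "\<mu> A \<le> \<mu> ((A - B) \<union> B)"
    using assms by (intro content_mono) (auto simp: Un_mem Diff_mem)
  also have "\<dots> \<le> \<mu> (A - B) + \<mu> B"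
    using assms by (intro content_Un_le) (auto simp: Un_mem Diff_mem)
  finally show ?thesis by simp
qed

lemma sandwiched_self: "A \<in> R \<Longrightarrow> sandwiched R \<mu> A (\<mu> A)"
  unfolding sandwiched_def by force

lemma sandwiched_Un:
  assumes A: "sandwiched R \<mu> A u" and B: "sandwiched R \<mu> B v" and disj: "A \<inter> B = {}"
  shows "sandwiched R \<mu> (A \<union> B) (u + v)"
  unfolding sandwiched_def
proof (intro allI impI)
  fix \<epsilon> :: real assume "\<epsilon> > 0"
  then have "\<epsilon> / 2 > 0" by simp
  note \<epsilon> = this
  obtain A1 A2 where A12: "A1 \<in> R" "A2 \<in> R" "A1 \<subseteq> A" "A \<subseteq> A2" "u - \<epsilon>/2 < \<mu> A1" "\<mu> A2 < u + \<epsilon>/2"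
    by (rule sandwichedE[OF A \<epsilon>])
  obtain B1 B2 where B12: "B1 \<in> R" "B2 \<in> R" "B1 \<subseteq> B" "B \<subseteq> B2" "v - \<epsilon>/2 < \<mu> B1" "\<mu> B2 < v + \<epsilon>/2"
    by (rule sandwichedE[OF B \<epsilon>])
  note * = A12 B12
  have "\<mu> (A1 \<union> B1) = \<mu> A1 + \<mu> B1" using A12(1-4) B12(1-4) disj by (intro add) (auto simp: Un_mem Diff_mem)
  moreover have "\<mu> (A2 \<union> B2) \<le> \<mu> A2 + \<mu> B2" using A12(1-4) B12(1-4) by (intro content_Un_le) auto
  ultimately have "u + v - \<epsilon> < \<mu> (A1 \<union> B1)" "\<mu> (A2 \<union> B2) < u + v + \<epsilon>"
    using * by linarith+
  moreover have "A1 \<union> B1 \<in> R" "A2 \<union> B2 \<in> R"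
    using A12(1,2) B12(1,2) by (auto simp: Un_mem Diff_mem)
  moreover have "A1 \<union> B1 \<subseteq> A \<union> B" "A \<union> B \<subseteq> A2 \<union> B2"
    using A12(3,4) B12(3,4) by auto
  ultimately show "\<exists>C\<in>R. \<exists>D\<in>R. C \<subseteq> A \<union> B \<and> A \<union> B \<subseteq> D \<and> u + v - \<epsilon> < \<mu> C \<and> \<mu> D < u + v + \<epsilon>"
    by metis
qed

lemma sandwiched_Diff:
  assumes A: "sandwiched R \<mu> A u" and B: "sandwiched R \<mu> B v" and sub: "B \<subseteq> A"
  shows "sandwiched R \<mu> (A - B) (u - v)"
  unfolding sandwiched_def
proof (intro allI impI)
  fix \<epsilon> :: real assume "\<epsilon> > 0"
  then have "\<epsilon> / 2 > 0" by simp
  note \<epsilon> = this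
  obtain A1 A2 where A12: "A1 \<in> R" "A2 \<in> R" "A1 \<subseteq> A" "A \<subseteq> A2" "u - \<epsilon>/2 < \<mu> A1" "\<mu> A2 < u + \<epsilon>/2"
    by (rule sandwichedE[OF A \<epsilon>])
  obtain B1 B2 where B12: "B1 \<in> R" "B2 \<in> R" "B1 \<subseteq> B" "B \<subseteq> B2" "v - \<epsilon>/2 < \<mu> B1" "\<mu> B2 < v + \<epsilon>/2"
    by (rule sandwichedE[OF B \<epsilon>])
  note * = A12 B12
  \<comment> \<open>\<open>B2\<close> covers \<open>B\<close> but may stick out of
    \<open>A1\<close>, so only an inequality is available here.\<close>
  have "\<mu> A1 - \<mu> B2 \<le> \<mu> (A1 - B2)" using A12(1-4) B12(1-4) by (intro content_diff_ge) (auto simp: Un_mem Diff_mem)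
  moreover have "\<mu> (A2 - B1) = \<mu> A2 - \<mu> B1" using A12(1-4) B12(1-4) sub by (intro content_diff) (auto simp: Un_mem Diff_mem)
  ultimately have "u - v - \<epsilon> < \<mu> (A1 - B2)" "\<mu> (A2 - B1) < u - v + \<epsilon>"
    using * by linarith+
  moreover have "A1 - B2 \<in> R" "A2 - B1 \<in> R"
    using A12(1,2) B12(1,2) by (auto simp: Un_mem Diff_mem)
  moreover have "A1 - B2 \<subseteq> A - B" "A - B \<subseteq> A2 - B1"
    using A12(3,4) B12(3,4) by auto
  ultimately show "\<exists>C\<in>R. \<exists>D\<in>R. C \<subseteq> A - B \<and> A - B \<subseteq> D \<and> u - v - \<epsilon> < \<mu> C \<and> \<mu> D < u - v + \<epsilon>"
    by metis
qed

text \<open>Completing twice gives nothing new: the approximating sets may themselves be merely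
  sandwiched instead of lying in the ring. The limit arguments below all end in this rule.\<close>

lemma sandwiched_squeeze:
  assumes "\<And>\<epsilon>. \<epsilon> > 0 \<Longrightarrow> \<exists>B C u w. sandwiched R \<mu> B u \<and> sandwiched R \<mu> C w \<and> B \<subseteq> A \<and> A \<subseteq> C
             \<and> v - \<epsilon> < u \<and> w < v + \<epsilon>"
  shows "sandwiched R \<mu> A v"
  unfolding sandwiched_def
proof (intro allI impI)
  fix \<epsilon> :: real assume "\<epsilon> > 0"
  then have \<epsilon>: "\<epsilon> / 2 > 0" by simp
  from assms[OF this] obtain B C u w where *: "sandwiched R \<mu> B u" "sandwiched R \<mu> C w" "B \<subseteq> A" "A \<subseteq> C"
    "v - \<epsilon>/2 < u" "w < v + \<epsilon>/2"
    by metis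
  obtain B1 where B1: "B1 \<in> R" "B1 \<subseteq> B" "u - \<epsilon>/2 < \<mu> B1" by (rule sandwichedE[OF *(1) \<epsilon>])
  obtain C1 where C1: "C1 \<in> R" "C \<subseteq> C1" "\<mu> C1 < w + \<epsilon>/2" by (rule sandwichedE[OF *(2) \<epsilon>])
  have "B1 \<subseteq> A" "A \<subseteq> C1" "v - \<epsilon> < \<mu> B1" "\<mu> C1 < v + \<epsilon>"
    using * B1 C1 by (auto simp: field_simps)
  then show "\<exists>B\<in>R. \<exists>C\<in>R. B \<subseteq> A \<and> A \<subseteq> C \<and> v - \<epsilon> < \<mu> B \<and> \<mu> C < v + \<epsilon>"
    using B1(1) C1(1) by metis
qed

text \<open>Membership in the completed ring and the value of the completed measure are both read
  off from one statement, which is why \<open>sandwiched\<close> carries the value \<open>v\<close>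
  along.\<close>

lemma sandwiched_completion:
  assumes "sandwiched R \<mu> A v"
  shows "\<forall>\<epsilon>>0. \<exists>B\<in>R. \<exists>C\<in>R. B \<subseteq> A \<and> A \<subseteq> C \<and> \<mu> (C - B) < \<epsilon>"
    and "Inf {\<mu> C | C. C \<in> R \<and> A \<subseteq> C} = v"
proof -
  show "\<forall>\<epsilon>>0. \<exists>B\<in>R. \<exists>C\<in>R. B \<subseteq> A \<and> A \<subseteq> C \<and> \<mu> (C - B) < \<epsilon>"
  proof (intro allI impI)
    fix \<epsilon> :: real assume "\<epsilon> > 0"
    then have "\<epsilon> / 2 > 0" by simp
    note pos = this
    obtain B C where
      *: "B \<in> R" "C \<in> R" "B \<subseteq> A" "A \<subseteq> C" "v - \<epsilon>/2 < \<mu> B" "\<mu> C < v + \<epsilon>/2" by (rule sandwichedE[OF assms pos])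
    have "\<mu> (C - B) = \<mu> C - \<mu> B" using * by (intro content_diff) (auto simp: Un_mem Diff_mem)
    then have "\<mu> (C - B) < \<epsilon>" using * by linarith
    then show "\<exists>B\<in>R. \<exists>C\<in>R. B \<subseteq> A \<and> A \<subseteq> C \<and> \<mu> (C - B) < \<epsilon>"
      using * by metis
  qed
  have lower: "v \<le> \<mu> C" if "C \<in> R" "A \<subseteq> C" for C
  proof (rule field_le_epsilon)
    fix \<epsilon> :: real assume "\<epsilon> > 0"
    note pos = this
    obtain B where "B \<in> R" "B \<subseteq> A" "v - \<epsilon> < \<mu> B" by (rule sandwichedE[OF assms pos])
    moreover have "\<mu> B \<le> \<mu> C" using calculation that by (intro content_mono) (auto simp: Un_mem Diff_mem)
    ultimately show "v \<le> \<mu> C + \<epsilon>" by simp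
  qed
  show "Inf {\<mu> C | C. C \<in> R \<and> A \<subseteq> C} = v"
  proof (rule cInf_eq_non_empty)
    show "{\<mu> C | C. C \<in> R \<and> A \<subseteq> C} \<noteq> {}"
      by (rule sandwichedE[OF assms zero_less_one]) blast
    show "v \<le> x" if "x \<in> {\<mu> C | C. C \<in> R \<and> A \<subseteq> C}" for x
      using that lower by auto
    show "y \<le> v" if y: "\<And>x. x \<in> {\<mu> C | C. C \<in> R \<and> A \<subseteq> C} \<Longrightarrow> y \<le> x" for y
    proof (rule field_le_epsilon)
      fix \<epsilon> :: real assume "\<epsilon> > 0"
      note pos = this
    obtain C where "C \<in> R" "A \<subseteq> C" "\<mu> C < v + \<epsilon>" by (rule sandwichedE[OF assms pos])
      then show "y \<le> v + \<epsilon>" using y[of "\<mu> C"] by force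
    qed
  qed
qed

end

section \<open>The ring generated by an intersection-stable family\<close>

text \<open>Only disjoint unions and proper differences occur, because these are the operations
  through which an additive function is determined by its values on \<open>K\<close>. Induction over
  this set later gives uniqueness of the measure, the representation by signed sums, and the
  transfer between bases.\<close>

inductive_set dynkin_ring :: "'a set set \<Rightarrow> 'a set set" for K where
  base: "A \<in> K \<Longrightarrow> A \<in> dynkin_ring K"
| Un: "A \<in> dynkin_ring K \<Longrightarrow> B \<in> dynkin_ring K \<Longrightarrow> A \<inter> B = {} \<Longrightarrow> A \<union> B \<in> dynkin_ring K"
| Diff: "A \<in> dynkin_ring K \<Longrightarrow> B \<in> dynkin_ring K \<Longrightarrow> B \<subseteq> A \<Longrightarrow> A - B \<in> dynkin_ring K"

text \<open>The two passes of the pi-lambda argument: intersections with a fixed member of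
  \<open>K\<close> first, then with an arbitrary member of the generated family.\<close>

lemma dynkin_ring_Int:
  assumes K: "Int_stable K" and "A \<in> dynkin_ring K" "B \<in> dynkin_ring K"
  shows "A \<inter> B \<in> dynkin_ring K"
proof -
  have *: "A \<inter> C \<in> dynkin_ring K" if "A \<in> dynkin_ring K" "C \<in> K" for A C
    using that(1)
  proof induction
    case (base A)
    then show ?case using K that(2) by (auto simp: Int_stable_def intro: dynkin_ring.base)
  next
    case (Un A B)
    then show ?case using dynkin_ring.Un[OF Un.IH] by (auto simp: Int_Un_distrib2)
  next
    case (Diff A B)
    have "(A - B) \<inter> C = (A \<inter> C) - (B \<inter> C)" by auto
    then show ?case using dynkin_ring.Diff[OF Diff.IH] Diff.hyps by auto
  qed
  show ?thesis using assms(3)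
  proof induction
    case (base C)
    then show ?case using * assms(2) by auto
  next
    case (Un C D)
    then show ?case using dynkin_ring.Un[OF Un.IH] by (auto simp: Int_Un_distrib)
  next
    case (Diff C D)
    have "A \<inter> (C - D) = (A \<inter> C) - (A \<inter> D)" by auto
    then show ?case using dynkin_ring.Diff[OF Diff.IH] Diff.hyps by auto
  qed
qed

lemma ring_of_sets_hull: "ring_of_sets UNIV (ring_of_sets UNIV hull K)"
  by (rule hull_in) (auto simp: ring_of_sets_iff)

lemma dynkin_ring_eq_hull:
  assumes K: "Int_stable K" and "{} \<in> K"
  shows "ring_of_sets UNIV hull K = dynkin_ring K"
proof (rule hull_unique)
  show "K \<subseteq> dynkin_ring K" by (auto intro: dynkin_ring.base)
  have diff: "A - B \<in> dynkin_ring K" if "A \<in> dynkin_ring K" "B \<in> dynkin_ring K" for A B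
    using dynkin_ring.Diff[OF that(1) dynkin_ring_Int[OF K that]] by (auto simp: Diff_Int)
  have "A \<union> B \<in> dynkin_ring K" if "A \<in> dynkin_ring K" "B \<in> dynkin_ring K" for A B
    using dynkin_ring.Un[OF that(1) diff[OF that(2,1)]] by auto
  then show "ring_of_sets UNIV (dynkin_ring K)"
    using diff assms(2) by (auto simp: ring_of_sets_iff intro: dynkin_ring.base)
next
  fix T assume T: "K \<subseteq> T" "ring_of_sets UNIV T"
  show "dynkin_ring K \<subseteq> T"
  proof
    fix A assume "A \<in> dynkin_ring K"
    then show "A \<in> T"
      by induction (use T in \<open>auto simp: ring_of_sets_iff\<close>)
  qed
qed

section \<open>Rectangles and their volume\<close>

text \<open>Nonemptiness is expressed by a square-summable sequence within the edges, without naming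
  a basis, so that the same parameters serve for rectangles of different bases.\<close>

definition nonempty_params :: "(nat \<Rightarrow> real) \<Rightarrow> (nat \<Rightarrow> real) \<Rightarrow> bool" where
  "nonempty_params a b \<longleftrightarrow> measurable_params a b \<and>
     (\<exists>c. summable (\<lambda>j. (c j)\<^sup>2) \<and> (\<forall>j. c j \<in> {a j..<b j}))"

text \<open>The construction of the measure rests on this property and not on orthonormality: a
  sheared orthonormal basis is in general no longer orthonormal, but it keeps this property.\<close>

definition l2_coordinates :: "(nat \<Rightarrow> 'a::real_inner) \<Rightarrow> bool" where
  "l2_coordinates e \<longleftrightarrow> range (\<lambda>x j. x \<bullet> e j) = {c. summable (\<lambda>j. (c j)\<^sup>2)}"

lemma l2_coordinates_summable:
  "l2_coordinates e \<Longrightarrow> summable (\<lambda>j. (x \<bullet> e j)\<^sup>2)"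
  using rangeI[of "\<lambda>x j. x \<bullet> e j" x] unfolding l2_coordinates_def by simp

lemma l2_coordinates_obtain:
  assumes "l2_coordinates e" "summable (\<lambda>j. (c j)\<^sup>2)"
  obtains x where "\<And>j. x \<bullet> e j = c j"
proof -
  have "c \<in> range (\<lambda>x j. x \<bullet> e j)"
    using assms unfolding l2_coordinates_def by blast
  then show ?thesis using that by auto
qed

lemma square_summable_add:
  fixes c d :: "nat \<Rightarrow> real"
  assumes "summable (\<lambda>j. (c j)\<^sup>2)" "summable (\<lambda>j. (d j)\<^sup>2)"
  shows "summable (\<lambda>j. (c j + d j)\<^sup>2)"
proof (rule summable_comparison_test')
  show "summable (\<lambda>j. 2 * (c j)\<^sup>2 + 2 * (d j)\<^sup>2)"
    using assms by (intro summable_add summable_mult)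
  show "norm ((c j + d j)\<^sup>2) \<le> 2 * (c j)\<^sup>2 + 2 * (d j)\<^sup>2" if "j \<ge> 0" for j
    using sum_squares_bound[of "c j" "d j"] by (simp only: real_norm_def abs_power2) (simp add: power2_sum)
qed

lemma square_summable_abs_le:
  fixes c d :: "nat \<Rightarrow> real"
  assumes "summable (\<lambda>j. (d j)\<^sup>2)" "\<And>j. \<bar>c j\<bar> \<le> \<bar>d j\<bar>"
  shows "summable (\<lambda>j. (c j)\<^sup>2)"
  using assms(2) by (intro summable_comparison_test'[OF assms(1)]) (simp add: abs_le_square_iff)

lemma summable_finite_change:
  fixes f g :: "nat \<Rightarrow> real"
  assumes "summable f" "finite F" "\<And>j. j \<notin> F \<Longrightarrow> g j = f j"
  shows "summable g"
proof -
  have "summable (\<lambda>j. f j + (g j - f j))"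
    using assms by (intro summable_add summable_finite[of F "\<lambda>j. g j - f j"]) auto
  then show ?thesis by simp
qed

lemma bounded_finite_change:
  fixes f g :: "nat \<Rightarrow> real"
  assumes "bounded (range f)" "finite F" "\<And>j. j \<notin> F \<Longrightarrow> g j = f j"
  shows "bounded (range g)"
proof -
  have "range g \<subseteq> range f \<union> g ` F" using assms(3) by force
  moreover have "bounded (range f \<union> g ` F)"
    using assms(1,2) by (simp add: finite_imp_bounded)
  ultimately show ?thesis using bounded_subset by blast
qed

lemma rectangle_nonempty_iff:
  assumes "l2_coordinates e"
  shows "rectangle e a b \<noteq> {} \<longleftrightarrow> (\<exists>c. summable (\<lambda>j. (c j)\<^sup>2) \<and> (\<forall>j. c j \<in> {a j..<b j}))"
proof
  assume "rectangle e a b \<noteq> {}"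
  then obtain x where "x \<in> rectangle e a b" by blast
  then show "\<exists>c. summable (\<lambda>j. (c j)\<^sup>2) \<and> (\<forall>j. c j \<in> {a j..<b j})"
    using l2_coordinates_summable[OF assms, of x]
    by (intro exI[of _ "\<lambda>j. x \<bullet> e j"]) (auto simp: rectangle_def)
next
  assume "\<exists>c. summable (\<lambda>j. (c j)\<^sup>2) \<and> (\<forall>j. c j \<in> {a j..<b j})"
  then obtain c where c: "summable (\<lambda>j. (c j)\<^sup>2)" "\<forall>j. c j \<in> {a j..<b j}" by blast
  obtain x where "\<And>j. x \<bullet> e j = c j"
    using l2_coordinates_obtain[OF assms c(1)] by blast
  then have "x \<in> rectangle e a b" using c by (auto simp: rectangle_def)
  then show "rectangle e a b \<noteq> {}" by blast
qed

lemma nonempty_params_iff: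
  "l2_coordinates e \<Longrightarrow> nonempty_params a b \<longleftrightarrow> measurable_params a b \<and> rectangle e a b \<noteq> {}"
  by (simp add: nonempty_params_def rectangle_nonempty_iff)

lemma measurable_rectangles_eq:
  "l2_coordinates e \<Longrightarrow> measurable_rectangles e = insert {} {rectangle e a b | a b. nonempty_params a b}"
  by (simp add: measurable_rectangles_def nonempty_params_iff)

lemma nonempty_params_less: "nonempty_params a b \<Longrightarrow> a j < b j"
  unfolding nonempty_params_def by (metis atLeastLessThan_iff le_less_trans)

lemma nonempty_params_measurable: "nonempty_params a b \<Longrightarrow> measurable_params a b"
  by (simp add: nonempty_params_def)

lemma nonempty_params_finite_change:
  assumes "nonempty_params a b" "finite F" "\<And>j. j \<notin> F \<Longrightarrow> a' j = a j \<and> b' j = b j"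
    "\<And>j. j \<in> F \<Longrightarrow> a' j < b' j"
  shows "nonempty_params a' b'"
proof -
  obtain c where c: "summable (\<lambda>j. (c j)\<^sup>2)" "\<forall>j. c j \<in> {a j..<b j}"
    using assms(1) by (auto simp: nonempty_params_def)
  let ?c = "\<lambda>j. if j \<in> F then a' j else c j"
  have "summable (\<lambda>j. (?c j)\<^sup>2)"
    using c(1) assms(2) by (rule summable_finite_change) auto
  moreover have "\<forall>j. ?c j \<in> {a' j..<b' j}"
    using c(2) assms(3,4) by auto
  moreover have "measurable_params a' b'"
    using assms(1,2,3) unfolding nonempty_params_def measurable_params_def
    by (auto intro: bounded_finite_change[of a F a'] bounded_finite_change[of b F b']
        summable_finite_change[of "\<lambda>j. max 0 (ln (b j - a j))" F])
  ultimately show ?thesis unfolding nonempty_params_def by (intro conjI exI[of _ ?c])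
qed

lemma rectangle_Int:
  "rectangle e a b \<inter> rectangle e a' b' = rectangle e (\<lambda>j. max (a j) (a' j)) (\<lambda>j. min (b j) (b' j))"
  by (auto simp: rectangle_def)

lemma bounded_range_max:
  fixes f g :: "nat \<Rightarrow> real"
  assumes "bounded (range f)" "bounded (range g)"
  shows "bounded (range (\<lambda>j. max (f j) (g j)))" "bounded (range (\<lambda>j. min (f j) (g j)))"
proof -
  have "range (\<lambda>j. max (f j) (g j)) \<subseteq> range f \<union> range g"
    "range (\<lambda>j. min (f j) (g j)) \<subseteq> range f \<union> range g"
    by (auto simp: max_def min_def)
  moreover have "bounded (range f \<union> range g)" using assms by simp
  ultimately show "bounded (range (\<lambda>j. max (f j) (g j)))" "bounded (range (\<lambda>j. min (f j) (g j)))"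
    using bounded_subset by blast+
qed

lemma measurable_params_Int:
  assumes "measurable_params a b" "measurable_params a' b'"
    and "\<And>j. max (a j) (a' j) < min (b j) (b' j)"
  shows "measurable_params (\<lambda>j. max (a j) (a' j)) (\<lambda>j. min (b j) (b' j))"
proof -
  have "summable (\<lambda>j. max 0 (ln (min (b j) (b' j) - max (a j) (a' j))))"
  proof (rule summable_comparison_test')
    show "summable (\<lambda>j. max 0 (ln (b j - a j)))"
      using assms(1) by (simp add: measurable_params_def)
    show "norm (max 0 (ln (min (b j) (b' j) - max (a j) (a' j)))) \<le> max 0 (ln (b j - a j))" for j
    proof -
      have "ln (min (b j) (b' j) - max (a j) (a' j)) \<le> ln (b j - a j)"
        using assms(3)[of j] by (subst ln_le_cancel_iff) auto
      then show ?thesis by auto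
    qed
  qed
  then show ?thesis
    using assms(1,2) bounded_range_max by (auto simp: measurable_params_def)
qed

lemma Int_stable_measurable_rectangles:
  "Int_stable (measurable_rectangles (e :: nat \<Rightarrow> 'a::real_inner))"
proof (rule Int_stableI)
  fix A B :: "'a set" assume AB: "A \<in> measurable_rectangles e" "B \<in> measurable_rectangles e"
  show "A \<inter> B \<in> measurable_rectangles e"
  proof (cases "A \<inter> B = {}")
    case False
    then obtain a b a' b' where *: "measurable_params a b" "A = rectangle e a b"
        "measurable_params a' b'" "B = rectangle e a' b'"
      using AB by (auto simp: measurable_rectangles_def)
    have "max (a j) (a' j) < min (b j) (b' j)" for j
    proof -
      from False obtain x where "x \<in> A" "x \<in> B" by blast
      then have "a j \<le> x \<bullet> e j" "x \<bullet> e j < b j" "a' j \<le> x \<bullet> e j" "x \<bullet> e j < b' j"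
        using * by (auto simp: rectangle_def)
      then show ?thesis by auto
    qed
    then show ?thesis
      using False measurable_params_Int[OF *(1,3)] *
      unfolding measurable_rectangles_def by (auto simp: rectangle_Int)
  qed (simp add: measurable_rectangles_def)
qed

lemma rectangle_ring_eq: "rectangle_ring e = dynkin_ring (measurable_rectangles e)"
  unfolding rectangle_ring_def
  by (rule dynkin_ring_eq_hull[OF Int_stable_measurable_rectangles])
    (simp add: measurable_rectangles_def)

lemma rectangle_ring_ring: "ring_of_sets UNIV (rectangle_ring e)"
  unfolding rectangle_ring_def by (rule ring_of_sets_hull)

lemma rectangle_mem_ring:
  assumes "l2_coordinates e" "nonempty_params a b"
  shows "rectangle e a b \<in> rectangle_ring e"
  unfolding rectangle_ring_eq
  by (rule dynkin_ring.base) (use assms in \<open>auto simp: measurable_rectangles_eq\<close>)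

section \<open>The volume as a limit of finite products\<close>

lemma nonneg_series_at_top:
  fixes f :: "nat \<Rightarrow> real"
  assumes "\<not> summable f" "\<And>j. 0 \<le> f j"
  shows "filterlim (\<lambda>m. \<Sum>j<m. f j) at_top sequentially"
  unfolding filterlim_at_top
proof
  fix Z
  obtain n where "Z < (\<Sum>j<n. f j)"
    using summableI_nonneg_bounded[of f Z] assms by (meson not_le)
  moreover have "(\<Sum>j<n. f j) \<le> (\<Sum>j<m. f j)" if "m \<ge> n" for m
    using assms(2) that by (intro sum_mono2) auto
  ultimately show "\<forall>\<^sub>F m in sequentially. Z \<le> (\<Sum>j<m. f j)"
    using eventually_sequentially by (meson less_imp_le order_trans)
qed

text \<open>This merges the two cases of \<open>rectangle_volume\<close>: if the logarithms are not
  summable although their positive parts are, the negative parts diverge and the finite products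
  tend to 0. Later volume estimates work with the finite products.\<close>

lemma rectangle_volume_tendsto:
  assumes "\<And>j. a j < b j" "measurable_params a b"
  shows "(\<lambda>m. \<Prod>j<m. b j - a j) \<longlonglongrightarrow> rectangle_volume a b"
proof -
  define l where "l j = ln (b j - a j)" for j
  have prod_eq: "(\<Prod>j<m. b j - a j) = exp (\<Sum>j<m. l j)" for m
    using assms(1) by (simp add: exp_sum l_def)
  show ?thesis
  proof (cases "summable l")
    case True
    then have "(\<lambda>m. exp (\<Sum>j<m. l j)) \<longlonglongrightarrow> exp (suminf l)"
      by (intro tendsto_exp summable_LIMSEQ)
    then show ?thesis
      using True unfolding prod_eq rectangle_volume_def l_def by simp
  next
    case False
    have pos: "summable (\<lambda>j. max 0 (l j))"
      using assms(2) by (simp add: measurable_params_def l_def)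
    have "\<not> summable (\<lambda>j. max 0 (- l j))"
    proof
      assume "summable (\<lambda>j. max 0 (- l j))"
      from summable_diff[OF pos this] have "summable (\<lambda>j. max 0 (l j) - max 0 (- l j))" .
      also have "(\<lambda>j. max 0 (l j) - max 0 (- l j)) = l" by (auto simp: max_def)
      finally show False using False by simp
    qed
    then have neg: "filterlim (\<lambda>m. \<Sum>j<m. max 0 (- l j)) at_top sequentially"
      by (rule nonneg_series_at_top) auto
    have "filterlim (\<lambda>m. (\<Sum>j<m. l j)) at_bot sequentially"
    proof (rule filterlim_at_bot_mono)
      show "filterlim (\<lambda>m. - ((- (\<Sum>j. max 0 (l j))) + (\<Sum>j<m. max 0 (- l j)))) at_bot sequentially"
        by (rule filterlim_compose[OF filterlim_uminus_at_bot_at_top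
              filterlim_tendsto_add_at_top[OF tendsto_const neg]])
      have "(\<Sum>j<m. l j) \<le> - ((- (\<Sum>j. max 0 (l j))) + (\<Sum>j<m. max 0 (- l j)))" for m
      proof -
        have "(\<Sum>j<m. l j) = (\<Sum>j<m. max 0 (l j)) - (\<Sum>j<m. max 0 (- l j))"
          unfolding sum_subtractf[symmetric] by (intro sum.cong) (auto simp: max_def)
        moreover have "(\<Sum>j<m. max 0 (l j)) \<le> (\<Sum>j. max 0 (l j))"
          using pos by (intro sum_le_suminf) auto
        ultimately show ?thesis by simp
      qed
      then show "\<forall>\<^sub>F m in sequentially. (\<Sum>j<m. l j) \<le> - ((- (\<Sum>j. max 0 (l j))) + (\<Sum>j<m. max 0 (- l j)))"
        by simp
    qed
    then have "(\<lambda>m. exp (\<Sum>j<m. l j)) \<longlonglongrightarrow> 0"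
      by (rule filterlim_compose[OF exp_at_bot])
    then show ?thesis
      using False unfolding prod_eq rectangle_volume_def l_def by simp
  qed
qed

lemma rectangle_volume_nonneg: "0 \<le> rectangle_volume a b"
  by (simp add: rectangle_volume_def)

text \<open>Multiplied out crosswise instead of written as a quotient of volumes, so that rectangles
  of volume 0 are covered too.\<close>

lemma rectangle_volume_finite_change:
  assumes ab: "nonempty_params a b" and ab': "nonempty_params a' b'"
    and F: "finite F" "\<And>j. j \<notin> F \<Longrightarrow> b' j - a' j = b j - a j"
  shows "rectangle_volume a' b' * (\<Prod>j\<in>F. b j - a j) = rectangle_volume a b * (\<Prod>j\<in>F. b' j - a' j)"
proof -
  have L: "(\<lambda>m. (\<Prod>j<m. b' j - a' j) * (\<Prod>j\<in>F. b j - a j)) \<longlonglongrightarrow> rectangle_volume a' b' * (\<Prod>j\<in>F. b j - a j)"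
    using ab' by (intro tendsto_mult_right rectangle_volume_tendsto nonempty_params_less nonempty_params_measurable)
  have R: "(\<lambda>m. (\<Prod>j<m. b j - a j) * (\<Prod>j\<in>F. b' j - a' j)) \<longlonglongrightarrow> rectangle_volume a b * (\<Prod>j\<in>F. b' j - a' j)"
    using ab by (intro tendsto_mult_right rectangle_volume_tendsto nonempty_params_less nonempty_params_measurable)
  obtain n where n: "F \<subseteq> {..<n}"
    using F(1) finite_nat_iff_bounded by blast
  have "(\<Prod>j<m. b' j - a' j) * (\<Prod>j\<in>F. b j - a j) = (\<Prod>j<m. b j - a j) * (\<Prod>j\<in>F. b' j - a' j)" if "m \<ge> n" for m
  proof -
    have sub: "F \<subseteq> {..<m}" using n that by auto
    have "(\<Prod>j\<in>{..<m} - F. b' j - a' j) = (\<Prod>j\<in>{..<m} - F. b j - a j)"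
      using F(2) by (intro prod.cong) auto
    then show ?thesis
      using prod.subset_diff[OF sub finite_lessThan, of "\<lambda>j. b' j - a' j"]
        prod.subset_diff[OF sub finite_lessThan, of "\<lambda>j. b j - a j"] by (simp add: mult_ac)
  qed
  then have "\<forall>\<^sub>F m in sequentially. (\<Prod>j<m. b' j - a' j) * (\<Prod>j\<in>F. b j - a j) = (\<Prod>j<m. b j - a j) * (\<Prod>j\<in>F. b' j - a' j)"
    using eventually_sequentially by blast
  from Lim_transform_eventually[OF L this] R show ?thesis
    using LIMSEQ_unique by blast
qed

section \<open>Existence and uniqueness of the rectangle measure\<close>

lemma interval_combination_nonneg:
  fixes d a b :: "'i \<Rightarrow> real"
  assumes "finite I" "\<And>i. i \<in> I \<Longrightarrow> a i \<le> b i"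
    and "\<And>t. 0 \<le> (\<Sum>i\<in>I. d i * indicator {a i..<b i} t)"
  shows "0 \<le> (\<Sum>i\<in>I. d i * (b i - a i))"
proof -
  have int: "integrable lborel (\<lambda>t. d i * indicator {a i..<b i} t :: real)" if "i \<in> I" for i
    using assms(2)[OF that] by (intro integrable_mult_right integrable_real_indicator) auto
  have "0 \<le> (\<integral>t. (\<Sum>i\<in>I. d i * indicator {a i..<b i} t) \<partial>lborel)"
    using assms(3) by (intro Bochner_Integration.integral_nonneg) auto
  also have "\<dots> = (\<Sum>i\<in>I. \<integral>t. d i * indicator {a i..<b i} t \<partial>lborel)"
    using int by (rule Bochner_Integration.integral_sum)
  also have "\<dots> = (\<Sum>i\<in>I. d i * (b i - a i))"
    using assms(2) by (intro sum.cong) auto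
  finally show ?thesis .
qed

text \<open>Fubini by hand. For a fixed last coordinate \<open>t\<close> the indicator at
  \<open>t\<close> is absorbed into the coefficients, which is why the induction keeps
  \<open>c\<close> arbitrary; what remains is a nonnegative combination of intervals in
  \<open>t\<close>, and this is integrated.\<close>

lemma box_combination_nonneg:
  fixes c :: "'i \<Rightarrow> real" and a b :: "'i \<Rightarrow> nat \<Rightarrow> real"
  assumes "finite I" "\<And>i j. i \<in> I \<Longrightarrow> a i j \<le> b i j"
    and "\<And>y. 0 \<le> (\<Sum>i\<in>I. c i * (\<Prod>j<m. indicator {a i j..<b i j} (y j)))"
  shows "0 \<le> (\<Sum>i\<in>I. c i * (\<Prod>j<m. b i j - a i j))"
  using assms(3)
proof (induction m arbitrary: c)
  case 0
  then show ?case by simp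
next
  case (Suc m)
  have "0 \<le> (\<Sum>i\<in>I. (c i * (\<Prod>j<m. b i j - a i j)) * indicator {a i m..<b i m} t)" for t
  proof -
    have "0 \<le> (\<Sum>i\<in>I. (c i * indicator {a i m..<b i m} t) * (\<Prod>j<m. b i j - a i j))"
    proof (rule Suc.IH)
      fix y :: "nat \<Rightarrow> real"
      have "(\<Prod>j<m. indicator {a i j..<b i j} ((y(m := t)) j) :: real) = (\<Prod>j<m. indicator {a i j..<b i j} (y j))" for i
        by (intro prod.cong) auto
      then show "0 \<le> (\<Sum>i\<in>I. c i * indicator {a i m..<b i m} t * (\<Prod>j<m. indicator {a i j..<b i j} (y j)))"
        using Suc.prems[of "y(m := t)"] by (simp add: mult_ac)
    qed
    then show ?thesis by (simp add: mult_ac)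
  qed
  from interval_combination_nonneg[OF assms(1) assms(2) this]
  show ?case by (simp add: mult_ac)
qed

lemma square_summable_sum_abs:
  fixes z :: "'i \<Rightarrow> nat \<Rightarrow> real"
  assumes "finite T" "\<And>i. i \<in> T \<Longrightarrow> summable (\<lambda>j. (z i j)\<^sup>2)"
  shows "summable (\<lambda>j. (\<Sum>i\<in>T. \<bar>z i j\<bar>)\<^sup>2)"
  using assms
proof (induction T rule: finite_induct)
  case (insert i T)
  have "summable (\<lambda>j. (\<bar>z i j\<bar> + (\<Sum>i\<in>T. \<bar>z i j\<bar>))\<^sup>2)"
    using insert by (intro square_summable_add) auto
  then show ?case using insert by simp
qed auto

text \<open>If two of the boxes are disjoint then they are separated in one of the first \<open>m\<close> coordinates
  for large \<open>m\<close>. A point of the \<open>m\<close>-dimensional projections then extends to a square-summable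
  sequence that lies in the same boxes, so the inequality between the indicator functions
  passes to the first \<open>m\<close> coordinates, where it can be integrated.\<close>

lemma rectangle_combination_nonneg:
  fixes c :: "'i \<Rightarrow> real" and a b :: "'i \<Rightarrow> nat \<Rightarrow> real"
  assumes fin: "finite I" and good: "\<And>i. i \<in> I \<Longrightarrow> nonempty_params (a i) (b i)"
    and pos: "\<And>y. summable (\<lambda>j. (y j)\<^sup>2) \<Longrightarrow> 0 \<le> (\<Sum>i\<in>I. c i * of_bool (\<forall>j. y j \<in> {a i j..<b i j}))"
  shows "0 \<le> (\<Sum>i\<in>I. c i * rectangle_volume (a i) (b i))"
proof -
  define meets where "meets i k j \<longleftrightarrow> a i j < b k j \<and> a k j < b i j" for i k j
  have "\<exists>m. \<forall>p\<in>I\<times>I. (\<exists>j. \<not> meets (fst p) (snd p) j) \<longrightarrow> (\<exists>j<m. \<not> meets (fst p) (snd p) j)"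
  proof -
    have "\<forall>p. \<exists>m. (\<exists>j. \<not> meets (fst p) (snd p) j) \<longrightarrow> (\<exists>j<m. \<not> meets (fst p) (snd p) j)"
      by blast
    then obtain M where M: "\<And>p. (\<exists>j. \<not> meets (fst p) (snd p) j) \<longrightarrow> (\<exists>j<M p. \<not> meets (fst p) (snd p) j)"
      by metis
    have "M p \<le> (\<Sum>p\<in>I\<times>I. M p)" if "p \<in> I \<times> I" for p
      using fin that by (intro member_le_sum) auto
    then have "(\<exists>j<(\<Sum>p\<in>I\<times>I. M p). \<not> meets (fst p) (snd p) j)"
      if "p \<in> I \<times> I" "\<exists>j. \<not> meets (fst p) (snd p) j" for p
      using M[of p] that less_le_trans by blast
    then show ?thesis by (intro exI[of _ "\<Sum>p\<in>I\<times>I. M p"]) blast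
  qed
  then obtain m where "\<forall>p\<in>I\<times>I. (\<exists>j. \<not> meets (fst p) (snd p) j) \<longrightarrow> (\<exists>j<m. \<not> meets (fst p) (snd p) j)" ..
  note m = this[rule_format, of "(i, k)" for i k, simplified]
  have "\<forall>i\<in>I. \<exists>z. summable (\<lambda>j. (z j)\<^sup>2) \<and> (\<forall>j. z j \<in> {a i j..<b i j})"
    using good unfolding nonempty_params_def by blast
  then obtain z where z: "\<And>i. i \<in> I \<Longrightarrow> summable (\<lambda>j. (z i j)\<^sup>2)"
    "\<And>i j. i \<in> I \<Longrightarrow> z i j \<in> {a i j..<b i j}"
    by metis
  have trunc: "0 \<le> (\<Sum>i\<in>I. c i * (\<Prod>j<n. indicator {a i j..<b i j} (y j)))" if "n \<ge> m" for n y
  proof -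
    define T where "T = {i\<in>I. \<forall>j<n. y j \<in> {a i j..<b i j}}"
    have T: "finite T" "T \<subseteq> I" using fin by (auto simp: T_def)
    have meets: "meets i k j" if ik: "i \<in> T" "k \<in> T" for i k j
    proof (rule ccontr)
      assume "\<not> meets i k j"
      then obtain j' where "j' < m" "\<not> meets i k j'"
        using m[of i k] T(2) ik by (meson subsetD)
      moreover from this have "y j' \<in> {a i j'..<b i j'}" "y j' \<in> {a k j'..<b k j'}"
        using that \<open>n \<ge> m\<close> by (auto simp: T_def)
      ultimately show False by (auto simp: meets_def)
    qed
    \<comment> \<open>A point common to the tail edges of all boxes in \<open>T\<close>. The largest
      left endpoint alone would lie in all of them but need not be square-summable in
      \<open>j\<close>. Raising it to at least the smallest \<open>z i j\<close> places it between
      two of the values \<open>z i j\<close>, hence below the sum of their moduli.\<close>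
    define w where "w j = (if T = {} then 0 else max (Max ((\<lambda>i. a i j) ` T)) (Min ((\<lambda>i. z i j) ` T)))" for j
    define y' where "y' j = (if j < n then y j else w j)" for j
    have w: "w j \<in> {a i j..<b i j}" if "i \<in> T" for i j
    proof -
      have "a i j \<le> Max ((\<lambda>i. a i j) ` T)" using T(1) that by (intro Max_ge) auto
      moreover have "Max ((\<lambda>i. a i j) ` T) < b i j"
        using T(1) that meets by (subst Max_less_iff) (auto simp: meets_def)
      moreover have "Min ((\<lambda>i. z i j) ` T) \<le> z i j" using T(1) that by (intro Min_le) auto
      moreover have "z i j < b i j" using z(2) T(2) that by fastforce
      ultimately show ?thesis using that unfolding w_def by auto
    qed
    have w_le: "\<bar>w j\<bar> \<le> \<bar>\<Sum>i\<in>T. \<bar>z i j\<bar>\<bar>" for j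
    proof (cases "T = {}")
      case False
      have z_le: "\<bar>z i j\<bar> \<le> (\<Sum>i\<in>T. \<bar>z i j\<bar>)" if "i \<in> T" for i
        using T(1) that by (intro member_le_sum) auto
      have "Min ((\<lambda>i. z i j) ` T) \<in> (\<lambda>i. z i j) ` T" "Max ((\<lambda>i. a i j) ` T) \<in> (\<lambda>i. a i j) ` T"
        using T(1) False by (simp_all add: Min_in Max_in)
      then obtain i k where i: "i \<in> T" "Min ((\<lambda>i. z i j) ` T) = z i j"
        and k: "k \<in> T" "Max ((\<lambda>i. a i j) ` T) = a k j"
        by blast
      have "a k j \<le> z k j" using z(2) T(2) k by fastforce
      moreover have "w j = max (a k j) (z i j)" using False i k by (simp add: w_def)
      ultimately show ?thesis using z_le[OF i(1)] z_le[OF k(1)] by auto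
    qed (simp add: w_def)
    have "summable (\<lambda>j. (w j)\<^sup>2)"
      by (rule square_summable_abs_le[OF square_summable_sum_abs[OF T(1), of z] w_le])
        (use z(1) T(2) in auto)
    then have "summable (\<lambda>j. (y' j)\<^sup>2)"
      by (rule summable_finite_change[where F = "{..<n}"]) (auto simp: y'_def)
    from pos[OF this] have "0 \<le> (\<Sum>i\<in>I. c i * of_bool (\<forall>j. y' j \<in> {a i j..<b i j}))" .
    also have "\<dots> = (\<Sum>i\<in>I. c i * (\<Prod>j<n. indicator {a i j..<b i j} (y j)))"
    proof (intro sum.cong refl)
      fix i assume "i \<in> I"
      show "c i * of_bool (\<forall>j. y' j \<in> {a i j..<b i j}) = c i * (\<Prod>j<n. indicator {a i j..<b i j} (y j))"
      proof (cases "i \<in> T")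
        case True
        then have "\<forall>j. y' j \<in> {a i j..<b i j}"
          using w by (auto simp: y'_def T_def)
        moreover have "(\<Prod>j<n. indicator {a i j..<b i j} (y j)) = (1::real)"
          using True by (intro prod.neutral) (auto simp: T_def)
        ultimately show ?thesis by simp
      next
        case False
        then obtain j where j: "j < n" "y j \<notin> {a i j..<b i j}"
          using \<open>i \<in> I\<close> by (auto simp: T_def)
        then have "y' j \<notin> {a i j..<b i j}" by (simp add: y'_def)
        then have "of_bool (\<forall>j. y' j \<in> {a i j..<b i j}) = (0::real)" by auto
        moreover have "(\<Prod>j<n. indicator {a i j..<b i j} (y j)) = (0::real)"
          using j by (intro prod_zero bexI[of _ j]) auto
        ultimately show ?thesis by (simp only: mult_zero_right)
      qed
    qed
    finally show ?thesis .
  qed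
  have less: "a i j < b i j" if "i \<in> I" for i j
    using nonempty_params_less[OF good[OF that]] .
  have "0 \<le> (\<Sum>i\<in>I. c i * (\<Prod>j<n. b i j - a i j))" if "n \<ge> m" for n
    by (rule box_combination_nonneg[OF fin less_imp_le[OF less] trunc[OF that]])
  moreover have "(\<lambda>n. \<Sum>i\<in>I. c i * (\<Prod>j<n. b i j - a i j)) \<longlonglongrightarrow> (\<Sum>i\<in>I. c i * rectangle_volume (a i) (b i))"
    using good less
    by (intro tendsto_sum tendsto_mult_left rectangle_volume_tendsto nonempty_params_measurable)
  ultimately show ?thesis
    by (intro LIMSEQ_le_const) auto
qed

section \<open>Signed formal sums of boxes\<close>

type_synonym box_combination = "(real \<times> (nat \<Rightarrow> real) \<times> (nat \<Rightarrow> real)) list"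

definition combination_value :: "box_combination \<Rightarrow> (nat \<Rightarrow> real) \<Rightarrow> real" where
  "combination_value L y = (\<Sum>(c, a, b)\<leftarrow>L. c * of_bool (\<forall>j. y j \<in> {a j..<b j}))"

definition combination_volume :: "box_combination \<Rightarrow> real" where
  "combination_volume L = (\<Sum>(c, a, b)\<leftarrow>L. c * rectangle_volume a b)"

text \<open>A set of the ring has many such representations; the volume of any of them is the
  candidate for its measure. With lists as formal sums, union becomes concatenation and difference
  becomes concatenation with negated coefficients.\<close>

definition represents :: "(nat \<Rightarrow> 'a::real_inner) \<Rightarrow> box_combination \<Rightarrow> 'a set \<Rightarrow> bool" where
  "represents e L A \<longleftrightarrow> (\<forall>(c, a, b)\<in>set L. nonempty_params a b) \<and>
     (\<forall>x. of_bool (x \<in> A) = combination_value L (\<lambda>j. x \<bullet> e j))"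

definition negate_combination :: "box_combination \<Rightarrow> box_combination" where
  "negate_combination L = map (\<lambda>(c, a, b). (- c, a, b)) L"

lemma combination_append [simp]:
  "combination_value (L @ L') y = combination_value L y + combination_value L' y"
  "combination_volume (L @ L') = combination_volume L + combination_volume L'"
  by (simp_all add: combination_value_def combination_volume_def)

lemma negate_combination [simp]:
  "combination_value (negate_combination L) y = - combination_value L y"
  "combination_volume (negate_combination L) = - combination_volume L"
  by (induction L) (auto simp: combination_value_def combination_volume_def negate_combination_def)

lemma represents_Un:
  assumes "represents e L A" "represents e L' B" "A \<inter> B = {}"
  shows "represents e (L @ L') (A \<union> B)"
proof -
  have "of_bool (x \<in> A \<union> B) = (of_bool (x \<in> A) + of_bool (x \<in> B) :: real)" for x
    using assms(3) by auto
  then show ?thesis using assms(1,2) by (auto simp: represents_def)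
qed

lemma represents_Diff:
  assumes "represents e L A" "represents e L' B" "B \<subseteq> A"
  shows "represents e (L @ negate_combination L') (A - B)"
proof -
  have "of_bool (x \<in> A - B) = (of_bool (x \<in> A) - of_bool (x \<in> B) :: real)" for x
    using assms(3) by auto
  moreover have "\<forall>(c, a, b)\<in>set (negate_combination L'). nonempty_params a b"
    using assms(2) by (auto simp: represents_def negate_combination_def)
  ultimately show ?thesis using assms(1,2) by (auto simp: represents_def)
qed

lemma represents_rectangle:
  "nonempty_params a b \<Longrightarrow> represents e [(1, a, b)] (rectangle e a b)"
  by (auto simp: represents_def combination_value_def rectangle_def)

lemma represents_empty: "represents e [] {}"
  by (auto simp: represents_def combination_value_def)

lemma combination_volume_nonneg:
  assumes "\<forall>(c, a, b)\<in>set L. nonempty_params a b"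
    and "\<And>y. summable (\<lambda>j. (y j)\<^sup>2) \<Longrightarrow> 0 \<le> combination_value L y"
  shows "0 \<le> combination_volume L"
proof -
  define c a b where "c i = fst (L ! i)" and "a i = fst (snd (L ! i))" and "b i = snd (snd (L ! i))" for i
  have val: "combination_value L y = (\<Sum>i\<in>{0..<length L}. c i * of_bool (\<forall>j. y j \<in> {a i j..<b i j}))" for y
    by (simp add: combination_value_def sum_list_sum_nth case_prod_unfold c_def a_def b_def)
  have vol: "combination_volume L = (\<Sum>i\<in>{0..<length L}. c i * rectangle_volume (a i) (b i))"
    by (simp add: combination_volume_def sum_list_sum_nth case_prod_unfold c_def a_def b_def)
  show ?thesis unfolding vol
  proof (rule rectangle_combination_nonneg)
    show "nonempty_params (a i) (b i)" if "i \<in> {0..<length L}" for i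
      using assms(1) nth_mem[of i L] that by (auto simp: a_def b_def case_prod_unfold)
  qed (use assms(2) val in auto)
qed

text \<open>The difference of the two combinations represents \<open>B - A\<close>, so its value is
  nonnegative at every square-summable sequence. With \<open>A = B\<close> this shows that the
  volume does not depend on the representation, and with \<open>A\<close> empty that it is
  nonnegative.\<close>

lemma represents_volume_mono:
  assumes "l2_coordinates e" "represents e L A" "represents e L' B" "A \<subseteq> B"
  shows "combination_volume L \<le> combination_volume L'"
proof -
  have rep: "represents e (L' @ negate_combination L) (B - A)"
    using assms by (intro represents_Diff)
  have "0 \<le> combination_volume (L' @ negate_combination L)"
  proof (rule combination_volume_nonneg)
    fix y :: "nat \<Rightarrow> real" assume "summable (\<lambda>j. (y j)\<^sup>2)"
    from l2_coordinates_obtain[OF assms(1) this] obtain x where "\<And>j. x \<bullet> e j = y j" by blast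
    then have "combination_value (L' @ negate_combination L) y = of_bool (x \<in> B - A)"
      using rep unfolding represents_def by simp
    then show "0 \<le> combination_value (L' @ negate_combination L) y" by simp
  qed (use rep in \<open>simp add: represents_def\<close>)
  then show ?thesis by simp
qed

lemma rectangle_ring_induct [consumes 2, case_names empty rectangle Un Diff]:
  assumes "l2_coordinates e" "A \<in> rectangle_ring e"
    and "P {}"
    and "\<And>a b. nonempty_params a b \<Longrightarrow> P (rectangle e a b)"
    and "\<And>A B. A \<in> rectangle_ring e \<Longrightarrow> B \<in> rectangle_ring e \<Longrightarrow> P A \<Longrightarrow> P B \<Longrightarrow> A \<inter> B = {} \<Longrightarrow> P (A \<union> B)"
    and "\<And>A B. A \<in> rectangle_ring e \<Longrightarrow> B \<in> rectangle_ring e \<Longrightarrow> P A \<Longrightarrow> P B \<Longrightarrow> B \<subseteq> A \<Longrightarrow> P (A - B)"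
  shows "P A"
  using assms(2) unfolding rectangle_ring_eq
proof induction
  case (base A)
  then show ?case using assms(3,4) by (auto simp: measurable_rectangles_eq[OF assms(1)])
qed (use assms(5,6) in \<open>auto simp: rectangle_ring_eq\<close>)

lemma rectangle_ring_represents:
  assumes "l2_coordinates e" "A \<in> rectangle_ring e"
  shows "\<exists>L. represents e L A"
  using assms
proof (induction rule: rectangle_ring_induct)
  case empty
  then show ?case using represents_empty by blast
next
  case (rectangle a b)
  then show ?case using represents_rectangle by blast
next
  case (Un A B)
  then show ?case using represents_Un by blast
next
  case (Diff A B)
  then show ?case using represents_Diff by blast
qed

section \<open>Translations\<close>

lemma nonempty_params_shift:
  assumes "nonempty_params a b" "summable (\<lambda>j. (s j)\<^sup>2)"
  shows "nonempty_params (\<lambda>j. a j + s j) (\<lambda>j. b j + s j)"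
proof -
  obtain c where c: "summable (\<lambda>j. (c j)\<^sup>2)" "\<forall>j. c j \<in> {a j..<b j}"
    using assms(1) by (auto simp: nonempty_params_def)
  have "(\<lambda>j. (s j)\<^sup>2) \<longlonglongrightarrow> 0" using assms(2) by (rule summable_LIMSEQ_zero)
  then have "s \<longlonglongrightarrow> 0" by (simp add: power_tendsto_0_iff)
  then have s: "bounded (range s)" by (rule convergent_imp_bounded)
  have "bounded (range (\<lambda>j. a j + s j))" "bounded (range (\<lambda>j. b j + s j))"
    using assms(1) s by (auto simp: nonempty_params_def measurable_params_def intro!: bounded_plus_comp)
  then have "measurable_params (\<lambda>j. a j + s j) (\<lambda>j. b j + s j)"
    using assms(1) by (simp add: nonempty_params_def measurable_params_def)
  moreover have "summable (\<lambda>j. (c j + s j)\<^sup>2)" using c assms(2) by (intro square_summable_add)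
  ultimately show ?thesis
    using c(2) unfolding nonempty_params_def by (intro conjI exI[of _ "\<lambda>j. c j + s j"]) auto
qed

lemma rectangle_shift:
  "(+) x ` rectangle e a b = rectangle e (\<lambda>j. a j + x \<bullet> e j) (\<lambda>j. b j + x \<bullet> e j)"
proof safe
  fix y assume "y \<in> rectangle e (\<lambda>j. a j + x \<bullet> e j) (\<lambda>j. b j + x \<bullet> e j)"
  then have "y - x \<in> rectangle e a b" by (auto simp: rectangle_def inner_diff_left algebra_simps)
  then show "y \<in> (+) x ` rectangle e a b" by (rule rev_image_eqI) simp
qed (auto simp: rectangle_def inner_add_left)

lemma rectangle_ring_shift:
  assumes "l2_coordinates e" "A \<in> rectangle_ring e"
  shows "(+) x ` A \<in> rectangle_ring e"
  using assms
proof (induction rule: rectangle_ring_induct)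
  case empty
  then show ?case using rectangle_ring_ring[of e] by (simp add: ring_of_sets_iff)
next
  case (rectangle a b)
  then show ?case
    using nonempty_params_shift[OF rectangle l2_coordinates_summable[OF assms(1)]]
    by (simp add: rectangle_shift rectangle_mem_ring[OF assms(1)])
next
  case (Un A B)
  then show ?case using rectangle_ring_ring[of e] by (simp add: ring_of_sets_iff image_Un)
next
  case (Diff A B)
  then show ?case using rectangle_ring_ring[of e] by (simp add: ring_of_sets_iff image_set_diff)
qed

lemma rectangle_volume_shift: "rectangle_volume (\<lambda>j. a j + s j) (\<lambda>j. b j + s j) = rectangle_volume a b"
  by (simp add: rectangle_volume_def)

lemma represents_shift:
  assumes "l2_coordinates e" "represents e L A"
  shows "\<exists>L'. represents e L' ((+) x ` A) \<and> combination_volume L' = combination_volume L"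
proof -
  let ?s = "\<lambda>j. x \<bullet> e j"
  let ?L = "map (\<lambda>(c, a, b). (c, \<lambda>j. a j + ?s j, \<lambda>j. b j + ?s j)) L"
  have vol: "combination_volume ?L = combination_volume L"
    by (simp add: combination_volume_def o_def case_prod_unfold rectangle_volume_shift)
  have val: "combination_value ?L (\<lambda>j. y \<bullet> e j) = combination_value L (\<lambda>j. (y - x) \<bullet> e j)" for y
  proof -
    have eq: "(\<forall>j. y \<bullet> e j \<in> {a j + ?s j..<b j + ?s j}) \<longleftrightarrow> (\<forall>j. (y - x) \<bullet> e j \<in> {a j..<b j})" for a b
      by (auto simp: inner_diff_left algebra_simps)
    show ?thesis
      unfolding combination_value_def by (simp only: map_map o_def case_prod_unfold fst_conv snd_conv eq)
  qed
  have "\<forall>(c, a, b)\<in>set ?L. nonempty_params a b"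
    using assms nonempty_params_shift[OF _ l2_coordinates_summable[OF assms(1)]]
    by (fastforce simp: represents_def)
  moreover have "y \<in> (+) x ` A \<longleftrightarrow> y - x \<in> A" for y
    by (auto intro: rev_image_eqI)
  ultimately have "represents e ?L ((+) x ` A)"
    using assms(2) unfolding represents_def val by auto
  with vol show ?thesis by blast
qed

lemma extends_volume_exists:
  assumes e: "l2_coordinates e"
  shows "\<exists>\<mu>. \<mu> \<in> extensional (rectangle_ring e) \<and> extends_volume e \<mu>"
proof -
  \<comment> \<open>The choice of \<open>L\<close> does not matter, by
    \<open>represents_volume_mono\<close> for equal sets in both directions.\<close>
  define \<mu> where "\<mu> = restrict (\<lambda>A. combination_volume (SOME L. represents e L A)) (rectangle_ring e)"
  have \<mu>_eq: "\<mu> A = combination_volume L" if "A \<in> rectangle_ring e" "represents e L A" for A L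
  proof -
    have "represents e (SOME L. represents e L A) A"
      using that(2) by (rule someI)
    then have "combination_volume (SOME L. represents e L A) = combination_volume L"
      using represents_volume_mono[OF e] that(2) by (simp add: order_antisym)
    then show ?thesis using that(1) by (simp add: \<mu>_def)
  qed
  have empty: "{} \<in> rectangle_ring e"
    using rectangle_ring_ring[of e] by (simp add: ring_of_sets_iff)
  have \<mu>_empty: "\<mu> {} = 0"
    using \<mu>_eq[OF empty represents_empty] by (simp add: combination_volume_def)
  have "extends_volume e \<mu>"
    unfolding extends_volume_def
  proof (intro conjI ballI allI impI)
    show "\<mu> {} = 0" by fact
    show "0 \<le> \<mu> A" if A: "A \<in> rectangle_ring e" for A
    proof -
      obtain L where "represents e L A" using rectangle_ring_represents[OF e A] by blast
      then show ?thesis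
        using represents_volume_mono[OF e represents_empty] \<mu>_eq[OF A]
        by (simp add: combination_volume_def)
    qed
    show "additive (rectangle_ring e) \<mu>"
      unfolding additive_def
    proof (intro ballI impI)
      fix A B assume AB: "A \<in> rectangle_ring e" "B \<in> rectangle_ring e" "A \<inter> B = {}"
      obtain L L' where L: "represents e L A" "represents e L' B"
        using AB(1,2) rectangle_ring_represents[OF e] by blast
      have "A \<union> B \<in> rectangle_ring e"
        using AB rectangle_ring_ring[of e] by (simp add: ring_of_sets_iff)
      then show "\<mu> (A \<union> B) = \<mu> A + \<mu> B"
        using \<mu>_eq[OF _ represents_Un[OF L AB(3)]] \<mu>_eq[OF AB(1) L(1)] \<mu>_eq[OF AB(2) L(2)] by simp
    qed
    show "\<mu> ((+) x ` A) = \<mu> A" if A: "A \<in> rectangle_ring e" for A x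
    proof -
      obtain L where L: "represents e L A" using rectangle_ring_represents[OF e A] by blast
      obtain L' where "represents e L' ((+) x ` A)" "combination_volume L' = combination_volume L"
        using represents_shift[OF e L] by blast
      then show ?thesis
        using \<mu>_eq[OF A L] \<mu>_eq[OF rectangle_ring_shift[OF e A]] by simp
    qed
    show "\<mu> (rectangle e a b) = rectangle_volume a b"
      if "measurable_params a b \<and> rectangle e a b \<noteq> {}" for a b
    proof -
      have "nonempty_params a b" using that e by (simp add: nonempty_params_iff)
      then show ?thesis
        using \<mu>_eq[OF rectangle_mem_ring[OF e] represents_rectangle]
        by (simp add: combination_volume_def)
    qed
  qed
  moreover have "\<mu> \<in> extensional (rectangle_ring e)" by (simp add: \<mu>_def)
  ultimately show ?thesis by blast
qed

lemma additive_Diff: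
  assumes "ring_of_sets UNIV R" "additive R \<mu>" "A \<in> R" "B \<in> R" "B \<subseteq> A"
  shows "\<mu> (A - B) = \<mu> A - (\<mu> B :: real)"
proof -
  have "\<mu> (B \<union> (A - B)) = \<mu> B + \<mu> (A - B)"
    using assms by (intro additiveD[OF assms(2)]) (auto simp: ring_of_sets_iff)
  then show ?thesis using assms(5) by (simp add: Un_absorb1)
qed

lemma extends_volume_unique:
  assumes e: "l2_coordinates e" and \<mu>: "extends_volume e \<mu>" and \<nu>: "extends_volume e \<nu>"
    and A: "A \<in> rectangle_ring e"
  shows "\<mu> A = \<nu> A"
  using e A
proof (induction rule: rectangle_ring_induct)
  case empty
  then show ?case using \<mu> \<nu> by (simp add: extends_volume_def)
next
  case (rectangle a b)
  then show ?case using \<mu> \<nu> e by (simp add: extends_volume_def nonempty_params_iff)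
next
  case (Un A B)
  then have "\<mu> (A \<union> B) = \<mu> A + \<mu> B" "\<nu> (A \<union> B) = \<nu> A + \<nu> B"
    using \<mu> \<nu> by (simp_all add: extends_volume_def additive_def)
  then show ?case using Un by simp
next
  case (Diff A B)
  have "\<mu> (A - B) = \<mu> A - \<mu> B" "\<nu> (A - B) = \<nu> A - \<nu> B"
    using \<mu> \<nu> Diff.hyps by (auto simp: extends_volume_def intro!: additive_Diff[OF rectangle_ring_ring])
  then show ?case using Diff by simp
qed

lemma extends_volume_ring_measure:
  assumes e: "l2_coordinates e"
  shows "extends_volume e (ring_measure e)"
proof -
  have "\<exists>!\<mu>. \<mu> \<in> extensional (rectangle_ring e) \<and> extends_volume e \<mu>"
    using extends_volume_exists[OF e] extends_volume_unique[OF e] by (blast intro: extensionalityI)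
  from theI'[OF this] show ?thesis unfolding ring_measure_def by blast
qed

lemma content_ring_measure:
  assumes "l2_coordinates e"
  shows "content (rectangle_ring e) (ring_measure e)"
  using extends_volume_ring_measure[OF assms] rectangle_ring_ring
  by (intro content.intro) (simp_all add: extends_volume_def additive_def)

lemma ring_measure_rectangle:
  "l2_coordinates e \<Longrightarrow> nonempty_params a b \<Longrightarrow> ring_measure e (rectangle e a b) = rectangle_volume a b"
  using extends_volume_ring_measure[of e] by (simp add: extends_volume_def nonempty_params_iff)

section \<open>Bases whose rectangles are measurable for another basis\<close>

text \<open>Jordan measurability of the rectangles of \<open>g\<close> with respect to
  \<open>e\<close>, with the value required to be the volume computed from the edges. Quantifying
  over all parameters makes the relation reflexive and transitive on bases with
  \<open>l2_coordinates\<close>.\<close>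

definition refines :: "(nat \<Rightarrow> 'a::real_inner) \<Rightarrow> (nat \<Rightarrow> 'a) \<Rightarrow> bool" where
  "refines e g \<longleftrightarrow> (\<forall>a b. nonempty_params a b \<longrightarrow>
     sandwiched (rectangle_ring e) (ring_measure e) (rectangle g a b) (rectangle_volume a b))"

lemma (in content) sandwiched_empty: "sandwiched R \<mu> {} 0"
  using sandwiched_self[OF empty_mem] by (simp add: content_empty)

lemma (in content) sandwiched_UN:
  assumes "finite I" "disjoint_family_on A I" "\<And>i. i \<in> I \<Longrightarrow> sandwiched R \<mu> (A i) (v i)"
  shows "sandwiched R \<mu> (\<Union>i\<in>I. A i) (\<Sum>i\<in>I. v i)"
  using assms
proof (induction I rule: finite_induct)
  case empty
  then show ?case using sandwiched_empty by simp
next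
  case (insert i I)
  have "disjoint_family_on A I" using insert.prems(1) by (rule disjoint_family_on_mono[rotated]) auto
  then have "sandwiched R \<mu> (\<Union>i\<in>I. A i) (\<Sum>i\<in>I. v i)" using insert by simp
  moreover have "A i \<inter> (\<Union>i\<in>I. A i) = {}"
    using insert.prems(1) insert.hyps by (auto simp: disjoint_family_on_def)
  ultimately have "sandwiched R \<mu> (A i \<union> (\<Union>i\<in>I. A i)) (v i + (\<Sum>i\<in>I. v i))"
    using insert.prems(2) by (intro sandwiched_Un) auto
  then show ?case using insert.hyps by simp
qed

lemma sandwiched_rectangle:
  assumes "l2_coordinates e" "nonempty_params a b"
  shows "sandwiched (rectangle_ring e) (ring_measure e) (rectangle e a b) (rectangle_volume a b)"
  using content.sandwiched_self[OF content_ring_measure rectangle_mem_ring] assms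
  by (metis ring_measure_rectangle)

lemma refines_ring:
  assumes e: "l2_coordinates e" and g: "l2_coordinates g" and "refines e g" and A: "A \<in> rectangle_ring g"
  shows "sandwiched (rectangle_ring e) (ring_measure e) A (ring_measure g A)"
proof -
  interpret E: content "rectangle_ring e" "ring_measure e" using content_ring_measure[OF e] .
  interpret G: content "rectangle_ring g" "ring_measure g" using content_ring_measure[OF g] .
  show ?thesis using g A
  proof (induction rule: rectangle_ring_induct)
    case empty
    then show ?case using E.sandwiched_empty by (simp add: G.content_empty)
  next
    case (rectangle a b)
    then show ?case using assms(3) by (simp add: refines_def ring_measure_rectangle[OF g])
  next
    case (Un A B)
    then show ?case by (simp add: G.add E.sandwiched_Un)
  next
    case (Diff A B)
    then show ?case by (simp add: G.content_diff E.sandwiched_Diff)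
  qed
qed

text \<open>The core of transitivity: inner and outer sets from the ring of \<open>g\<close> are
  themselves sandwiched for \<open>e\<close>, and the squeeze removes this intermediate
  layer.\<close>

lemma refines_sandwiched:
  assumes e: "l2_coordinates e" and g: "l2_coordinates g" and "refines e g"
    and A: "sandwiched (rectangle_ring g) (ring_measure g) A v"
  shows "sandwiched (rectangle_ring e) (ring_measure e) A v"
proof (rule content.sandwiched_squeeze[OF content_ring_measure[OF e]])
  fix \<epsilon> :: real assume "\<epsilon> > 0"
  obtain B C where BC: "B \<in> rectangle_ring g" "C \<in> rectangle_ring g" "B \<subseteq> A" "A \<subseteq> C"
    "v - \<epsilon> < ring_measure g B" "ring_measure g C < v + \<epsilon>"
    by (rule sandwichedE[OF A \<open>\<epsilon> > 0\<close>])
  then show "\<exists>B C u w. sandwiched (rectangle_ring e) (ring_measure e) B u \<and>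
      sandwiched (rectangle_ring e) (ring_measure e) C w \<and> B \<subseteq> A \<and> A \<subseteq> C \<and> v - \<epsilon> < u \<and> w < v + \<epsilon>"
    using refines_ring[OF e g assms(3)] by blast
qed

lemma refines_refl: "l2_coordinates e \<Longrightarrow> refines e e"
  by (simp add: refines_def sandwiched_rectangle)

lemma refines_trans:
  assumes "l2_coordinates e" "l2_coordinates g" "refines e g" "refines g h"
  shows "refines e h"
  using refines_sandwiched[OF assms(1-3)] assms(4) by (auto simp: refines_def)

lemma refines_completion:
  assumes e: "l2_coordinates e" and g: "l2_coordinates g" and ref: "refines e g"
    and Q: "Q \<in> measurable_rectangles g"
  shows "Q \<in> completed_ring e \<and> completed_measure e Q = completed_measure g Q"
proof -
  have ring: "Q \<in> rectangle_ring g"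
    using Q by (simp add: rectangle_ring_eq dynkin_ring.base)
  note E = content.sandwiched_completion[OF content_ring_measure[OF e] refines_ring[OF e g ref ring]]
  note G = content.sandwiched_completion[OF content_ring_measure[OF g]
      content.sandwiched_self[OF content_ring_measure[OF g] ring]]
  show ?thesis using E G(2) unfolding completed_ring_def completed_measure_def by simp
qed

section \<open>Shears and rotations\<close>

lemma l2_coordinates_shear:
  assumes e: "l2_coordinates e" and "p \<noteq> q"
  shows "l2_coordinates (e(p := e p + t *\<^sub>R e q))"
proof -
  let ?e = "e(p := e p + t *\<^sub>R e q)"
  have "summable (\<lambda>j. (x \<bullet> ?e j)\<^sup>2)" for x
    using l2_coordinates_summable[OF e, of x] by (rule summable_finite_change[where F = "{p}"]) auto
  moreover have "c \<in> range (\<lambda>x j. x \<bullet> ?e j)" if c: "summable (\<lambda>j. (c j)\<^sup>2)" for c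
  proof -
    have "summable (\<lambda>j. ((c(p := c p - t * c q)) j)\<^sup>2)"
      using c by (rule summable_finite_change[where F = "{p}"]) auto
    from l2_coordinates_obtain[OF e this] obtain x where
      x: "\<And>j. x \<bullet> e j = (c(p := c p - t * c q)) j" by blast
    have "c = (\<lambda>j. x \<bullet> ?e j)"
      using x \<open>p \<noteq> q\<close> by (auto simp: inner_add_right)
    then show ?thesis by (rule image_eqI) simp
  qed
  ultimately show ?thesis unfolding l2_coordinates_def by blast
qed

text \<open>The sheared rectangle is cut into \<open>n\<close> layers of height \<open>h\<close> in
  direction \<open>q\<close>. Within a layer the shear term varies by at most
  \<open>s = \<bar>t\<bar> * h\<close>, so the layer lies between two true rectangles whose edge in
  direction \<open>p\<close> is shorter or longer by \<open>2 * s\<close>. Summed over the layers,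
  the relative error is \<open>2 * s / dp\<close>, which tends to 0 as \<open>n\<close>
  grows.\<close>

lemma refines_shear:
  assumes e: "l2_coordinates e" and pq: "p \<noteq> q"
  shows "refines e (e(p := e p + t *\<^sub>R e q))"
  unfolding refines_def
proof (intro allI impI)
  fix a b assume ab: "nonempty_params a b"
  let ?Q = "rectangle (e(p := e p + t *\<^sub>R e q)) a b" and ?V = "rectangle_volume a b"
  interpret content "rectangle_ring e" "ring_measure e" using content_ring_measure[OF e] .
  define dp dq where "dp = b p - a p" and "dq = b q - a q"
  have d: "0 < dp" "0 < dq" using nonempty_params_less[OF ab] by (simp_all add: dp_def dq_def)
  show "sandwiched (rectangle_ring e) (ring_measure e) ?Q ?V"
  proof (rule sandwiched_squeeze)
    fix \<epsilon> :: real assume "\<epsilon> > 0"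
    \<comment> \<open>The bound amounts to \<open>2 * s * (1 + ?V / \<epsilon>) < dp\<close>. The
      summand 1 in the bracket keeps the inner edges positive, the other one makes the volume error
      smaller than \<open>\<epsilon>\<close>; the last \<open>+ 1\<close> only ensures that
      \<open>n\<close> is positive.\<close>
    obtain n :: nat where n: "2 * \<bar>t\<bar> * dq / dp * (1 + ?V / \<epsilon>) + 1 < real n"
      using reals_Archimedean2 by blast
    have V: "0 \<le> ?V" by (rule rectangle_volume_nonneg)
    have n0: "0 < real n" using n d V \<open>\<epsilon> > 0\<close> by (intro le_less_trans[OF _ n]) auto
    define h s where "h = dq / n" and "s = \<bar>t\<bar> * h"
    have h: "0 < h" "n * h = dq" using d n0 by (simp_all add: h_def)
    have s0: "0 \<le> s" using h by (simp add: s_def)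
    have "2 * \<bar>t\<bar> * dq * (1 + ?V / \<epsilon>) < n * dp"
      using n d by (simp add: field_simps)
    then have "2 * s * (1 + ?V / \<epsilon>) < dp"
      using n0 by (simp add: s_def h_def field_simps)
    then have "2 * s + 2 * s * ?V / \<epsilon> < dp" by (simp add: algebra_simps)
    moreover have "0 \<le> 2 * s * ?V / \<epsilon>" using s0 V \<open>\<epsilon> > 0\<close> by simp
    ultimately have s1: "2 * s < dp" and "2 * s * ?V / \<epsilon> < dp" using s0 by linarith+
    then have s2: "?V * (2 * s) / dp < \<epsilon>" using d \<open>\<epsilon> > 0\<close> by (simp add: field_simps)
    \<comment> \<open>Layer \<open>k\<close>, with the edge in direction \<open>p\<close> moved by
      the value of the shear at the lower end of the layer and widened by \<open>u\<close> on both
      sides. The inner approximation uses \<open>u = - s\<close>, the outer one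
      \<open>u = s\<close>.\<close>
    define A where "A u k = a(p := a p - t * (a q + k * h) - u, q := a q + k * h)" for u :: real and k :: nat
    define B where "B u k = b(p := b p - t * (a q + k * h) + u, q := a q + k * h + h)" for u :: real and k :: nat
    have good: "nonempty_params (A u k) (B u k)" if "0 < dp + 2 * u" for u k
      by (rule nonempty_params_finite_change[OF ab, of "{p, q}"])
        (use that h in \<open>auto simp: A_def B_def dp_def\<close>)
    have vol: "rectangle_volume (A u k) (B u k) = ?V * ((dp + 2 * u) * h) / (dp * dq)" if "0 < dp + 2 * u" for u k
    proof -
      have "rectangle_volume (A u k) (B u k) * (\<Prod>j\<in>{p, q}. b j - a j)
          = ?V * (\<Prod>j\<in>{p, q}. B u k j - A u k j)"
        by (rule rectangle_volume_finite_change[OF ab good[OF that]]) (auto simp: A_def B_def)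
      moreover have "(\<Prod>j\<in>{p, q}. b j - a j) = dp * dq" using pq by (simp add: dp_def dq_def)
      moreover have "(\<Prod>j\<in>{p, q}. B u k j - A u k j) = (dp + 2 * u) * h"
        using pq by (simp add: A_def B_def dp_def)
      ultimately show ?thesis using d by (simp add: eq_divide_eq)
    qed
    define U where "U u = (\<Union>k\<in>{..<n}. rectangle e (A u k) (B u k))" for u
    have mem: "x \<in> rectangle e (A u k) (B u k) \<longleftrightarrow>
        (\<forall>j. j \<noteq> p \<and> j \<noteq> q \<longrightarrow> x \<bullet> e j \<in> {a j..<b j}) \<and>
        x \<bullet> e q \<in> {a q + k * h..<a q + k * h + h} \<and>
        x \<bullet> e p \<in> {a p - t * (a q + k * h) - u..<b p - t * (a q + k * h) + u}" for x u k
      using pq unfolding rectangle_def A_def B_def by (auto split: if_splits)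
    have memQ: "x \<in> ?Q \<longleftrightarrow>
        (\<forall>j. j \<noteq> p \<and> j \<noteq> q \<longrightarrow> x \<bullet> e j \<in> {a j..<b j}) \<and>
        x \<bullet> e q \<in> {a q..<b q} \<and> x \<bullet> e p + t * (x \<bullet> e q) \<in> {a p..<b p}" for x
      using pq unfolding rectangle_def by (auto split: if_splits simp: inner_add_right)
    have slice: "k = nat \<lfloor>(y - a q) / h\<rfloor>" if "y \<in> {a q + k * h..<a q + k * h + h}" for y and k :: nat
    proof -
      have "real k \<le> (y - a q) / h" "(y - a q) / h < real k + 1"
        using that h by (simp_all add: field_simps)
      then have "\<lfloor>(y - a q) / h\<rfloor> = int k" by (intro floor_unique) auto
      then show ?thesis by simp
    qed
    have U: "sandwiched (rectangle_ring e) (ring_measure e) (U u) (?V * (dp + 2 * u) / dp)" if "0 < dp + 2 * u" for u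
    proof -
      have "disjoint_family_on (\<lambda>k. rectangle e (A u k) (B u k)) {..<n}"
        unfolding disjoint_family_on_def using slice by (auto simp: mem) (metis slice)
      then have "sandwiched (rectangle_ring e) (ring_measure e) (U u) (\<Sum>k<n. rectangle_volume (A u k) (B u k))"
        unfolding U_def using good[OF that] by (intro sandwiched_UN sandwiched_rectangle e) auto
      also have "(\<Sum>k<n. rectangle_volume (A u k) (B u k)) = ?V * (dp + 2 * u) / dp"
        using d n0 by (simp add: vol[OF that] h_def field_simps)
      finally show ?thesis .
    qed
    have t_bound: "\<bar>t * (x \<bullet> e q) - t * (a q + k * h)\<bar> \<le> s"
      if "x \<bullet> e q \<in> {a q + k * h..<a q + k * h + h}" for x and k :: nat
    proof -
      have "\<bar>t * (x \<bullet> e q) - t * (a q + k * h)\<bar> = \<bar>t\<bar> * \<bar>x \<bullet> e q - (a q + k * h)\<bar>"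
        by (simp add: abs_mult[symmetric] algebra_simps)
      also have "\<dots> \<le> \<bar>t\<bar> * h" using that by (intro mult_left_mono) auto
      finally show ?thesis by (simp add: s_def)
    qed
    have "U (- s) \<subseteq> ?Q"
    proof
      fix x assume "x \<in> U (- s)"
      then obtain k where k: "k < n" "x \<in> rectangle e (A (- s) k) (B (- s) k)" by (auto simp: U_def)
      have xq: "x \<bullet> e q \<in> {a q + k * h..<a q + k * h + h}" using k(2) mem by blast
      have "0 \<le> real k * h" using h by simp
      moreover have "real k * h + h \<le> dq"
        using k(1) h mult_right_mono[of "real k + 1" n h] by (simp add: algebra_simps)
      ultimately have "a q \<le> x \<bullet> e q" "x \<bullet> e q < b q"
        using xq unfolding dq_def atLeastLessThan_iff by linarith+
      then show "x \<in> ?Q"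
        using k(2) t_bound[OF xq] unfolding mem memQ by auto
    qed
    moreover have "?Q \<subseteq> U s"
    proof
      fix x assume x: "x \<in> ?Q"
      define k where "k = nat \<lfloor>(x \<bullet> e q - a q) / h\<rfloor>"
      have xq: "a q \<le> x \<bullet> e q" "x \<bullet> e q < b q" using x by (auto simp: memQ)
      then have "0 \<le> (x \<bullet> e q - a q) / h" using h by simp
      then have "real k \<le> (x \<bullet> e q - a q) / h" "(x \<bullet> e q - a q) / h < real k + 1"
        unfolding k_def by linarith+
      then have k: "x \<bullet> e q \<in> {a q + k * h..<a q + k * h + h}" using h by (auto simp: field_simps)
      have "real k * h < dq" using k xq by (simp add: dq_def)
      then have "real k < n" using h by (metis mult_less_cancel_right_pos)
      moreover have "x \<in> rectangle e (A s k) (B s k)"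
        using x k t_bound[OF k] unfolding mem memQ by auto
      ultimately show "x \<in> U s" unfolding U_def by auto
    qed
    moreover have "?V - \<epsilon> < ?V * (dp + 2 * (- s)) / dp" "?V * (dp + 2 * s) / dp < ?V + \<epsilon>"
      using s2 d by (simp_all add: field_simps)
    moreover have "0 < dp + 2 * s" "0 < dp + 2 * (- s)" using s1 s0 d by linarith+
    ultimately show "\<exists>B C u w. sandwiched (rectangle_ring e) (ring_measure e) B u \<and>
      sandwiched (rectangle_ring e) (ring_measure e) C w \<and> B \<subseteq> ?Q \<and> ?Q \<subseteq> C \<and> ?V - \<epsilon> < u \<and> w < ?V + \<epsilon>"
      using U by metis
  qed
qed

text \<open>A rotation by an angle \<open>\<theta> \<noteq> \<pi>\<close> is a product of three shears with parameters
  \<open>tan (\<theta>/2)\<close>, \<open>- sin \<theta>\<close> and \<open>tan (\<theta>/2)\<close>.\<close>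

lemma refines_rotation:
  assumes e: "l2_coordinates e" and pq: "p \<noteq> q" and cs: "c\<^sup>2 + s\<^sup>2 = 1" "0 \<le> c"
  shows "refines e (e(p := c *\<^sub>R e p + s *\<^sub>R e q, q := c *\<^sub>R e q - s *\<^sub>R e p))" (is "refines e ?g")
    and "l2_coordinates (e(p := c *\<^sub>R e p + s *\<^sub>R e q, q := c *\<^sub>R e q - s *\<^sub>R e p))"
proof -
  \<comment> \<open>For \<open>c = cos \<theta>\<close> and \<open>s = sin \<theta>\<close> this is
    \<open>tan (\<theta>/2)\<close>; the hypothesis \<open>0 \<le> c\<close> keeps the denominator
    positive.\<close>
  define t where "t = s / (1 + c)"
  define e1 where "e1 = e(p := e p + t *\<^sub>R e q)"
  define e2 where "e2 = e1(q := e1 q + (- s) *\<^sub>R e1 p)"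
  define e3 where "e3 = e2(p := e2 p + t *\<^sub>R e2 q)"
  have l: "l2_coordinates e1" "l2_coordinates e2" "l2_coordinates e3"
    unfolding e3_def e2_def e1_def using pq by (intro l2_coordinates_shear e; simp)+
  have r: "refines e e1" "refines e1 e2" "refines e2 e3"
    using refines_shear[OF e pq, of t] refines_shear[OF l(1) pq[symmetric], of "- s"]
      refines_shear[OF l(2) pq, of t] by (simp_all only: e3_def e2_def e1_def)
  have ref: "refines e e3"
    using refines_trans[OF e l(2) refines_trans[OF e l(1) r(1,2)] r(3)] .
  have st: "t * (1 + c) = s" "s * t = 1 - c"
  proof -
    show st1: "t * (1 + c) = s" using cs(2) by (simp add: t_def)
    have "s * t * (1 + c) = (1 - c) * (1 + c)"
      using cs(1) unfolding mult.assoc st1 by (simp add: power2_eq_square algebra_simps)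
    then show "s * t = 1 - c" using cs(2) by simp
  qed
  have e2q: "e2 q = c *\<^sub>R e q - s *\<^sub>R e p"
  proof -
    have "e2 q = (1 - s * t) *\<^sub>R e q - s *\<^sub>R e p"
      using pq by (simp add: e2_def e1_def algebra_simps)
    then show ?thesis by (simp add: st)
  qed
  have "e3 p = e2 p + t *\<^sub>R e2 q" by (simp add: e3_def)
  also have "\<dots> = (1 - s * t) *\<^sub>R e p + (t * (1 + c)) *\<^sub>R e q"
    unfolding e2q using pq by (simp add: e2_def e1_def algebra_simps)
  finally have e3p: "e3 p = c *\<^sub>R e p + s *\<^sub>R e q" by (simp add: st)
  have "e3 j = ?g j" for j
    using pq e3p e2q by (cases "j = p"; cases "j = q") (simp_all add: e3_def, simp add: e2_def e1_def)
  then have "e3 = ?g" by blast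
  then show "refines e ?g" "l2_coordinates ?g" using ref l(3) by simp_all
qed

section \<open>Orthonormal bases\<close>

text \<open>Totality replaces density of the span: it passes through rotations and permutations by
  looking at coordinates, with no closure involved.\<close>

definition onb :: "(nat \<Rightarrow> 'a::real_inner) \<Rightarrow> bool" where
  "onb e \<longleftrightarrow> (\<forall>i j. e i \<bullet> e j = of_bool (i = j)) \<and> (\<forall>x. (\<forall>i. x \<bullet> e i = 0) \<longrightarrow> x = 0)"

lemma onb_inner: "onb e \<Longrightarrow> e i \<bullet> e j = of_bool (i = j)"
  by (simp add: onb_def)

lemma onb_eq_0: "onb e \<Longrightarrow> (\<And>i. x \<bullet> e i = 0) \<Longrightarrow> x = 0"
  by (simp add: onb_def)

lemma orthonormal_basis_onb:
  assumes "orthonormal_basis e"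
  shows "onb e"
proof -
  have "x = 0" if "\<forall>i. x \<bullet> e i = 0" for x
  proof -
    have "span (range e) \<subseteq> {y. x \<bullet> y = 0}"
      using that by (intro span_minimal) (auto simp: subspace_def inner_add_right)
    moreover have "closed {y. x \<bullet> y = 0}"
      by (rule closed_hyperplane)
    ultimately have "closure (span (range e)) \<subseteq> {y. x \<bullet> y = 0}"
      by (rule closure_minimal)
    then have "x \<in> {y. x \<bullet> y = 0}" using assms unfolding orthonormal_basis_def by blast
    then show ?thesis by simp
  qed
  then show ?thesis using assms by (auto simp: orthonormal_basis_def onb_def)
qed

section \<open>Bessel, Riesz-Fischer and Parseval\<close>

lemma onb_sum_inner:
  assumes "onb e" "finite F"
  shows "(\<Sum>i\<in>F. c i *\<^sub>R e i) \<bullet> e j = (if j \<in> F then c j else 0)"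
  using assms by (simp add: inner_sum_left onb_inner of_bool_def if_distrib[of "\<lambda>x. _ * x"] cong: if_cong)

lemma onb_norm_sum:
  assumes "onb e" "finite F"
  shows "(norm (\<Sum>i\<in>F. c i *\<^sub>R e i))\<^sup>2 = (\<Sum>i\<in>F. (c i)\<^sup>2)"
proof -
  have "(norm (\<Sum>i\<in>F. c i *\<^sub>R e i))\<^sup>2 = (\<Sum>j\<in>F. c j * ((\<Sum>i\<in>F. c i *\<^sub>R e i) \<bullet> e j))"
    by (simp only: power2_norm_eq_inner inner_sum_right inner_scaleR_right)
  also have "\<dots> = (\<Sum>j\<in>F. (c j)\<^sup>2)"
    by (intro sum.cong refl) (simp add: onb_sum_inner[OF assms] power2_eq_square)
  finally show ?thesis .
qed

lemma onb_bessel: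
  assumes "onb e" "finite F"
  shows "(\<Sum>i\<in>F. (x \<bullet> e i)\<^sup>2) \<le> x \<bullet> x"
proof -
  let ?y = "\<Sum>i\<in>F. (x \<bullet> e i) *\<^sub>R e i"
  have "x \<bullet> ?y = (\<Sum>i\<in>F. (x \<bullet> e i)\<^sup>2)"
    by (simp add: inner_sum_right power2_eq_square)
  moreover have "?y \<bullet> ?y = (\<Sum>i\<in>F. (x \<bullet> e i)\<^sup>2)"
    using onb_norm_sum[OF assms, of "\<lambda>i. x \<bullet> e i"] by (simp add: power2_norm_eq_inner)
  moreover have "0 \<le> (x - ?y) \<bullet> (x - ?y)" by simp
  ultimately show ?thesis
    by (simp add: inner_diff_left inner_diff_right inner_commute)
qed

lemma onb_summable:
  assumes "onb e"
  shows "summable (\<lambda>i. (x \<bullet> e i)\<^sup>2)"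
  by (rule summableI_nonneg_bounded[of _ "x \<bullet> x"]) (auto intro: onb_bessel[OF assms])

text \<open>The Riesz-Fischer theorem. By Pythagoras the partial sums form a Cauchy sequence, and
  this is where completeness of the space enters.\<close>

lemma onb_series:
  fixes e :: "nat \<Rightarrow> 'a::{real_inner, complete_space}"
  assumes e: "onb e" and c: "summable (\<lambda>i. (c i)\<^sup>2)"
  obtains x where "(\<lambda>n. \<Sum>i<n. c i *\<^sub>R e i) \<longlonglongrightarrow> x" "\<And>i. x \<bullet> e i = c i"
proof -
  define X where "X n = (\<Sum>i<n. c i *\<^sub>R e i)" for n
  have diff: "(norm (X n - X m))\<^sup>2 = (\<Sum>i\<in>{m..<n}. (c i)\<^sup>2)" if "m \<le> n" for m n
  proof -
    have "X n - X m = (\<Sum>i\<in>{m..<n}. c i *\<^sub>R e i)"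
      using sum_diff_nat_ivl[of 0 m n "\<lambda>i. c i *\<^sub>R e i"] that by (simp add: X_def lessThan_atLeast0)
    then show ?thesis using onb_norm_sum[OF e] by simp
  qed
  have "Cauchy X"
  proof (rule CauchyI')
    fix \<epsilon> :: real assume "\<epsilon> > 0"
    then have "0 < \<epsilon>\<^sup>2" by simp
    with c obtain N where N: "\<And>m n. m \<ge> N \<Longrightarrow> norm (\<Sum>i\<in>{m..<n}. (c i)\<^sup>2) < \<epsilon>\<^sup>2"
      unfolding summable_Cauchy by blast
    show "\<exists>M. \<forall>m\<ge>M. \<forall>n>m. dist (X m) (X n) < \<epsilon>"
    proof (intro exI allI impI)
      fix m n assume "m \<ge> N" "m < n"
      then have "(norm (X n - X m))\<^sup>2 < \<epsilon>\<^sup>2"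
        using diff[of m n] N[of m n] by simp
      then show "dist (X m) (X n) < \<epsilon>"
        using \<open>\<epsilon> > 0\<close> by (simp add: dist_norm norm_minus_commute power2_less_imp_less)
    qed
  qed
  then obtain x where x: "X \<longlonglongrightarrow> x" using Cauchy_convergent convergent_def by blast
  have "x \<bullet> e i = c i" for i
  proof -
    have lim: "(\<lambda>n. X n \<bullet> e i) \<longlonglongrightarrow> x \<bullet> e i" using x by (intro tendsto_intros)
    have ev: "\<forall>\<^sub>F n in sequentially. X n \<bullet> e i = c i"
      using eventually_gt_at_top[of i] by eventually_elim (simp add: X_def onb_sum_inner[OF e])
    show ?thesis
      by (rule LIMSEQ_unique[OF lim tendsto_eventually[OF ev]])
  qed
  with x that show ?thesis unfolding X_def by blast
qed

lemma onb_l2_coordinates: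
  fixes e :: "nat \<Rightarrow> 'a::{real_inner, complete_space}"
  assumes e: "onb e"
  shows "l2_coordinates e"
proof -
  have "c \<in> range (\<lambda>x j. x \<bullet> e j)" if "summable (\<lambda>j. (c j)\<^sup>2)" for c
  proof -
    from onb_series[OF e that] obtain x where "\<And>i. x \<bullet> e i = c i" by blast
    then have "c = (\<lambda>j. x \<bullet> e j)" by auto
    then show ?thesis by (rule image_eqI) simp
  qed
  then have s2: "{c. summable (\<lambda>j. (c j)\<^sup>2)} \<subseteq> range (\<lambda>x j. x \<bullet> e j)"
    by (intro subsetI) simp
  have s1: "range (\<lambda>x j. x \<bullet> e j) \<subseteq> {c. summable (\<lambda>j. (c j)\<^sup>2)}"
    using onb_summable[OF e] by (simp add: image_subset_iff)
  show ?thesis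
    unfolding l2_coordinates_def by (rule equalityI[OF s1 s2])
qed

lemma onb_parseval:
  fixes e :: "nat \<Rightarrow> 'a::{real_inner, complete_space}"
  assumes e: "onb e"
  shows "(\<lambda>i. (x \<bullet> e i) * (y \<bullet> e i)) sums (x \<bullet> y)"
proof -
  obtain x' where x': "(\<lambda>n. \<Sum>i<n. (x \<bullet> e i) *\<^sub>R e i) \<longlonglongrightarrow> x'" "\<And>i. x' \<bullet> e i = x \<bullet> e i"
    using onb_series[OF e onb_summable[OF e, of x]] by blast
  \<comment> \<open>The limit and \<open>x\<close> have the same coordinates, so totality identifies
    them.\<close>
  have "x' - x = 0" by (rule onb_eq_0[OF e]) (simp add: inner_diff_left x')
  then have "(\<lambda>n. (\<Sum>i<n. (x \<bullet> e i) *\<^sub>R e i) \<bullet> y) \<longlonglongrightarrow> x \<bullet> y"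
    using x'(1) by (intro tendsto_intros) simp
  then show ?thesis
    by (simp add: sums_def inner_sum_left inner_commute[of y])
qed

lemma onb_rotation:
  assumes e: "onb e" and pq: "p \<noteq> q" and cs: "c\<^sup>2 + s\<^sup>2 = 1"
  shows "onb (e(p := c *\<^sub>R e p + s *\<^sub>R e q, q := c *\<^sub>R e q - s *\<^sub>R e p))" (is "onb ?g")
  unfolding onb_def
proof (intro conjI allI impI)
  show "?g i \<bullet> ?g j = of_bool (i = j)" for i j
    using pq cs
    by (auto simp: inner_add_left inner_add_right inner_diff_left inner_diff_right onb_inner[OF e]
        power2_eq_square algebra_simps)
  fix x assume x: "\<forall>i. x \<bullet> ?g i = 0"
  have 1: "c * (x \<bullet> e p) + s * (x \<bullet> e q) = 0" "c * (x \<bullet> e q) - s * (x \<bullet> e p) = 0"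
    using x[rule_format, of p] x[rule_format, of q] pq by (simp_all add: inner_add_right inner_diff_right)
  have "x \<bullet> e p = (c\<^sup>2 + s\<^sup>2) * (x \<bullet> e p)" using cs by simp
  also have "\<dots> = c * (c * (x \<bullet> e p) + s * (x \<bullet> e q)) - s * (c * (x \<bullet> e q) - s * (x \<bullet> e p))"
    by (simp add: power2_eq_square algebra_simps)
  finally have xp: "x \<bullet> e p = 0" unfolding 1 by simp
  have "x \<bullet> e q = (c\<^sup>2 + s\<^sup>2) * (x \<bullet> e q)" using cs by simp
  also have "\<dots> = s * (c * (x \<bullet> e p) + s * (x \<bullet> e q)) + c * (c * (x \<bullet> e q) - s * (x \<bullet> e p))"
    by (simp add: power2_eq_square algebra_simps)
  finally have xq: "x \<bullet> e q = 0" unfolding 1 by simp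
  have "x \<bullet> e i = 0" for i
    using x[rule_format, of i] xp xq by (cases "i = p"; cases "i = q") (auto simp: pq)
  then show "x = 0" by (rule onb_eq_0[OF e])
qed

section \<open>Triangular form by Givens rotations\<close>

lemma annihilate_by_rotations:
  fixes e :: "nat \<Rightarrow> 'a::{real_inner, complete_space}"
  assumes "onb e" "finite T" "p \<notin> T"
  shows "\<exists>g. onb g \<and> refines e g \<and> (\<forall>i. i \<notin> insert p T \<longrightarrow> g i = e i) \<and>
    (\<forall>i\<in>insert p T. g i \<in> span (e ` insert p T)) \<and> (\<forall>i\<in>T. y \<bullet> g i = 0)"
  using assms(2,3)
proof (induction T rule: finite_induct)
  case empty
  show ?case
    using assms(1) by (intro exI[of _ e]) (auto intro!: refines_refl onb_l2_coordinates span_base)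
next
  case (insert q T)
  then obtain g where g: "onb g" "refines e g" "\<And>i. i \<notin> insert p T \<Longrightarrow> g i = e i"
    "\<And>i. i \<in> insert p T \<Longrightarrow> g i \<in> span (e ` insert p T)" "\<And>i. i \<in> T \<Longrightarrow> y \<bullet> g i = 0"
    by auto
  have pq: "p \<noteq> q" using insert by auto
  define \<alpha> \<beta> where "\<alpha> = y \<bullet> g p" and "\<beta> = y \<bullet> g q"
  \<comment> \<open>The rotation moves the component of \<open>y\<close> along \<open>g q\<close>
    into the vector at \<open>p\<close>. Its tangent is \<open>\<beta> / \<alpha>\<close>, with the
    sign arranged so that \<open>c\<close> is nonnegative as \<open>refines_rotation\<close>
    demands; a quarter turn handles \<open>\<alpha> = 0\<close>.\<close>
  have "\<exists>c s. c\<^sup>2 + s\<^sup>2 = 1 \<and> 0 \<le> c \<and> c * \<beta> - s * \<alpha> = 0"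
  proof (cases "\<alpha> = 0")
    case True
    then show ?thesis by (intro exI[of _ 0] exI[of _ 1]) auto
  next
    case False
    define r where "r = sqrt (1 + (\<beta> / \<alpha>)\<^sup>2)"
    have r: "0 < r" "r\<^sup>2 = 1 + (\<beta> / \<alpha>)\<^sup>2" by (simp_all add: r_def add_pos_nonneg)
    have "(1 / r)\<^sup>2 + ((\<beta> / \<alpha>) / r)\<^sup>2 = (1 + (\<beta> / \<alpha>)\<^sup>2) / r\<^sup>2"
      by (simp only: power_divide add_divide_distrib power_one)
    also have "\<dots> = 1" unfolding r(2)[symmetric] using r(1) by simp
    finally have "(1 / r)\<^sup>2 + ((\<beta> / \<alpha>) / r)\<^sup>2 = 1" .
    moreover have "0 \<le> 1 / r" "1 / r * \<beta> - ((\<beta> / \<alpha>) / r) * \<alpha> = 0"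
      using r(1) False by simp_all
    ultimately show ?thesis by blast
  qed
  then obtain c s where cs: "c\<^sup>2 + s\<^sup>2 = 1" "0 \<le> c" "c * \<beta> - s * \<alpha> = 0" by blast
  let ?h = "g(p := c *\<^sub>R g p + s *\<^sub>R g q, q := c *\<^sub>R g q - s *\<^sub>R g p)"
  have "onb ?h" using onb_rotation[OF g(1) pq cs(1)] .
  moreover have "refines e ?h"
    using refines_trans[OF onb_l2_coordinates[OF assms(1)] onb_l2_coordinates[OF g(1)] g(2)
        refines_rotation(1)[OF onb_l2_coordinates[OF g(1)] pq cs(1,2)]] .
  moreover have "\<forall>i. i \<notin> insert p (insert q T) \<longrightarrow> ?h i = e i" using g(3) by auto
  moreover have "?h i \<in> span (e ` insert p (insert q T))" if "i \<in> insert p (insert q T)" for i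
  proof -
    have sub: "span (e ` insert p T) \<subseteq> span (e ` insert p (insert q T))" by (intro span_mono) auto
    have "g q = e q" using g(3) pq insert by auto
    then have "g q \<in> span (e ` insert p (insert q T))" by (auto intro: span_base)
    moreover have "g j \<in> span (e ` insert p (insert q T))" if "j \<in> insert p T" for j
      using g(4)[OF that] sub by blast
    ultimately show ?thesis
      using that by (auto intro!: span_add span_diff span_scale)
  qed
  moreover have "\<forall>i\<in>insert q T. y \<bullet> ?h i = 0"
    using g(5) cs(3) insert pq by (auto simp: inner_diff_right \<alpha>_def \<beta>_def)
  ultimately show ?case by blast
qed

text \<open>Stage \<open>k\<close> rotates only the vectors with index in \<open>{k..<N}\<close>.
  The rows before \<open>k\<close> are orthogonal to all of these, hence to their span, and so keep
  their zeros; this is the purpose of the span clause in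
  \<open>annihilate_by_rotations\<close>.\<close>

lemma triangular_basis:
  fixes e :: "nat \<Rightarrow> 'a::{real_inner, complete_space}"
  assumes "onb e"
  shows "\<exists>g. onb g \<and> refines e g \<and> (\<forall>i\<ge>N. g i = e i) \<and> (\<forall>j i. j < i \<and> i < N \<longrightarrow> f j \<bullet> g i = 0)"
proof -
  have "\<exists>g. onb g \<and> refines e g \<and> (\<forall>i\<ge>N. g i = e i) \<and> (\<forall>j<k. \<forall>i. j < i \<and> i < N \<longrightarrow> f j \<bullet> g i = 0)"
    if "k \<le> N" for k
    using that
  proof (induction k)
    case 0
    show ?case using assms by (auto intro!: exI[of _ e] refines_refl onb_l2_coordinates)
  next
    case (Suc k)
    then obtain g where g: "onb g" "refines e g" "\<And>i. i \<ge> N \<Longrightarrow> g i = e i"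
      "\<And>j i. j < k \<Longrightarrow> j < i \<Longrightarrow> i < N \<Longrightarrow> f j \<bullet> g i = 0"
      by auto
    have ins: "insert k {k<..<N} = {k..<N}" using Suc.prems by auto
    obtain h where h: "onb h" "refines g h" "\<And>i. i \<notin> {k..<N} \<Longrightarrow> h i = g i"
      "\<And>i. i \<in> {k..<N} \<Longrightarrow> h i \<in> span (g ` {k..<N})" "\<And>i. i \<in> {k<..<N} \<Longrightarrow> f k \<bullet> h i = 0"
      using annihilate_by_rotations[OF g(1), of "{k<..<N}" k "f k"] unfolding ins by auto
    have "refines e h"
      using refines_trans[OF onb_l2_coordinates[OF assms] onb_l2_coordinates[OF g(1)] g(2) h(2)] .
    moreover have "h i = e i" if "i \<ge> N" for i
      using h(3)[of i] g(3)[of i] that by auto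
    moreover have "f j \<bullet> h i = 0" if "j < Suc k" "j < i" "i < N" for i j
    proof (cases "j = k")
      case True
      then show ?thesis using h(5) that by auto
    next
      case False
      then have j: "j < k" using that by simp
      show ?thesis
      proof (cases "i < k")
        case True
        then show ?thesis using h(3)[of i] g(4)[OF j] that by auto
      next
        case False
        have "span (g ` {k..<N}) \<subseteq> {z. f j \<bullet> z = 0}"
          using g(4)[OF j] j by (intro span_minimal) (auto simp: subspace_def inner_add_right)
        then show ?thesis using h(4)[of i] False that by auto
      qed
    qed
    ultimately show ?case using h(1) by blast
  qed
  from this[of N] show ?thesis by (metis order_refl order.strict_trans)
qed

section \<open>Rectangles of nearby orthonormal bases\<close>

definition offdiag :: "(nat \<Rightarrow> 'a::real_inner) \<Rightarrow> (nat \<Rightarrow> 'a) \<Rightarrow> nat \<Rightarrow> nat \<Rightarrow> real" where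
  "offdiag f g j i = (if i = j then 0 else \<bar>f j \<bullet> g i\<bar>)"

text \<open>Square truncations bound the whole double series without infinite sums, and make the
  condition visibly symmetric in the two bases.\<close>

definition offdiag_le :: "(nat \<Rightarrow> 'a::real_inner) \<Rightarrow> (nat \<Rightarrow> 'a) \<Rightarrow> real \<Rightarrow> bool" where
  "offdiag_le f g \<delta> \<longleftrightarrow> (\<forall>n. (\<Sum>j<n. \<Sum>i<n. offdiag f g j i) \<le> \<delta>)"

lemma offdiag_nonneg [simp]: "0 \<le> offdiag f g j i"
  by (simp add: offdiag_def)

lemma offdiag_swap: "offdiag g f i j = offdiag f g j i"
  by (simp add: offdiag_def inner_commute)

lemma offdiag_le_swap: "offdiag_le f g \<delta> \<Longrightarrow> offdiag_le g f \<delta>"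
  unfolding offdiag_le_def by (subst sum.swap) (simp add: offdiag_swap)

lemma offdiag_le_sum:
  assumes "offdiag_le f g \<delta>"
  shows "(\<Sum>j<m. \<Sum>i<n. offdiag f g j i) \<le> \<delta>"
proof -
  have "(\<Sum>j<m. \<Sum>i<n. offdiag f g j i) \<le> (\<Sum>j<max m n. \<Sum>i<max m n. offdiag f g j i)"
    by (intro order_trans[OF sum_mono2[of "{..<max m n}" "{..<m}"]] sum_mono sum_mono2)
      (auto intro: sum_nonneg)
  also have "\<dots> \<le> \<delta>" using assms by (simp add: offdiag_le_def)
  finally show ?thesis .
qed

lemma offdiag_row_summable:
  assumes "offdiag_le f g \<delta>"
  shows "summable (offdiag f g j)"
proof (rule summableI_nonneg_bounded)
  show "(\<Sum>i<n. offdiag f g j i) \<le> \<delta>" for n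
  proof -
    have "(\<Sum>i<n. offdiag f g j i) \<le> (\<Sum>j<Suc j. \<Sum>i<n. offdiag f g j i)"
      by (simp add: sum_nonneg)
    also have "\<dots> \<le> \<delta>" by (rule offdiag_le_sum[OF assms])
    finally show ?thesis .
  qed
qed simp

lemma offdiag_rows_le:
  assumes "offdiag_le f g \<delta>"
  shows "(\<Sum>j<m. suminf (offdiag f g j)) \<le> \<delta>"
proof -
  have "(\<lambda>n. \<Sum>j<m. \<Sum>i<n. offdiag f g j i) \<longlonglongrightarrow> (\<Sum>j<m. suminf (offdiag f g j))"
    by (intro tendsto_sum summable_LIMSEQ offdiag_row_summable[OF assms])
  then show ?thesis
    by (rule LIMSEQ_le_const2) (use offdiag_le_sum[OF assms] in auto)
qed

lemma offdiag_row_le: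
  assumes "offdiag_le f g \<delta>"
  shows "suminf (offdiag f g j) \<le> \<delta>"
proof -
  have "suminf (offdiag f g j) \<le> (\<Sum>j<Suc j. suminf (offdiag f g j))"
    using offdiag_row_summable[OF assms] by (auto intro!: sum_nonneg suminf_nonneg)
  also have "\<dots> \<le> \<delta>" by (rule offdiag_rows_le[OF assms])
  finally show ?thesis .
qed

lemma onb_abs_inner_le:
  assumes "onb f" "onb g"
  shows "\<bar>f j \<bullet> g i\<bar> \<le> 1"
proof -
  have "norm (f j) = 1" "norm (g i) = 1"
    using assms by (simp_all add: norm_eq_sqrt_inner onb_inner)
  then show ?thesis using Cauchy_Schwarz_ineq2[of "f j" "g i"] by simp
qed

lemma abs_inner_row_sums:
  assumes "offdiag_le f g \<delta>"
  shows "(\<lambda>i. \<bar>f j \<bullet> g i\<bar>) sums (\<bar>f j \<bullet> g j\<bar> + suminf (offdiag f g j))"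
proof -
  have "(\<lambda>i. (if i = j then \<bar>f j \<bullet> g j\<bar> else 0) + offdiag f g j i) sums (\<bar>f j \<bullet> g j\<bar> + suminf (offdiag f g j))"
    using offdiag_row_summable[OF assms]
    by (intro sums_add sums_single[of j "\<lambda>_. \<bar>f j \<bullet> g j\<bar>"] summable_sums)
  moreover have "(if i = j then \<bar>f j \<bullet> g j\<bar> else 0) + offdiag f g j i = \<bar>f j \<bullet> g i\<bar>" for i
    by (simp add: offdiag_def)
  ultimately show ?thesis by simp
qed

text \<open>The entries have modulus at most 1, so in each row the sum of squares, which is 1, is at
  most the sum of moduli.\<close>

lemma diagonal_ge:
  fixes f g :: "nat \<Rightarrow> 'a::{real_inner, complete_space}"
  assumes f: "onb f" and g: "onb g" and fg: "offdiag_le f g \<delta>"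
  shows "1 - suminf (offdiag f g j) \<le> \<bar>f j \<bullet> g j\<bar>"
proof -
  have "(\<lambda>i. (f j \<bullet> g i) * (f j \<bullet> g i)) sums 1"
    using onb_parseval[OF g, of "f j" "f j"] by (simp add: onb_inner[OF f])
  then have "1 \<le> \<bar>f j \<bullet> g j\<bar> + suminf (offdiag f g j)"
  proof (rule sums_le[rotated])
    show "(\<lambda>i. \<bar>f j \<bullet> g i\<bar>) sums (\<bar>f j \<bullet> g j\<bar> + suminf (offdiag f g j))"
      by (rule abs_inner_row_sums[OF fg])
    show "(f j \<bullet> g i) * (f j \<bullet> g i) \<le> \<bar>f j \<bullet> g i\<bar>" for i
      using mult_left_mono[OF onb_abs_inner_le[OF f g], of "\<bar>f j \<bullet> g i\<bar>" j i] by simp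
  qed
  then show ?thesis by simp
qed

text \<open>A rectangle with bounded edges may be unbounded in norm, so its points are controlled by
  the supremum of their coordinates. Absolute summability of the rows carries such a bound from one
  basis to the other.\<close>

lemma coordinate_bound:
  fixes f g :: "nat \<Rightarrow> 'a::{real_inner, complete_space}"
  assumes f: "onb f" and g: "onb g" and fg: "offdiag_le f g \<delta>"
    and x: "\<And>j. \<bar>x \<bullet> f j\<bar> \<le> M"
  shows "\<bar>x \<bullet> g i\<bar> \<le> M * (1 + \<delta>)"
proof -
  note gf = offdiag_le_swap[OF fg]
  have M: "0 \<le> M" using x[of 0] by linarith
  have sums: "(\<lambda>j. M * \<bar>g i \<bullet> f j\<bar>) sums (M * (\<bar>g i \<bullet> f i\<bar> + suminf (offdiag g f i)))"
    by (intro sums_mult abs_inner_row_sums[OF gf])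
  have le: "norm ((x \<bullet> f j) * (g i \<bullet> f j)) \<le> M * \<bar>g i \<bullet> f j\<bar>" for j
    using x[of j] by (simp add: abs_mult mult_right_mono)
  have "\<bar>x \<bullet> g i\<bar> = norm (\<Sum>j. (x \<bullet> f j) * (g i \<bullet> f j))"
    using sums_unique[OF onb_parseval[OF f, of x "g i"]] by simp
  also have "\<dots> \<le> (\<Sum>j. M * \<bar>g i \<bullet> f j\<bar>)"
    using sums by (intro norm_suminf_le le) (rule sums_summable)
  also have "\<dots> = M * (\<bar>g i \<bullet> f i\<bar> + suminf (offdiag g f i))"
    using sums_unique[OF sums] by simp
  also have "\<dots> \<le> M * (1 + \<delta>)"
    using M onb_abs_inner_le[OF g f, of i i] offdiag_row_le[OF gf, of i] by (intro mult_left_mono add_mono)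
  finally show ?thesis .
qed

text \<open>Two errors, each at most \<open>M * suminf (offdiag f g j)\<close>: the off-diagonal
  terms of the expansion, and the replacement of the diagonal entry by its sign.\<close>

lemma coordinate_change:
  fixes f g :: "nat \<Rightarrow> 'a::{real_inner, complete_space}"
  assumes f: "onb f" and g: "onb g" and fg: "offdiag_le f g \<delta>"
    and x: "\<And>j. \<bar>x \<bullet> g j\<bar> \<le> M" and s: "s = (if 0 \<le> f j \<bullet> g j then 1 else -1)"
  shows "\<bar>x \<bullet> f j - s * (x \<bullet> g j)\<bar> \<le> 2 * M * suminf (offdiag f g j)"
proof -
  let ?\<epsilon> = "suminf (offdiag f g j)" and ?w = "f j \<bullet> g j"
  have M: "0 \<le> M" using x[of 0] by linarith
  have "(\<lambda>i. (x \<bullet> g i) * (f j \<bullet> g i) - (if i = j then (x \<bullet> g j) * ?w else 0)) sums (x \<bullet> f j - (x \<bullet> g j) * ?w)"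
    by (intro sums_diff onb_parseval[OF g] sums_single[of j "\<lambda>_. (x \<bullet> g j) * ?w"])
  then have sums: "(\<lambda>i. if i = j then 0 else (x \<bullet> g i) * (f j \<bullet> g i)) sums (x \<bullet> f j - (x \<bullet> g j) * ?w)"
    by (rule sums_cong[THEN iffD1, rotated]) auto
  have msums: "(\<lambda>i. M * offdiag f g j i) sums (M * ?\<epsilon>)"
    using offdiag_row_summable[OF fg] by (intro sums_mult summable_sums)
  have le: "norm (if i = j then 0 else (x \<bullet> g i) * (f j \<bullet> g i)) \<le> M * offdiag f g j i" for i
    using x[of i] by (simp add: offdiag_def abs_mult mult_right_mono)
  have "\<bar>x \<bullet> f j - (x \<bullet> g j) * ?w\<bar> = norm (\<Sum>i. if i = j then 0 else (x \<bullet> g i) * (f j \<bullet> g i))"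
    using sums_unique[OF sums] by simp
  also have "\<dots> \<le> (\<Sum>i. M * offdiag f g j i)"
    using msums by (intro norm_suminf_le le) (rule sums_summable)
  also have "\<dots> = M * ?\<epsilon>" using sums_unique[OF msums] by simp
  finally have 1: "\<bar>x \<bullet> f j - (x \<bullet> g j) * ?w\<bar> \<le> M * ?\<epsilon>" .
  have "\<bar>?w - s\<bar> \<le> ?\<epsilon>"
    using diagonal_ge[OF f g fg, of j] onb_abs_inner_le[OF f g, of j j] by (auto simp: s)
  then have "\<bar>x \<bullet> g j\<bar> * \<bar>?w - s\<bar> \<le> M * ?\<epsilon>"
    using x[of j] M by (intro mult_mono) auto
  then have 2: "\<bar>(x \<bullet> g j) * ?w - s * (x \<bullet> g j)\<bar> \<le> M * ?\<epsilon>"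
    by (simp add: abs_mult[symmetric] algebra_simps)
  show ?thesis using 1 2 by linarith
qed

section \<open>Small changes of the edges and their effect on the volume\<close>

lemma widen_le_exp:
  fixes d \<eta> :: real
  assumes "0 < d" "0 \<le> \<eta>"
  shows "d + 2 * \<eta> \<le> exp (max 0 (ln d)) * exp (2 * \<eta>)"
proof -
  have "exp (max 0 (ln d)) = max 1 d" using assms(1) by (simp add: max_def)
  \<comment> \<open>The growth is measured against \<open>max 1 d\<close> and not against
    \<open>d\<close>: a very short edge may be multiplied by a huge factor, but this costs little in
    the positive part of the logarithm.\<close>
  moreover have "d + 2 * \<eta> \<le> max 1 d * (1 + 2 * \<eta>)"
    using assms mult_right_mono[of 1 "max 1 d" "2 * \<eta>"] by (simp add: distrib_left)
  moreover have "max 1 d * (1 + 2 * \<eta>) \<le> max 1 d * exp (2 * \<eta>)"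
    by (intro mult_left_mono exp_ge_add_one_self) simp
  ultimately show ?thesis by simp
qed

lemma measurable_params_widen:
  assumes "measurable_params a b" "\<And>j. a j < b j" "\<And>j. 0 \<le> \<eta> j" "summable \<eta>"
    and "bounded (range a')" "bounded (range b')" "\<And>j. b' j - a' j = b j - a j + 2 * \<eta> j"
  shows "measurable_params a' b'"
proof -
  have "summable (\<lambda>j. max 0 (ln (b' j - a' j)))"
  proof (rule summable_comparison_test')
    show "summable (\<lambda>j. max 0 (ln (b j - a j)) + 2 * \<eta> j)"
      using assms(1,4) by (intro summable_add summable_mult) (simp_all add: measurable_params_def)
    show "norm (max 0 (ln (b' j - a' j))) \<le> max 0 (ln (b j - a j)) + 2 * \<eta> j" for j
    proof -
      have d: "0 < b j - a j" using assms(2)[of j] by simp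
      have "b j - a j + 2 * \<eta> j \<le> exp (max 0 (ln (b j - a j))) * exp (2 * \<eta> j)"
        using widen_le_exp[OF d assms(3)] by simp
      then have "ln (b j - a j + 2 * \<eta> j) \<le> ln (exp (max 0 (ln (b j - a j)) + 2 * \<eta> j))"
        using d assms(3)[of j] by (subst ln_le_cancel_iff) (auto simp: exp_add)
      then show ?thesis using assms(3)[of j] by (simp add: assms(7))
    qed
  qed
  then show ?thesis using assms(5,6) by (simp add: measurable_params_def)
qed

lemma measurable_params_narrow:
  assumes "measurable_params a b" "\<And>j. a' j < b' j" "\<And>j. b' j - a' j \<le> b j - a j"
    and "bounded (range a')" "bounded (range b')"
  shows "measurable_params a' b'"
proof -
  have "summable (\<lambda>j. max 0 (ln (b' j - a' j)))"
  proof (rule summable_comparison_test')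
    show "summable (\<lambda>j. max 0 (ln (b j - a j)))"
      using assms(1) by (simp add: measurable_params_def)
    show "norm (max 0 (ln (b' j - a' j))) \<le> max 0 (ln (b j - a j))" for j
    proof -
      have "ln (b' j - a' j) \<le> ln (b j - a j)"
        using assms(2,3)[of j] by (subst ln_le_cancel_iff) auto
      then show ?thesis by auto
    qed
  qed
  then show ?thesis using assms(4,5) by (simp add: measurable_params_def)
qed

text \<open>The two systems of coordinates agree up to sign and up to summable errors, so the edges
  are moved by these errors. The outer rectangle always exists. The inner one would be empty if some
  edge were too short, hence the condition inside the last conclusion.\<close>

lemma near_rectangles:
  fixes f g :: "nat \<Rightarrow> 'a::{real_inner, complete_space}"
  assumes f: "onb f" and g: "onb g" and fg: "offdiag_le f g \<delta>" and \<delta>: "0 < \<delta>" "\<delta> \<le> 1"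
    and ab: "nonempty_params a b" and R: "\<And>j. \<bar>a j\<bar> \<le> R" "\<And>j. \<bar>b j\<bar> \<le> R"
    and \<kappa>: "\<kappa> = (4 * R + 2) * \<delta>"
  obtains \<eta> a' b' where "\<And>j. 0 \<le> \<eta> j" "\<And>n. (\<Sum>j<n. \<eta> j) \<le> \<kappa>"
    "nonempty_params a' b'" "rectangle f a b \<subseteq> rectangle g a' b'" "\<And>j. b' j - a' j = b j - a j + 2 * \<eta> j"
    "(\<And>j. 4 * \<kappa> \<le> b j - a j) \<Longrightarrow> \<exists>a'' b''. nonempty_params a'' b'' \<and> rectangle g a'' b'' \<subseteq> rectangle f a b \<and>
       (\<forall>j. b'' j - a'' j = b j - a j - 2 * \<eta> j)"
proof -
  define \<epsilon> where "\<epsilon> j = suminf (offdiag f g j)" for j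
  \<comment> \<open>Points of the outer comparison have \<open>g\<close>-coordinates at most
    \<open>2 * R\<close>, and \<open>coordinate_change\<close> doubles this to \<open>4 * R\<close>.
    The geometric term makes the inequality strict, which is needed because a sign change turns a
    half-open edge around. The total is at most
    \<open>4 * R * \<delta> + 2 * \<delta> = \<kappa>\<close>.\<close>
  define \<eta> where "\<eta> j = 4 * R * \<epsilon> j + \<delta> * (1/2) ^ j" for j
  define pos where "pos j \<longleftrightarrow> 0 \<le> f j \<bullet> g j" for j
  define s :: "nat \<Rightarrow> real" where "s j = (if pos j then 1 else -1)" for j
  have R0: "0 \<le> R" using R(1)[of 0] by linarith
  have \<epsilon>0: "0 \<le> \<epsilon> j" for j
    unfolding \<epsilon>_def by (intro suminf_nonneg offdiag_row_summable[OF fg]) simp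
  have \<eta>pos: "0 < \<eta> j" "4 * R * \<epsilon> j < \<eta> j" for j
    using R0 \<epsilon>0[of j] \<delta>(1) by (simp_all add: \<eta>_def add_nonneg_pos)
  have \<eta>sum: "(\<Sum>j<n. \<eta> j) \<le> \<kappa>" for n
  proof -
    have "(\<Sum>j<n. (1/2::real) ^ j) \<le> (\<Sum>j. (1/2) ^ j)"
      by (intro sum_le_suminf) (auto simp: summable_geometric)
    also have "\<dots> = 2" by (subst suminf_geometric) auto
    finally have "(\<Sum>j<n. \<eta> j) \<le> 4 * R * \<delta> + \<delta> * 2"
      unfolding \<eta>_def sum.distrib sum_distrib_left[symmetric] \<epsilon>_def
      using R0 \<delta> offdiag_rows_le[OF fg] by (intro add_mono mult_left_mono) auto
    then show ?thesis by (simp add: \<kappa> algebra_simps)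
  qed
  have \<eta>le: "\<eta> j \<le> \<kappa>" for j
  proof -
    have "0 \<le> (\<Sum>j<j. \<eta> j)" by (intro sum_nonneg less_imp_le \<eta>pos(1))
    then show ?thesis using \<eta>sum[of "Suc j"] by simp
  qed
  have \<eta>summable: "summable \<eta>"
    by (rule summableI_nonneg_bounded[of _ \<kappa>]) (use \<eta>pos(1) \<eta>sum in \<open>auto intro: less_imp_le\<close>)
  have \<kappa>0: "0 \<le> \<kappa>" using R0 \<delta> by (simp add: \<kappa>)
  have bdd: "bounded (range c)" if "\<And>j. \<bar>c j\<bar> \<le> R + \<kappa>" for c :: "nat \<Rightarrow> real"
    using that unfolding bounded_iff by auto
  \<comment> \<open>Where the diagonal entry is negative, the edge is reflected at 0.\<close>
  define a' b' where "a' j = (if pos j then a j - \<eta> j else - b j - \<eta> j)"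
    and "b' j = (if pos j then b j + \<eta> j else - a j + \<eta> j)" for j
  have sub: "rectangle f a b \<subseteq> rectangle g a' b'"
  proof
    fix x assume x: "x \<in> rectangle f a b"
    then have xf: "a j \<le> x \<bullet> f j" "x \<bullet> f j < b j" for j by (auto simp: rectangle_def)
    have "\<bar>x \<bullet> f j\<bar> \<le> R" for j using xf[of j] R(1)[of j] R(2)[of j] by linarith
    then have "\<bar>x \<bullet> g i\<bar> \<le> R * (1 + \<delta>)" for i by (rule coordinate_bound[OF f g fg])
    moreover have "R * (1 + \<delta>) \<le> 2 * R" using R0 \<delta>(2) mult_left_mono[of "1 + \<delta>" 2 R] by simp
    ultimately have "\<bar>x \<bullet> g i\<bar> \<le> 2 * R" for i by (meson order_trans)
    then have "\<bar>x \<bullet> f j - s j * (x \<bullet> g j)\<bar> \<le> 2 * (2 * R) * \<epsilon> j" for j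
      unfolding \<epsilon>_def by (rule coordinate_change[OF f g fg]) (simp add: s_def pos_def)
    then have near: "\<bar>x \<bullet> f j - s j * (x \<bullet> g j)\<bar> \<le> 4 * R * \<epsilon> j" for j by simp
    have "a' j \<le> x \<bullet> g j \<and> x \<bullet> g j < b' j" for j
      using xf[of j] near[of j] \<eta>pos(2)[of j]
      by (cases "pos j") (auto simp: a'_def b'_def s_def)
    then show "x \<in> rectangle g a' b'" by (simp add: rectangle_def)
  qed
  have "measurable_params a' b'"
  proof (rule measurable_params_widen[OF nonempty_params_measurable[OF ab] nonempty_params_less[OF ab]])
    show "0 \<le> \<eta> j" for j using \<eta>pos(1)[of j] by simp
    show "summable \<eta>" by fact
    show "bounded (range a')" "bounded (range b')"
      by (intro bdd; use R \<eta>pos(1) \<eta>le in \<open>smt (verit) a'_def b'_def\<close>)+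
    show "b' j - a' j = b j - a j + 2 * \<eta> j" for j by (simp add: a'_def b'_def)
  qed
  moreover have "rectangle g a' b' \<noteq> {}"
    using sub ab nonempty_params_iff[OF onb_l2_coordinates[OF f]] by blast
  ultimately have good': "nonempty_params a' b'"
    using nonempty_params_iff[OF onb_l2_coordinates[OF g]] by blast
  have inner: "\<exists>a'' b''. nonempty_params a'' b'' \<and> rectangle g a'' b'' \<subseteq> rectangle f a b \<and>
       (\<forall>j. b'' j - a'' j = b j - a j - 2 * \<eta> j)" if d: "\<And>j. 4 * \<kappa> \<le> b j - a j"
  proof -
    define a'' b'' where "a'' j = (if pos j then a j + \<eta> j else - b j + \<eta> j)"
      and "b'' j = (if pos j then b j - \<eta> j else - a j - \<eta> j)" for j
    have len: "b'' j - a'' j = b j - a j - 2 * \<eta> j" for j by (simp add: a''_def b''_def)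
    have d': "4 * \<eta> j \<le> b j - a j" for j using d[of j] \<eta>le[of j] by linarith
    have less: "a'' j < b'' j - \<eta> j" for j
      using len[of j] d'[of j] \<eta>pos(1)[of j] by linarith
    obtain z where z: "summable (\<lambda>j. (z j)\<^sup>2)" "\<And>j. z j \<in> {a j..<b j}"
      using ab by (auto simp: nonempty_params_def)
    \<comment> \<open>The witness \<open>z\<close> for the original edges, with its signs adjusted,
      is clipped to the shortened edges. This moves it by at most \<open>2 * \<eta> j\<close>, so it
      stays square-summable; clipping at \<open>b'' j - \<eta> j\<close> keeps it strictly below the
      open end.\<close>
    define c where "c j = max (a'' j) (min (s j * z j) (b'' j - \<eta> j))" for j
    have c: "c j \<in> {a'' j..<b'' j}" for j using less[of j] \<eta>pos(1)[of j] by (auto simp: c_def)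
    have c_le: "\<bar>c j\<bar> \<le> \<bar>\<bar>z j\<bar> + 2 * \<eta> j\<bar>" for j
    proof -
      have "a'' j - \<eta> j \<le> s j * z j" "s j * z j \<le> b'' j + \<eta> j"
        using z(2)[of j] by (cases "pos j"; simp add: a''_def b''_def s_def)+
      then have "\<bar>c j - s j * z j\<bar> \<le> 2 * \<eta> j"
        using less[of j] \<eta>pos(1)[of j] unfolding c_def by linarith
      moreover have "\<bar>s j * z j\<bar> = \<bar>z j\<bar>" by (simp add: s_def)
      ultimately show ?thesis by linarith
    qed
    have "summable (\<lambda>j. (\<bar>z j\<bar> + 2 * \<eta> j)\<^sup>2)"
    proof (rule square_summable_add)
      show "summable (\<lambda>j. \<bar>z j\<bar>\<^sup>2)" using z(1) by simp
      show "summable (\<lambda>j. (2 * \<eta> j)\<^sup>2)"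
      proof (rule summable_comparison_test')
        show "summable (\<lambda>j. 4 * \<kappa> * \<eta> j)" using \<eta>summable by (intro summable_mult)
        show "norm ((2 * \<eta> j)\<^sup>2) \<le> 4 * \<kappa> * \<eta> j" for j
          using mult_right_mono[OF \<eta>le[of j], of "\<eta> j"] \<eta>pos(1)[of j] by (simp add: power2_eq_square)
      qed
    qed
    then have "summable (\<lambda>j. (c j)\<^sup>2)" using c_le by (rule square_summable_abs_le)
    moreover have "measurable_params a'' b''"
    proof (rule measurable_params_narrow[OF nonempty_params_measurable[OF ab]])
      show "a'' j < b'' j" "b'' j - a'' j \<le> b j - a j" for j
        using less[of j] len[of j] \<eta>pos(1)[of j] by linarith+
      show "bounded (range a'')" "bounded (range b'')"
        by (intro bdd; use R \<eta>pos(1) \<eta>le in \<open>smt (verit) a''_def b''_def\<close>)+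
    qed
    ultimately have "nonempty_params a'' b''" using c unfolding nonempty_params_def by (intro conjI exI[of _ c]) auto
    moreover have "rectangle g a'' b'' \<subseteq> rectangle f a b"
    proof
      fix x assume x: "x \<in> rectangle g a'' b''"
      then have xg: "a'' j \<le> x \<bullet> g j" "x \<bullet> g j < b'' j" for j by (auto simp: rectangle_def)
      have "\<bar>x \<bullet> g j\<bar> \<le> R" for j
        using xg[of j] R(1)[of j] R(2)[of j] \<eta>pos(1)[of j]
        unfolding a''_def b''_def by (auto split: if_splits)
      then have "\<bar>x \<bullet> f j - s j * (x \<bullet> g j)\<bar> \<le> 2 * R * \<epsilon> j" for j
        unfolding \<epsilon>_def by (rule coordinate_change[OF f g fg]) (simp add: s_def pos_def)
      moreover have "2 * R * \<epsilon> j < \<eta> j" for j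
        using \<eta>pos(2)[of j] mult_nonneg_nonneg[OF R0 \<epsilon>0[of j]] by linarith
      ultimately have near: "\<bar>x \<bullet> f j - s j * (x \<bullet> g j)\<bar> < \<eta> j" for j by (meson le_less_trans)
      have "a j \<le> x \<bullet> f j \<and> x \<bullet> f j < b j" for j
        using xg[of j] near[of j] unfolding a''_def b''_def s_def by (auto split: if_splits)
      then show "x \<in> rectangle f a b" by (simp add: rectangle_def)
    qed
    ultimately show ?thesis using len by blast
  qed
  show ?thesis
  proof (rule that)
    show "0 \<le> \<eta> j" for j using \<eta>pos(1)[of j] by simp
    show "b' j - a' j = b j - a j + 2 * \<eta> j" for j by (simp add: a'_def b'_def)
  qed (fact \<eta>sum good' sub inner)+
qed

text \<open>The volume may be 0, so relative changes cannot be used. Finitely many edges depend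
  continuously on \<open>\<kappa>\<close>, and the rest of the product is bounded through the
  summable positive parts of the logarithms. The threshold depends on the original rectangle and
  \<open>\<epsilon>\<close> only.\<close>

lemma volume_widen:
  assumes ab: "nonempty_params a b" and "\<epsilon> > 0"
  obtains \<kappa>0 where "\<kappa>0 > 0"
    "\<And>\<kappa> \<eta> a' b'. 0 < \<kappa> \<Longrightarrow> \<kappa> < \<kappa>0 \<Longrightarrow> nonempty_params a' b' \<Longrightarrow> (\<And>j. 0 \<le> \<eta> j) \<Longrightarrow> (\<And>n. (\<Sum>j<n. \<eta> j) \<le> \<kappa>) \<Longrightarrow>
       (\<And>j. b' j - a' j = b j - a j + 2 * \<eta> j) \<Longrightarrow> rectangle_volume a' b' < rectangle_volume a b + \<epsilon>"
proof -
  define d where "d j = b j - a j" for j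
  define u where "u j = max 0 (ln (d j))" for j
  \<comment> \<open>The tail of the positive parts: \<open>exp (T k)\<close> bounds every finite
    product of edges from index \<open>k\<close> on, and it tends to 1.\<close>
  define T where "T k = suminf u - (\<Sum>j<k. u j)" for k
  have d: "0 < d j" for j using nonempty_params_less[OF ab, of j] by (simp add: d_def)
  have u: "summable u" "\<And>j. 0 \<le> u j"
    using nonempty_params_measurable[OF ab] unfolding measurable_params_def u_def[abs_def] d_def by simp_all
  have "T \<longlonglongrightarrow> suminf u - suminf u"
    unfolding T_def using u(1) by (intro tendsto_diff tendsto_const summable_LIMSEQ)
  then have "(\<lambda>k. (\<Prod>j<k. d j) * exp (T k)) \<longlonglongrightarrow> rectangle_volume a b * exp (suminf u - suminf u)"
    unfolding d_def
    by (intro tendsto_mult tendsto_exp rectangle_volume_tendsto nonempty_params_less[OF ab] nonempty_params_measurable[OF ab])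
  then have "\<forall>\<^sub>F k in sequentially. (\<Prod>j<k. d j) * exp (T k) < rectangle_volume a b + \<epsilon>"
    using \<open>\<epsilon> > 0\<close> by (intro order_tendstoD(2)) auto
  then obtain k where k: "(\<Prod>j<k. d j) * exp (T k) < rectangle_volume a b + \<epsilon>"
    unfolding eventually_sequentially by blast
  have "((\<lambda>\<kappa>. (\<Prod>j<k. d j + 2 * \<kappa>) * exp (T k + 2 * \<kappa>)) \<longlongrightarrow> (\<Prod>j<k. d j + 2 * 0) * exp (T k + 2 * 0)) (at_right 0)"
    by (intro tendsto_intros)
  then have "\<forall>\<^sub>F \<kappa> in at_right 0. (\<Prod>j<k. d j + 2 * \<kappa>) * exp (T k + 2 * \<kappa>) < rectangle_volume a b + \<epsilon>"
    using k by (intro order_tendstoD(2)) auto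
  then obtain \<kappa>0 where \<kappa>0: "\<kappa>0 > 0"
    "\<And>\<kappa>. 0 < \<kappa> \<Longrightarrow> \<kappa> < \<kappa>0 \<Longrightarrow> (\<Prod>j<k. d j + 2 * \<kappa>) * exp (T k + 2 * \<kappa>) < rectangle_volume a b + \<epsilon>"
    unfolding eventually_at_right_field by blast
  show ?thesis
  proof (rule that[OF \<kappa>0(1)])
    fix \<kappa> and \<eta> a' b' :: "nat \<Rightarrow> real"
    assume \<kappa>: "0 < \<kappa>" "\<kappa> < \<kappa>0" and good: "nonempty_params a' b'" and \<eta>: "\<And>j. 0 \<le> \<eta> j" "\<And>n. (\<Sum>j<n. \<eta> j) \<le> \<kappa>"
      and d': "\<And>j. b' j - a' j = b j - a j + 2 * \<eta> j"
    have \<eta>le: "\<eta> j \<le> \<kappa>" for j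
    proof -
      have "0 \<le> (\<Sum>j<j. \<eta> j)" by (intro sum_nonneg \<eta>(1))
      then show ?thesis using \<eta>(2)[of "Suc j"] by simp
    qed
    have "(\<Prod>j<m. b' j - a' j) \<le> (\<Prod>j<k. d j + 2 * \<kappa>) * exp (T k + 2 * \<kappa>)" if "m \<ge> k" for m
    proof -
      have split: "{..<m} = {..<k} \<union> {k..<m}" using that by auto
      have "(\<Prod>j<m. b' j - a' j) = (\<Prod>j<k. d j + 2 * \<eta> j) * (\<Prod>j\<in>{k..<m}. d j + 2 * \<eta> j)"
        unfolding split d' d_def by (rule prod.union_disjoint) auto
      also have "\<dots> \<le> (\<Prod>j<k. d j + 2 * \<kappa>) * exp (\<Sum>j\<in>{k..<m}. u j + 2 * \<eta> j)"
      proof (intro mult_mono prod_mono)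
        show "0 \<le> d j + 2 * \<eta> j \<and> d j + 2 * \<eta> j \<le> d j + 2 * \<kappa>" for j
          using d[of j] \<eta>(1)[of j] \<eta>le[of j] by simp
        have "(\<Prod>j\<in>{k..<m}. d j + 2 * \<eta> j) \<le> (\<Prod>j\<in>{k..<m}. exp (u j + 2 * \<eta> j))"
        proof (rule prod_mono)
          show "0 \<le> d j + 2 * \<eta> j \<and> d j + 2 * \<eta> j \<le> exp (u j + 2 * \<eta> j)" for j
            using d[of j] \<eta>(1)[of j] widen_le_exp[OF d \<eta>(1), of j j] by (simp add: u_def exp_add)
        qed
        then show "(\<Prod>j\<in>{k..<m}. d j + 2 * \<eta> j) \<le> exp (\<Sum>j\<in>{k..<m}. u j + 2 * \<eta> j)"
          by (simp add: exp_sum)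
        show "0 \<le> (\<Prod>j<k. d j + 2 * \<kappa>)"
          using d \<kappa>(1) by (intro prod_nonneg) (simp add: add_nonneg_nonneg less_imp_le)
        show "0 \<le> (\<Prod>j\<in>{k..<m}. d j + 2 * \<eta> j)"
          using d \<eta>(1) by (intro prod_nonneg) (simp add: add_nonneg_nonneg less_imp_le)
      qed
      also have "\<dots> \<le> (\<Prod>j<k. d j + 2 * \<kappa>) * exp (T k + 2 * \<kappa>)"
      proof (intro mult_left_mono)
        have "(\<Sum>j<m. u j) = (\<Sum>j<k. u j) + (\<Sum>j\<in>{k..<m}. u j)"
          unfolding split by (rule sum.union_disjoint) auto
        moreover have "(\<Sum>j<m. u j) \<le> suminf u" using u by (intro sum_le_suminf) auto
        moreover have "(\<Sum>j\<in>{k..<m}. \<eta> j) \<le> (\<Sum>j<m. \<eta> j)"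
          using \<eta>(1) by (intro sum_mono2) auto
        moreover have "(\<Sum>j<m. \<eta> j) \<le> \<kappa>" by (rule \<eta>(2))
        ultimately have "(\<Sum>j\<in>{k..<m}. u j) + 2 * (\<Sum>j\<in>{k..<m}. \<eta> j) \<le> T k + 2 * \<kappa>"
          unfolding T_def by linarith
        then show "exp (\<Sum>j\<in>{k..<m}. u j + 2 * \<eta> j) \<le> exp (T k + 2 * \<kappa>)"
          by (simp add: sum.distrib sum_distrib_left)
        show "0 \<le> (\<Prod>j<k. d j + 2 * \<kappa>)"
          using d \<kappa>(1) by (intro prod_nonneg) (simp add: add_nonneg_nonneg less_imp_le)
      qed
      finally show ?thesis .
    qed
    then have "rectangle_volume a' b' \<le> (\<Prod>j<k. d j + 2 * \<kappa>) * exp (T k + 2 * \<kappa>)"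
      by (intro LIMSEQ_le_const2[OF rectangle_volume_tendsto[OF nonempty_params_less[OF good] nonempty_params_measurable[OF good]]]) blast
    also have "\<dots> < rectangle_volume a b + \<epsilon>" using \<kappa>0(2) \<kappa> by blast
    finally show "rectangle_volume a' b' < rectangle_volume a b + \<epsilon>" .
  qed
qed

text \<open>Positive volume means that the logarithms are summable, so the edges tend to 1 and have
  a positive lower bound \<open>l\<close>. Relative losses are then at most
  \<open>2 * \<eta> j / l\<close>, and Weierstrass' product inequality bounds their joint effect by
  the sum.\<close>

lemma volume_narrow:
  assumes ab: "nonempty_params a b" and V: "0 < rectangle_volume a b" and "\<epsilon> > 0"
  obtains \<kappa>0 where "\<kappa>0 > 0" "\<And>j. 4 * \<kappa>0 \<le> b j - a j"
    "\<And>\<kappa> \<eta> a' b'. 0 < \<kappa> \<Longrightarrow> \<kappa> < \<kappa>0 \<Longrightarrow> nonempty_params a' b' \<Longrightarrow> (\<And>j. 0 \<le> \<eta> j) \<Longrightarrow> (\<And>n. (\<Sum>j<n. \<eta> j) \<le> \<kappa>) \<Longrightarrow>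
       (\<And>j. b' j - a' j = b j - a j - 2 * \<eta> j) \<Longrightarrow> rectangle_volume a b - \<epsilon> < rectangle_volume a' b'"
proof -
  define d where "d j = b j - a j" for j
  let ?V = "rectangle_volume a b"
  have d: "0 < d j" for j using nonempty_params_less[OF ab, of j] by (simp add: d_def)
  have "summable (\<lambda>j. ln (d j))"
    using V by (auto simp: rectangle_volume_def d_def split: if_splits)
  then have "(\<lambda>j. ln (d j)) \<longlonglongrightarrow> 0" by (rule summable_LIMSEQ_zero)
  then have "\<forall>\<^sub>F j in sequentially. -1 < ln (d j)" by (intro order_tendstoD(1)) auto
  then obtain n where n: "\<And>j. j \<ge> n \<Longrightarrow> -1 < ln (d j)" unfolding eventually_sequentially by blast
  define l where "l = Min (insert (exp (-1)) (d ` {..<n}))"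
  have l0: "0 < l" using d by (simp add: l_def)
  have l: "l \<le> d j" for j
  proof (cases "j < n")
    case True
    then show ?thesis unfolding l_def by (intro Min_le) auto
  next
    case False
    then have "exp (-1) < exp (ln (d j))" using n[of j] by simp
    moreover have "l \<le> exp (-1)" unfolding l_def by (intro Min_le) auto
    ultimately show ?thesis using d[of j] by simp
  qed
  \<comment> \<open>The first bound keeps every edge at least \<open>4 * \<kappa>0\<close>; the
    second makes the volume loss \<open>?V * (2 * \<kappa> / l)\<close> smaller than
    \<open>\<epsilon>\<close>.\<close>
  define \<kappa>0 where "\<kappa>0 = min (l / 4) (\<epsilon> * l / (2 * ?V))"
  have \<kappa>0: "0 < \<kappa>0" "4 * \<kappa>0 \<le> l" "2 * \<kappa>0 * ?V \<le> \<epsilon> * l"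
    using l0 V \<open>\<epsilon> > 0\<close> by (auto simp: \<kappa>0_def min_def field_simps)
  show ?thesis
  proof (rule that[OF \<kappa>0(1)])
    show "4 * \<kappa>0 \<le> b j - a j" for j using \<kappa>0(2) l[of j] by (simp add: d_def)
    fix \<kappa> and \<eta> a' b' :: "nat \<Rightarrow> real"
    assume \<kappa>: "0 < \<kappa>" "\<kappa> < \<kappa>0" and good: "nonempty_params a' b'" and \<eta>: "\<And>j. 0 \<le> \<eta> j" "\<And>n. (\<Sum>j<n. \<eta> j) \<le> \<kappa>"
      and d': "\<And>j. b' j - a' j = b j - a j - 2 * \<eta> j"
    have \<eta>le: "\<eta> j \<le> \<kappa>" for j
    proof -
      have "0 \<le> (\<Sum>j<j. \<eta> j)" by (intro sum_nonneg \<eta>(1))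
      then show ?thesis using \<eta>(2)[of "Suc j"] by simp
    qed
    have "(\<Prod>j<m. d j) * (1 - 2 * \<kappa> / l) \<le> (\<Prod>j<m. b' j - a' j)" for m
    proof -
      have "(\<Sum>j<m. 2 * \<eta> j / d j) \<le> (\<Sum>j<m. 2 * \<eta> j / l)"
        using \<eta>(1) d l l0 by (intro sum_mono divide_left_mono) auto
      also have "\<dots> = 2 * (\<Sum>j<m. \<eta> j) / l"
        by (simp add: sum_divide_distrib sum_distrib_left)
      also have "\<dots> \<le> 2 * \<kappa> / l" using \<eta>(2)[of m] l0 by (intro divide_right_mono) auto
      finally have "1 - 2 * \<kappa> / l \<le> 1 - (\<Sum>j<m. 2 * \<eta> j / d j)" by simp
      also have "\<dots> \<le> (\<Prod>j<m. 1 - 2 * \<eta> j / d j)"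
      proof (rule Weierstrass_prod_ineq)
        show "2 * \<eta> j / d j \<in> {0..1}" for j
          using \<eta>(1)[of j] \<eta>le[of j] \<kappa> \<kappa>0(2) l[of j] d[of j] by simp
      qed
      finally have "(\<Prod>j<m. d j) * (1 - 2 * \<kappa> / l) \<le> (\<Prod>j<m. d j) * (\<Prod>j<m. 1 - 2 * \<eta> j / d j)"
        using d by (intro mult_left_mono) (auto intro!: prod_nonneg intro: less_imp_le)
      also have "\<dots> = (\<Prod>j<m. b' j - a' j)"
        unfolding prod.distrib[symmetric]
      proof (rule prod.cong[OF refl])
        show "d j * (1 - 2 * \<eta> j / d j) = b' j - a' j" for j
          using d[of j] d'[of j] by (simp add: right_diff_distrib d_def)
      qed
      finally show ?thesis .
    qed
    moreover have "(\<lambda>m. (\<Prod>j<m. d j) * (1 - 2 * \<kappa> / l)) \<longlonglongrightarrow> ?V * (1 - 2 * \<kappa> / l)"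
      unfolding d_def
      by (intro tendsto_mult_right rectangle_volume_tendsto nonempty_params_less[OF ab] nonempty_params_measurable[OF ab])
    ultimately have "?V * (1 - 2 * \<kappa> / l) \<le> rectangle_volume a' b'"
      by (intro LIMSEQ_le[OF _ rectangle_volume_tendsto[OF nonempty_params_less[OF good] nonempty_params_measurable[OF good]]]) blast+
    moreover have "?V * (2 * \<kappa> / l) < \<epsilon>"
    proof -
      have "2 * \<kappa> * ?V < 2 * \<kappa>0 * ?V" using \<kappa>(2) V by simp
      with \<kappa>0(3) have "2 * \<kappa> * ?V < \<epsilon> * l" by linarith
      then show ?thesis using l0 by (simp add: field_simps)
    qed
    ultimately show "?V - \<epsilon> < rectangle_volume a' b'" by (simp add: right_diff_distrib)
  qed
qed

text \<open>The tolerances from \<open>volume_widen\<close> and \<open>volume_narrow\<close> depend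
  on the rectangle and on \<open>\<epsilon>\<close> alone, so they can be fixed before a basis
  \<open>g\<close> close enough to \<open>f\<close> is chosen.\<close>

lemma refines_limit:
  fixes e f :: "nat \<Rightarrow> 'a::{real_inner, complete_space}"
  assumes e: "l2_coordinates e" and f: "onb f"
    and approx: "\<And>\<delta>. \<delta> > 0 \<Longrightarrow> \<exists>g. onb g \<and> refines e g \<and> offdiag_le f g \<delta>"
  shows "refines e f"
  unfolding refines_def
proof (intro allI impI)
  fix a b assume ab: "nonempty_params a b"
  let ?V = "rectangle_volume a b"
  interpret content "rectangle_ring e" "ring_measure e" using content_ring_measure[OF e] .
  obtain Ra Rb where "\<And>j. \<bar>a j\<bar> \<le> Ra" "\<And>j. \<bar>b j\<bar> \<le> Rb"
    using ab unfolding nonempty_params_def measurable_params_def bounded_iff by auto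
  then have R: "\<bar>a j\<bar> \<le> max Ra Rb" "\<bar>b j\<bar> \<le> max Ra Rb" for j by (simp_all add: le_max_iff_disj)
  define C where "C = 4 * max Ra Rb + 2"
  have C: "0 < C" using R(1)[of 0] by (simp add: C_def)
  show "sandwiched (rectangle_ring e) (ring_measure e) (rectangle f a b) ?V"
  proof (rule sandwiched_squeeze)
    fix \<epsilon> :: real assume "\<epsilon> > 0"
    obtain \<kappa>0 where \<kappa>0: "\<kappa>0 > 0"
      "\<And>\<kappa> \<eta> a' b'. 0 < \<kappa> \<Longrightarrow> \<kappa> < \<kappa>0 \<Longrightarrow> nonempty_params a' b' \<Longrightarrow> (\<And>j. 0 \<le> \<eta> j) \<Longrightarrow> (\<And>n. (\<Sum>j<n. \<eta> j) \<le> \<kappa>) \<Longrightarrow>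
       (\<And>j. b' j - a' j = b j - a j + 2 * \<eta> j) \<Longrightarrow> rectangle_volume a' b' < ?V + \<epsilon>"
      using volume_widen[OF ab \<open>\<epsilon> > 0\<close>] by blast
    have outer: "\<exists>D w. sandwiched (rectangle_ring e) (ring_measure e) D w \<and> rectangle f a b \<subseteq> D \<and> w < ?V + \<epsilon>"
    proof -
      \<comment> \<open>\<open>C\<close> is the factor \<open>4 * R + 2\<close> of
        \<open>near_rectangles\<close>; the 2 in the denominator gives the strict inequality
        \<open>C * \<delta> < \<kappa>0\<close>.\<close>
      define \<delta> where "\<delta> = min 1 (\<kappa>0 / (2 * C))"
      have \<delta>: "0 < \<delta>" "\<delta> \<le> 1" "C * \<delta> < \<kappa>0"
        using C \<kappa>0(1) by (auto simp: \<delta>_def min_def field_simps)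
      obtain g where g: "onb g" "refines e g" "offdiag_le f g \<delta>" using approx[OF \<delta>(1)] by blast
      obtain \<eta> a' b' where *: "\<And>j. 0 \<le> \<eta> j" "\<And>n. (\<Sum>j<n. \<eta> j) \<le> C * \<delta>"
        "nonempty_params a' b'" "rectangle f a b \<subseteq> rectangle g a' b'" "\<And>j. b' j - a' j = b j - a j + 2 * \<eta> j"
        using near_rectangles[OF f g(1,3) \<delta>(1,2) ab R refl] unfolding C_def by metis
      have "rectangle_volume a' b' < ?V + \<epsilon>"
        using C \<delta> by (intro \<kappa>0(2)[of "C * \<delta>" a' b' \<eta>] *) auto
      then show ?thesis using g(2) *(3,4) unfolding refines_def by blast
    qed
    have inner: "\<exists>B u. sandwiched (rectangle_ring e) (ring_measure e) B u \<and> B \<subseteq> rectangle f a b \<and> ?V - \<epsilon> < u"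
    \<comment> \<open>With volume 0 the edges may come arbitrarily close to 0, so no shrunken
      rectangle need exist, but the empty set is already good enough from inside.\<close>
    proof (cases "?V = 0")
      case True
      then show ?thesis using sandwiched_empty \<open>\<epsilon> > 0\<close> by (intro exI[of _ "{}"] exI[of _ "0::real"]) auto
    next
      case False
      then have V: "0 < ?V" using rectangle_volume_nonneg[of a b] by simp
      obtain \<kappa>1 where \<kappa>1: "\<kappa>1 > 0" "\<And>j. 4 * \<kappa>1 \<le> b j - a j"
        "\<And>\<kappa> \<eta> a' b'. 0 < \<kappa> \<Longrightarrow> \<kappa> < \<kappa>1 \<Longrightarrow> nonempty_params a' b' \<Longrightarrow> (\<And>j. 0 \<le> \<eta> j) \<Longrightarrow> (\<And>n. (\<Sum>j<n. \<eta> j) \<le> \<kappa>) \<Longrightarrow>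
         (\<And>j. b' j - a' j = b j - a j - 2 * \<eta> j) \<Longrightarrow> ?V - \<epsilon> < rectangle_volume a' b'"
        using volume_narrow[OF ab V \<open>\<epsilon> > 0\<close>] by blast
      define \<delta> where "\<delta> = min 1 (\<kappa>1 / (2 * C))"
      have \<delta>: "0 < \<delta>" "\<delta> \<le> 1" "C * \<delta> < \<kappa>1"
        using C \<kappa>1(1) by (auto simp: \<delta>_def min_def field_simps)
      have d: "4 * (C * \<delta>) \<le> b j - a j" for j using \<kappa>1(2)[of j] \<delta>(3) by linarith
      obtain g where g: "onb g" "refines e g" "offdiag_le f g \<delta>" using approx[OF \<delta>(1)] by blast
      obtain \<eta> where \<eta>: "\<And>j. 0 \<le> \<eta> j" "\<And>n. (\<Sum>j<n. \<eta> j) \<le> C * \<delta>"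
        "\<exists>a'' b''. nonempty_params a'' b'' \<and> rectangle g a'' b'' \<subseteq> rectangle f a b \<and>
           (\<forall>j. b'' j - a'' j = b j - a j - 2 * \<eta> j)"
        using near_rectangles[OF f g(1,3) \<delta>(1,2) ab R refl] d unfolding C_def by metis
      then obtain a'' b'' where *: "nonempty_params a'' b''" "rectangle g a'' b'' \<subseteq> rectangle f a b"
        "\<And>j. b'' j - a'' j = b j - a j - 2 * \<eta> j" by blast
      have "?V - \<epsilon> < rectangle_volume a'' b''"
        using C \<delta> by (intro \<kappa>1(3)[of "C * \<delta>" a'' b'' \<eta>] * \<eta>(1,2)) auto
      then show ?thesis using g(2) *(1,2) unfolding refines_def by blast
    qed
    show "\<exists>B D u w. sandwiched (rectangle_ring e) (ring_measure e) B u \<and>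
      sandwiched (rectangle_ring e) (ring_measure e) D w \<and> B \<subseteq> rectangle f a b \<and> rectangle f a b \<subseteq> D
        \<and> ?V - \<epsilon> < u \<and> w < ?V + \<epsilon>"
      using outer inner by blast
  qed
qed

section \<open>Triangularisation of an almost diagonal change of basis\<close>

text \<open>The square truncations increase to the total mass; \<open>N\<close> is taken so that the
  leading square already contains all of it up to \<open>\<epsilon>\<close>.\<close>

lemma offdiag_le_tail:
  assumes T: "offdiag_le f e T" and "\<epsilon> > 0"
  obtains N where "\<And>n. (\<Sum>j<n. \<Sum>i<n. if j < N \<and> i < N then 0 else offdiag f e j i) \<le> \<epsilon>"
proof -
  define S where "S n = (\<Sum>j<n. \<Sum>i<n. offdiag f e j i)" for n
  have mono: "S m \<le> S n" if "m \<le> n" for m n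
    unfolding S_def using that
    by (intro order_trans[OF sum_mono2[of "{..<n}" "{..<m}"]] sum_mono sum_mono2) (auto intro: sum_nonneg)
  have bdd: "bdd_above (range S)" using T unfolding offdiag_le_def S_def by (intro bdd_aboveI2) auto
  have "(SUP n. S n) - \<epsilon> < (SUP n. S n)" using \<open>\<epsilon> > 0\<close> by simp
  then obtain N where N: "(SUP n. S n) - \<epsilon> < S N"
    using bdd by (subst (asm) less_cSUP_iff) auto
  have "(\<Sum>j<n. \<Sum>i<n. if j < N \<and> i < N then 0 else offdiag f e j i) \<le> \<epsilon>" for n
  proof (cases "n \<le> N")
    case True
    then have "(\<Sum>j<n. \<Sum>i<n. if j < N \<and> i < N then 0 else offdiag f e j i) = 0"
      by (intro sum.neutral ballI) auto
    then show ?thesis using \<open>\<epsilon> > 0\<close> by simp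
  next
    case False
    have "(\<Sum>j<n. \<Sum>i<n. if j < N \<and> i < N then offdiag f e j i else 0)
        = (\<Sum>j<n. if j < N then (\<Sum>i<N. offdiag f e j i) else 0)"
    proof (intro sum.cong refl)
      fix j
      show "(\<Sum>i<n. if j < N \<and> i < N then offdiag f e j i else 0) = (if j < N then (\<Sum>i<N. offdiag f e j i) else 0)"
        using False by (simp add: sum.If_cases Int_def) (intro impI sum.cong, auto)
    qed
    also have "\<dots> = S N"
      using False by (simp add: S_def sum.If_cases Int_def) (intro sum.cong, auto)
    finally have SN: "(\<Sum>j<n. \<Sum>i<n. if j < N \<and> i < N then offdiag f e j i else 0) = S N" .
    have "S n = (\<Sum>j<n. \<Sum>i<n. (if j < N \<and> i < N then offdiag f e j i else 0)
        + (if j < N \<and> i < N then 0 else offdiag f e j i))"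
      unfolding S_def by (intro sum.cong) auto
    then have "S n = S N + (\<Sum>j<n. \<Sum>i<n. if j < N \<and> i < N then 0 else offdiag f e j i)"
      unfolding sum.distrib SN .
    moreover have "S n \<le> (SUP n. S n)" by (intro cSUP_upper bdd) simp
    ultimately show ?thesis using N by linarith
  qed
  then show ?thesis by (rule that)
qed

text \<open>With \<open>\<omega> j i = f j \<bullet> g i\<close> lower triangular for \<open>i < N\<close>, Parseval's identity for
  \<open>f j \<bullet> f k = 0\<close> gives \<open>\<omega> k k * \<omega> j k = - (\<Sum>i<k. \<omega> j i * \<omega> k i) - (\<Sum>i\<ge>N. \<omega> j i * \<omega> k i)\<close> for
  \<open>k < N\<close>, \<open>k < j\<close>. The second sum is small by the choice of \<open>N\<close>, so this recursion bounds the
  rows of the strictly lower triangular part one after the other.\<close>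

lemma triangular_offdiag_le:
  fixes e f g :: "nat \<Rightarrow> 'a::{real_inner, complete_space}"
  assumes e: "onb e" and f: "onb f" and g: "onb g" and T: "offdiag_le f e T"
    and tail: "\<And>n. (\<Sum>j<n. \<Sum>i<n. if j < N \<and> i < N then 0 else offdiag f e j i) \<le> \<epsilon>"
    and ge: "\<And>i. N \<le> i \<Longrightarrow> g i = e i" and tri: "\<And>j i. j < i \<Longrightarrow> i < N \<Longrightarrow> f j \<bullet> g i = 0"
    and \<epsilon>: "16 * (1 + T) * \<epsilon> \<le> 1"
  shows "offdiag_le f g (\<epsilon> + 4 * (1 + T) * \<epsilon>)"
proof -
  define \<omega> where "\<omega> j i = \<bar>f j \<bullet> g i\<bar>" for j i
  define D where "D = offdiag f e"
  have T0: "0 \<le> T" using T[unfolded offdiag_le_def, rule_format, of 0] by simp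
  have \<epsilon>0: "0 \<le> \<epsilon>" using tail[of 0] by simp
  have \<epsilon>1: "\<epsilon> \<le> 1/16"
  proof -
    have "16 * (1 + T) * \<epsilon> = 16 * \<epsilon> + 16 * (T * \<epsilon>)" by (simp add: algebra_simps)
    then show ?thesis using \<epsilon> mult_nonneg_nonneg[OF T0 \<epsilon>0] by linarith
  qed
  have tail_block: "(\<Sum>j<m. \<Sum>i\<in>{N..<n}. D j i) \<le> \<epsilon>" for m n
  proof -
    let ?M = "max m n"
    have "(\<Sum>j<m. \<Sum>i\<in>{N..<n}. D j i) \<le> (\<Sum>j<?M. \<Sum>i\<in>{N..<n}. D j i)"
      by (intro sum_mono2) (auto simp: D_def intro: sum_nonneg)
    also have "\<dots> \<le> (\<Sum>j<?M. \<Sum>i<?M. if j < N \<and> i < N then 0 else D j i)"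
    proof (rule sum_mono)
      fix j
      have "(\<Sum>i\<in>{N..<n}. D j i) = (\<Sum>i\<in>{N..<n}. if j < N \<and> i < N then 0 else D j i)"
        by (intro sum.cong) auto
      also have "\<dots> \<le> (\<Sum>i<?M. if j < N \<and> i < N then 0 else D j i)"
        by (intro sum_mono2) (auto simp: D_def)
      finally show "(\<Sum>i\<in>{N..<n}. D j i) \<le> \<dots>" .
    qed
    also have "\<dots> \<le> \<epsilon>" unfolding D_def by (rule tail)
    finally show ?thesis .
  qed
  have a_le1: "\<bar>f j \<bullet> e i\<bar> \<le> 1" for i j by (rule onb_abs_inner_le[OF f e])
  have \<omega>1: "\<omega> j i \<le> 1" "0 \<le> \<omega> j i" for i j unfolding \<omega>_def using onb_abs_inner_le[OF f g] by simp_all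
  \<comment> \<open>A bound for the part of the Parseval sum with \<open>i \<ge> N\<close>. There
    \<open>g\<close> equals \<open>e\<close>, so this quantity does not depend on the
    rotation.\<close>
  define \<kappa> where "\<kappa> j k = (\<Sum>i. \<bar>f j \<bullet> e (i + N)\<bar> * \<bar>f k \<bullet> e (i + N)\<bar>)" for j k
  have row_summable: "summable (\<lambda>i. \<bar>f k \<bullet> e (i + N)\<bar>)" for k
    using sums_summable[OF abs_inner_row_sums[OF T, of k]] by (subst summable_iff_shift)
  have \<kappa>_summable: "summable (\<lambda>i. \<bar>f j \<bullet> e (i + N)\<bar> * \<bar>f k \<bullet> e (i + N)\<bar>)" for j k
  proof (rule summable_comparison_test'[OF row_summable[of k]])
    show "norm (\<bar>f j \<bullet> e (i + N)\<bar> * \<bar>f k \<bullet> e (i + N)\<bar>) \<le> \<bar>f k \<bullet> e (i + N)\<bar>" for i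
      using mult_right_mono[OF a_le1[of j "i + N"], of "\<bar>f k \<bullet> e (i + N)\<bar>"] by (simp add: abs_mult)
  qed
  have \<kappa>0: "0 \<le> \<kappa> j k" for j k unfolding \<kappa>_def by (intro suminf_nonneg \<kappa>_summable) simp
  \<comment> \<open>Summing over \<open>j\<close> first leaves column sums of moduli, at most
    \<open>1 + T\<close> each (diagonal entry plus off-diagonal mass). What remains is the mass of
    the columns from \<open>N\<close> on, at most \<open>\<epsilon>\<close>.\<close>
  have \<kappa>_total: "(\<Sum>j<n. \<Sum>k<N. \<kappa> j k) \<le> (1 + T) * \<epsilon>" for n
  proof -
    have part: "(\<Sum>j<n. \<Sum>k<N. \<Sum>i<m. \<bar>f j \<bullet> e (i + N)\<bar> * \<bar>f k \<bullet> e (i + N)\<bar>) \<le> (1 + T) * \<epsilon>" for m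
    proof -
      have col: "(\<Sum>j<n. \<bar>f j \<bullet> e i\<bar>) \<le> 1 + T" for i
      proof -
        have "(\<Sum>j<n. \<bar>f j \<bullet> e i\<bar>) \<le> (\<Sum>j<n. (if i = j then 1 else 0) + D j i)"
          using a_le1 by (intro sum_mono) (auto simp: D_def offdiag_def)
        also have "\<dots> \<le> 1 + (\<Sum>j<n. D j i)" by (simp add: sum.distrib)
        also have "(\<Sum>j<n. D j i) \<le> (\<Sum>j<n. \<Sum>i<Suc i. D j i)"
          by (intro sum_mono) (simp add: D_def sum_nonneg)
        also have "\<dots> \<le> T" unfolding D_def by (rule offdiag_le_sum[OF T])
        finally show ?thesis by simp
      qed
      have "(\<Sum>j<n. \<Sum>k<N. \<Sum>i<m. \<bar>f j \<bullet> e (i + N)\<bar> * \<bar>f k \<bullet> e (i + N)\<bar>)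
          = (\<Sum>k<N. \<Sum>j<n. \<Sum>i<m. \<bar>f j \<bullet> e (i + N)\<bar> * \<bar>f k \<bullet> e (i + N)\<bar>)"
        by (rule sum.swap)
      also have "\<dots> = (\<Sum>k<N. \<Sum>i<m. \<Sum>j<n. \<bar>f j \<bullet> e (i + N)\<bar> * \<bar>f k \<bullet> e (i + N)\<bar>)"
        by (rule sum.cong[OF refl], rule sum.swap)
      also have "\<dots> = (\<Sum>k<N. \<Sum>i<m. (\<Sum>j<n. \<bar>f j \<bullet> e (i + N)\<bar>) * \<bar>f k \<bullet> e (i + N)\<bar>)"
        by (simp add: sum_distrib_right)
      also have "\<dots> \<le> (\<Sum>k<N. \<Sum>i<m. (1 + T) * \<bar>f k \<bullet> e (i + N)\<bar>)"
        by (intro sum_mono mult_right_mono col) simp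
      also have "\<dots> = (1 + T) * (\<Sum>k<N. \<Sum>i<m. D k (i + N))"
        by (simp add: sum_distrib_left D_def offdiag_def)
      also have "(\<Sum>k<N. \<Sum>i<m. D k (i + N)) = (\<Sum>k<N. \<Sum>i\<in>{N..<m + N}. D k i)"
        using sum.shift_bounds_nat_ivl[of "D k" 0 N m for k] by (simp add: lessThan_atLeast0)
      also have "(1 + T) * (\<Sum>k<N. \<Sum>i\<in>{N..<m + N}. D k i) \<le> (1 + T) * \<epsilon>"
        using T0 by (intro mult_left_mono tail_block) auto
      finally show ?thesis .
    qed
    have "(\<lambda>m. \<Sum>j<n. \<Sum>k<N. \<Sum>i<m. \<bar>f j \<bullet> e (i + N)\<bar> * \<bar>f k \<bullet> e (i + N)\<bar>) \<longlonglongrightarrow> (\<Sum>j<n. \<Sum>k<N. \<kappa> j k)"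
      unfolding \<kappa>_def by (intro tendsto_sum summable_LIMSEQ \<kappa>_summable)
    then show ?thesis by (rule LIMSEQ_le_const2) (use part in auto)
  qed
  have gsplit: "(\<lambda>i. (f j \<bullet> e (i + N)) * (f k \<bullet> e (i + N))) sums
      (f j \<bullet> f k - (\<Sum>i<N. (f j \<bullet> g i) * (f k \<bullet> g i)))" for j k
  proof -
    have "(\<lambda>i. (f j \<bullet> g (i + N)) * (f k \<bullet> g (i + N))) sums
      (f j \<bullet> f k - (\<Sum>i<N. (f j \<bullet> g i) * (f k \<bullet> g i)))"
      using onb_parseval[OF g, of "f j" "f k"] by (subst sums_iff_shift) simp
    then show ?thesis using ge by simp
  qed
  define s where "s j = (\<Sum>k<min j N. \<omega> j k)" for j
  define \<kappa>row where "\<kappa>row j = (\<Sum>k<N. \<kappa> j k)" for j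
  have s0: "0 \<le> s j" for j unfolding s_def by (intro sum_nonneg \<omega>1(2))
  \<comment> \<open>By induction the earlier rows have total at most
    \<open>4 * (1 + T) * \<epsilon> \<le> 1/4\<close>. Hence their diagonal entries are at least
    \<open>1 - 1/4 - 1/16\<close>, and the quadratic term of the recursion is absorbed:
    \<open>s j / 2 \<le> \<kappa>row j + s j / 4\<close>, which explains the factor 4.\<close>
  have s_le: "s j \<le> 4 * \<kappa>row j" for j
  proof (induction j rule: less_induct)
    case (less j)
    let ?M = "min j N"
    have total: "(\<Sum>k<?M. s k) \<le> 1/4"
    proof -
      have "(\<Sum>k<?M. s k) \<le> (\<Sum>k<?M. 4 * \<kappa>row k)" using less by (intro sum_mono) auto
      also have "\<dots> = 4 * (\<Sum>k<?M. \<kappa>row k)" by (simp add: sum_distrib_left)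
      also have "\<dots> \<le> 4 * ((1 + T) * \<epsilon>)"
        using \<kappa>_total[of ?M] unfolding \<kappa>row_def by simp
      also have "\<dots> \<le> 1/4" using \<epsilon> unfolding mult.assoc by linarith
      finally show ?thesis .
    qed
    have diag: "1/2 \<le> \<omega> k k" if k: "k < ?M" for k
    proof -
      have "s k \<le> (\<Sum>k<?M. s k)" using k s0 by (intro member_le_sum) auto
      then have sk: "s k \<le> 1/4" using total by simp
      have "(f k \<bullet> g i)\<^sup>2 \<le> \<omega> k i" for i
        using mult_left_mono[OF \<omega>1(1)[of k i] \<omega>1(2)[of k i]] by (simp add: \<omega>_def power2_eq_square)
      note sq = this
      have "(\<Sum>i<N. (f k \<bullet> g i)\<^sup>2) = (\<Sum>i<Suc k. (f k \<bullet> g i)\<^sup>2)"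
        using k tri by (intro sum.mono_neutral_right) auto
      also have "\<dots> \<le> s k + \<omega> k k"
        using k sq by (auto simp: s_def intro!: add_mono sum_mono)
      finally have head: "(\<Sum>i<N. (f k \<bullet> g i)\<^sup>2) \<le> s k + \<omega> k k" .
      have part: "(\<Sum>i<m. (f k \<bullet> e (i + N)) * (f k \<bullet> e (i + N))) \<le> \<epsilon>" for m
      proof -
        have "(\<Sum>i<m. (f k \<bullet> e (i + N)) * (f k \<bullet> e (i + N))) \<le> (\<Sum>i<m. D k (i + N))"
        proof (rule sum_mono)
          fix i
          show "(f k \<bullet> e (i + N)) * (f k \<bullet> e (i + N)) \<le> D k (i + N)"
            using k mult_left_mono[OF a_le1[of k "i + N"], of "\<bar>f k \<bullet> e (i + N)\<bar>"]
            by (simp add: D_def offdiag_def)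
        qed
        also have "\<dots> = (\<Sum>i\<in>{N..<m + N}. D k i)"
          using sum.shift_bounds_nat_ivl[of "D k" 0 N m] by (simp add: lessThan_atLeast0)
        also have "\<dots> \<le> (\<Sum>j<Suc k. \<Sum>i\<in>{N..<m + N}. D j i)"
          by (simp add: D_def sum_nonneg)
        also have "\<dots> \<le> \<epsilon>" by (rule tail_block)
        finally show ?thesis .
      qed
      have "f k \<bullet> f k - (\<Sum>i<N. (f k \<bullet> g i) * (f k \<bullet> g i)) \<le> \<epsilon>"
        using gsplit[of k k] unfolding sums_def by (rule LIMSEQ_le_const2) (use part in auto)
      then have "1 - (\<Sum>i<N. (f k \<bullet> g i)\<^sup>2) \<le> 1/16"
        using \<epsilon>1 by (simp add: onb_inner[OF f] power2_eq_square)
      then show ?thesis using head sk by linarith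
    qed
    have rec: "\<omega> k k * \<omega> j k \<le> \<kappa> j k + s j * s k" if k: "k < ?M" for k
    proof -
      have "\<bar>f j \<bullet> f k - (\<Sum>i<N. (f j \<bullet> g i) * (f k \<bullet> g i))\<bar> = norm (\<Sum>i. (f j \<bullet> e (i + N)) * (f k \<bullet> e (i + N)))"
        using sums_unique[OF gsplit[of j k]] by simp
      also have "\<dots> \<le> \<kappa> j k"
        unfolding \<kappa>_def by (intro norm_suminf_le \<kappa>_summable) (simp add: abs_mult)
      finally have 1: "\<bar>\<Sum>i<N. (f j \<bullet> g i) * (f k \<bullet> g i)\<bar> \<le> \<kappa> j k"
        using k by (simp add: onb_inner[OF f])
      have "(\<Sum>i<N. (f j \<bullet> g i) * (f k \<bullet> g i)) = (\<Sum>i<Suc k. (f j \<bullet> g i) * (f k \<bullet> g i))"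
        using k tri by (intro sum.mono_neutral_right) auto
      then have "\<bar>(f j \<bullet> g k) * (f k \<bullet> g k)\<bar> \<le> \<kappa> j k + \<bar>\<Sum>i<k. (f j \<bullet> g i) * (f k \<bullet> g i)\<bar>"
        using 1 by simp
      also have "\<bar>\<Sum>i<k. (f j \<bullet> g i) * (f k \<bullet> g i)\<bar> \<le> (\<Sum>i<k. \<omega> j i * \<omega> k i)"
        unfolding \<omega>_def abs_mult[symmetric] by (rule sum_abs)
      also have "\<dots> \<le> (\<Sum>i<k. s j * \<omega> k i)"
      proof (intro sum_mono mult_right_mono)
        show "\<omega> j i \<le> s j" if "i \<in> {..<k}" for i
          unfolding s_def using that k \<omega>1(2) by (intro member_le_sum) auto
      qed (rule \<omega>1(2))
      also have "\<dots> = s j * s k" using k by (simp add: s_def sum_distrib_left)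
      finally show ?thesis by (simp add: \<omega>_def abs_mult mult.commute)
    qed
    have "1/2 * s j = (\<Sum>k<?M. 1/2 * \<omega> j k)" by (simp add: s_def sum_distrib_left)
    also have "\<dots> \<le> (\<Sum>k<?M. \<omega> k k * \<omega> j k)"
      using diag \<omega>1(2) by (intro sum_mono mult_right_mono) auto
    also have "\<dots> \<le> (\<Sum>k<?M. \<kappa> j k + s j * s k)" using rec by (intro sum_mono) auto
    also have "\<dots> = (\<Sum>k<?M. \<kappa> j k) + s j * (\<Sum>k<?M. s k)"
      by (simp add: sum.distrib sum_distrib_left)
    also have "\<dots> \<le> \<kappa>row j + s j * (1/4)"
    proof (intro add_mono mult_left_mono total s0)
      show "(\<Sum>k<?M. \<kappa> j k) \<le> \<kappa>row j" unfolding \<kappa>row_def using \<kappa>0 by (intro sum_mono2) auto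
    qed
    finally show ?case by simp
  qed
  show ?thesis
    unfolding offdiag_le_def
  proof
    fix n
    \<comment> \<open>Columns from \<open>N\<close> on are those of \<open>e\<close>. In the rotated
      columns, \<open>s j\<close> accounts both for the part of the block below the diagonal and for
      the whole strip of rows \<open>j \<ge> N\<close>.\<close>
    have row: "(\<Sum>i<n. offdiag f g j i) \<le> (\<Sum>i<n. if j < N \<and> i < N then 0 else D j i) + s j" for j
    proof -
      have "(\<Sum>i<n. offdiag f g j i)
          \<le> (\<Sum>i<n. (if j < N \<and> i < N then 0 else D j i) + (if i < min j N then \<omega> j i else 0))"
      proof (rule sum_mono)
        fix i
        show "offdiag f g j i \<le> (if j < N \<and> i < N then 0 else D j i) + (if i < min j N then \<omega> j i else 0)"
        proof (cases "N \<le> i")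
          case True
          then show ?thesis by (auto simp: D_def offdiag_def ge)
        next
          case False
          then show ?thesis
            using tri[of j i] \<omega>1(2)[of j i] by (auto simp: D_def offdiag_def \<omega>_def)
        qed
      qed
      also have "\<dots> = (\<Sum>i<n. if j < N \<and> i < N then 0 else D j i) + (\<Sum>i<n. if i < min j N then \<omega> j i else 0)"
        by (rule sum.distrib)
      also have "(\<Sum>i<n. if i < min j N then \<omega> j i else 0) = (\<Sum>i\<in>{..<n} \<inter> {..<min j N}. \<omega> j i)"
        by (simp add: sum.inter_restrict)
      also have "\<dots> \<le> s j" unfolding s_def using \<omega>1(2) by (intro sum_mono2) auto
      finally show ?thesis by simp
    qed
    have "(\<Sum>j<n. \<Sum>i<n. offdiag f g j i) \<le> (\<Sum>j<n. (\<Sum>i<n. if j < N \<and> i < N then 0 else D j i) + 4 * \<kappa>row j)"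
      using row s_le by (intro sum_mono) (meson add_left_mono order_trans)
    also have "\<dots> = (\<Sum>j<n. \<Sum>i<n. if j < N \<and> i < N then 0 else D j i) + 4 * (\<Sum>j<n. \<kappa>row j)"
      by (simp add: sum.distrib sum_distrib_left)
    also have "\<dots> \<le> \<epsilon> + 4 * ((1 + T) * \<epsilon>)"
      using tail[of n] \<kappa>_total[of n] unfolding D_def \<kappa>row_def by (intro add_mono mult_left_mono) auto
    finally show "(\<Sum>j<n. \<Sum>i<n. offdiag f g j i) \<le> \<epsilon> + 4 * (1 + T) * \<epsilon>" by (simp only: mult.assoc)
  qed
qed

lemma offdiag_le_mono: "offdiag_le f g \<delta> \<Longrightarrow> \<delta> \<le> \<delta>' \<Longrightarrow> offdiag_le f g \<delta>'"
  unfolding offdiag_le_def by (meson order_trans)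

lemma refines_if_offdiag_le:
  fixes e f :: "nat \<Rightarrow> 'a::{real_inner, complete_space}"
  assumes e: "onb e" and f: "onb f" and T: "offdiag_le f e T"
  shows "refines e f"
proof (rule refines_limit[OF onb_l2_coordinates[OF e] f])
  fix \<delta> :: real assume "\<delta> > 0"
  have T0: "0 \<le> T" using T[unfolded offdiag_le_def, rule_format, of 0] by simp
  \<comment> \<open>The 1 in the minimum supplies the smallness hypothesis of
    \<open>triangular_offdiag_le\<close>, the \<open>\<delta>\<close> the final bound, since
    \<open>\<epsilon> + 4 * (1 + T) * \<epsilon> \<le> 16 * (1 + T) * \<epsilon>\<close>.\<close>
  define \<epsilon> where "\<epsilon> = min 1 \<delta> / (16 * (1 + T))"
  have \<epsilon>: "0 < \<epsilon>" "16 * (1 + T) * \<epsilon> = min 1 \<delta>"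
    using T0 \<open>\<delta> > 0\<close> by (simp_all add: \<epsilon>_def)
  obtain N where N: "\<And>n. (\<Sum>j<n. \<Sum>i<n. if j < N \<and> i < N then 0 else offdiag f e j i) \<le> \<epsilon>"
    using offdiag_le_tail[OF T \<epsilon>(1)] by blast
  obtain g where g: "onb g" "refines e g" "\<And>i. N \<le> i \<Longrightarrow> g i = e i" "\<And>j i. j < i \<Longrightarrow> i < N \<Longrightarrow> f j \<bullet> g i = 0"
    using triangular_basis[OF e, of N f] by blast
  have "offdiag_le f g (\<epsilon> + 4 * (1 + T) * \<epsilon>)"
    by (rule triangular_offdiag_le[OF e f g(1) T N g(3,4)]) (use \<epsilon>(2) in auto)
  moreover have "\<epsilon> + 4 * (1 + T) * \<epsilon> \<le> \<delta>"
  proof -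
    have "16 * (1 + T) * \<epsilon> = 16 * \<epsilon> + 16 * (T * \<epsilon>)" "4 * (1 + T) * \<epsilon> = 4 * \<epsilon> + 4 * (T * \<epsilon>)"
      by (simp_all add: algebra_simps)
    then show ?thesis
      using \<epsilon> mult_nonneg_nonneg[OF T0 less_imp_le[OF \<epsilon>(1)]] \<open>\<delta> > 0\<close> by linarith
  qed
  ultimately have "offdiag_le f g \<delta>" by (rule offdiag_le_mono)
  then show "\<exists>g. onb g \<and> refines e g \<and> offdiag_le f g \<delta>" using g(1,2) by blast
qed

section \<open>Permuted bases\<close>

lemma summable_abs_permute:
  fixes l :: "nat \<Rightarrow> real"
  assumes "summable (\<lambda>j. \<bar>l j\<bar>)" "bij p"
  shows "summable (\<lambda>j. l (p j))" "(\<Sum>j. l (p j)) = suminf l" "summable (\<lambda>j. \<bar>l (p j)\<bar>)"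
proof -
  have "(l has_sum suminf l) UNIV"
    using assms(1) summable_rabs_cancel[OF assms(1)]
    by (intro norm_summable_imp_has_sum summable_sums) auto
  then have "((\<lambda>j. l (p j)) has_sum suminf l) UNIV"
    using has_sum_reindex_bij_betw[OF assms(2), of l "suminf l"] by simp
  from has_sum_imp_sums[OF this] show "summable (\<lambda>j. l (p j))" "(\<Sum>j. l (p j)) = suminf l"
    by (auto simp: sums_iff)
  have "((\<lambda>j. \<bar>l j\<bar>) has_sum (\<Sum>j. \<bar>l j\<bar>)) UNIV"
    using assms(1) by (intro norm_summable_imp_has_sum summable_sums) auto
  then have "((\<lambda>j. \<bar>l (p j)\<bar>) has_sum (\<Sum>j. \<bar>l j\<bar>)) UNIV"
    using has_sum_reindex_bij_betw[OF assms(2), of "\<lambda>j. \<bar>l j\<bar>" "\<Sum>j. \<bar>l j\<bar>"] by simp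
  from has_sum_imp_sums[OF this] show "summable (\<lambda>j. \<bar>l (p j)\<bar>)" by (auto simp: sums_iff)
qed

lemma nonempty_params_permute:
  assumes ab: "nonempty_params a b" and p: "bij p"
  shows "nonempty_params (a \<circ> p) (b \<circ> p)"
proof -
  obtain c where c: "summable (\<lambda>j. (c j)\<^sup>2)" "\<And>j. c j \<in> {a j..<b j}"
    using ab by (auto simp: nonempty_params_def)
  have "summable (\<lambda>j. ((c \<circ> p) j)\<^sup>2)"
    using summable_abs_permute(1)[of "\<lambda>j. (c j)\<^sup>2" p] c(1) p by simp
  moreover have "summable (\<lambda>j. max 0 (ln ((b \<circ> p) j - (a \<circ> p) j)))"
    using summable_abs_permute(1)[of "\<lambda>j. max 0 (ln (b j - a j))" p] nonempty_params_measurable[OF ab] p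
    by (simp add: measurable_params_def)
  moreover have "bounded (range (a \<circ> p))" "bounded (range (b \<circ> p))"
    using nonempty_params_measurable[OF ab] by (auto simp: measurable_params_def intro: bounded_subset)
  moreover have "\<forall>j. (c \<circ> p) j \<in> {(a \<circ> p) j..<(b \<circ> p) j}" using c(2) by simp
  ultimately show ?thesis unfolding nonempty_params_def measurable_params_def by blast
qed

text \<open>Since the positive parts are summable, a convergent series of logarithms converges
  absolutely. So its sum does not depend on the order, and neither does its divergence.\<close>

lemma rectangle_volume_permute:
  assumes ab: "nonempty_params a b" and p: "bij p"
  shows "rectangle_volume (a \<circ> p) (b \<circ> p) = rectangle_volume a b"
proof -
  have abs: "summable (\<lambda>j. \<bar>ln (b j - a j)\<bar>)"
    if "nonempty_params a b" "summable (\<lambda>j. ln (b j - a j))" for a b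
  proof -
    have "summable (\<lambda>j. 2 * max 0 (ln (b j - a j)) - ln (b j - a j))"
      using nonempty_params_measurable[OF that(1)] that(2)
      by (intro summable_diff summable_mult) (auto simp: measurable_params_def)
    moreover have "2 * max 0 (ln (b j - a j)) - ln (b j - a j) = \<bar>ln (b j - a j)\<bar>" for j by auto
    ultimately show ?thesis by simp
  qed
  show ?thesis
  proof (cases "summable (\<lambda>j. ln (b j - a j))")
    case True
    note * = summable_abs_permute(1,2)[OF abs[OF ab True] p]
    show ?thesis using True * by (simp add: rectangle_volume_def)
  next
    case False
    have "\<not> summable (\<lambda>j. ln (b (p j) - a (p j)))"
    proof
      assume "summable (\<lambda>j. ln (b (p j) - a (p j)))"
      then have "summable (\<lambda>j. \<bar>ln (b (p j) - a (p j))\<bar>)"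
        using abs[OF nonempty_params_permute[OF ab p]] by simp
      from summable_abs_permute(1)[OF this bij_imp_bij_inv[OF p]] show False
        using False by (simp add: surj_f_inv_f[OF bij_is_surj[OF p]])
    qed
    then show ?thesis using False by (simp add: rectangle_volume_def)
  qed
qed

lemma rectangle_permute:
  assumes "bij p"
  shows "rectangle (e \<circ> p) (a \<circ> p) (b \<circ> p) = rectangle e a b"
  unfolding rectangle_def using bij_is_surj[OF assms] by auto (metis surj_def)+

lemma refines_permute:
  assumes e: "l2_coordinates e" and p: "bij p"
  shows "refines e (e \<circ> p)"
  unfolding refines_def
proof (intro allI impI)
  fix a b assume ab: "nonempty_params a b"
  let ?a = "a \<circ> inv p" and ?b = "b \<circ> inv p"
  have good: "nonempty_params ?a ?b" using nonempty_params_permute[OF ab bij_imp_bij_inv[OF p]] .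
  have "?a \<circ> p = a" "?b \<circ> p = b" using bij_is_inj[OF p] by (simp_all add: o_assoc[symmetric])
  then have "rectangle (e \<circ> p) a b = rectangle e ?a ?b"
    using rectangle_permute[OF p, of e ?a ?b] by simp
  moreover have "rectangle_volume a b = rectangle_volume ?a ?b"
    using rectangle_volume_permute[OF ab bij_imp_bij_inv[OF p]] by simp
  ultimately show "sandwiched (rectangle_ring e) (ring_measure e) (rectangle (e \<circ> p) a b) (rectangle_volume a b)"
    using sandwiched_rectangle[OF e good] by simp
qed

lemma onb_permute:
  assumes "onb e" "bij p"
  shows "onb (e \<circ> p)"
  unfolding onb_def
proof (intro conjI allI impI)
  show "(e \<circ> p) i \<bullet> (e \<circ> p) j = of_bool (i = j)" for i j
    using assms by (simp add: onb_inner bij_is_inj inj_eq)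
  fix x assume x: "\<forall>i. x \<bullet> (e \<circ> p) i = 0"
  have "x \<bullet> e i = 0" for i
    using x[rule_format, of "inv p i"] surj_f_inv_f[OF bij_is_surj[OF assms(2)]] by simp
  then show "x = 0" by (rule onb_eq_0[OF assms(1)])
qed

text \<open>The off-diagonal condition is symmetric and asks only for some finite bound, so both
  directions of the theorem come from the same permutation.\<close>

lemma refines_if_offdiag_le_permute:
  fixes e f :: "nat \<Rightarrow> 'a::{real_inner, complete_space}"
  assumes e: "onb e" and f: "onb f" and p: "bij p" and T: "offdiag_le f (e \<circ> p) T"
  shows "refines e f" "refines f e"
proof -
  note ep = onb_permute[OF e p]
  note l2 = onb_l2_coordinates
  show "refines e f"
    by (rule refines_trans[OF l2[OF e] l2[OF ep] refines_permute[OF l2[OF e] p] refines_if_offdiag_le[OF ep f T]])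
  have "refines (e \<circ> p) ((e \<circ> p) \<circ> inv p)"
    by (rule refines_permute[OF l2[OF ep] bij_imp_bij_inv[OF p]])
  then have "refines (e \<circ> p) e"
    using bij_is_surj[OF p] by (simp add: o_assoc[symmetric] surj_iff)
  then show "refines f e"
    by (rule refines_trans[OF l2[OF f] l2[OF ep] refines_if_offdiag_le[OF f ep offdiag_le_swap[OF T]]])
qed

section \<open>Extracting the permutation\<close>

text \<open>The squares sum to 1 and are bounded by the largest modulus times the sum
  \<open>\<sigma>\<close> of the moduli, so the largest modulus is at least
  \<open>1 / \<sigma>\<close>.\<close>

lemma large_entry:
  fixes e :: "nat \<Rightarrow> 'a::{real_inner, complete_space}"
  assumes e: "onb e" and x: "norm x = 1" and sums: "(\<lambda>i. \<bar>x \<bullet> e i\<bar>) sums \<sigma>"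
  shows "\<exists>i. 1 / \<sigma> \<le> \<bar>x \<bullet> e i\<bar>" "1 \<le> \<sigma>"
proof -
  have one: "(\<lambda>i. (x \<bullet> e i) * (x \<bullet> e i)) sums 1"
    using onb_parseval[OF e, of x x] x by (simp add: dot_square_norm)
  have le1: "\<bar>x \<bullet> e i\<bar> \<le> 1" for i
  proof -
    have "norm (e i) = 1" using e by (simp add: norm_eq_sqrt_inner onb_inner)
    then show ?thesis using Cauchy_Schwarz_ineq2[of x "e i"] x by simp
  qed
  show \<sigma>: "1 \<le> \<sigma>"
  proof (rule sums_le[OF _ one sums])
    show "(x \<bullet> e i) * (x \<bullet> e i) \<le> \<bar>x \<bullet> e i\<bar>" for i
      using mult_left_mono[OF le1[of i], of "\<bar>x \<bullet> e i\<bar>"] by simp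
  qed
  show "\<exists>i. 1 / \<sigma> \<le> \<bar>x \<bullet> e i\<bar>"
  proof (rule ccontr)
    assume "\<not> ?thesis"
    then have less: "\<bar>x \<bullet> e i\<bar> < 1 / \<sigma>" for i by (simp add: not_le)
    \<comment> \<open>If all entries were below \<open>1 / \<sigma>\<close>, this would be a series
      of nonnegative terms with sum 0; every term then vanishes, and so does
      \<open>x\<close>.\<close>
    have sums0: "(\<lambda>i. \<bar>x \<bullet> e i\<bar> * (1 / \<sigma>) - (x \<bullet> e i) * (x \<bullet> e i)) sums 0"
      using sums_diff[OF sums_mult2[OF sums, of "1 / \<sigma>"] one] \<sigma> by simp
    have nonneg: "0 \<le> \<bar>x \<bullet> e i\<bar> * (1 / \<sigma>) - (x \<bullet> e i) * (x \<bullet> e i)" for i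
      using mult_left_mono[OF less_imp_le[OF less[of i]], of "\<bar>x \<bullet> e i\<bar>"] by simp
    have "\<bar>x \<bullet> e i\<bar> * (1 / \<sigma>) - (x \<bullet> e i) * (x \<bullet> e i) = 0" for i
      using suminf_eq_zero_iff[OF sums_summable[OF sums0] nonneg] sums_unique[OF sums0] by metis
    then have "\<bar>x \<bullet> e i\<bar> * (1 / \<sigma> - \<bar>x \<bullet> e i\<bar>) = 0" for i
      by (simp add: right_diff_distrib abs_mult[symmetric])
    then have "x \<bullet> e i = 0" for i using less[of i] by (metis abs_eq_0 diff_gt_0_iff_gt less_irrefl mult_eq_0_iff)
    then have "x = 0" by (rule onb_eq_0[OF e])
    then show False using x by simp
  qed
qed

text \<open>Each row \<open>j\<close> has one dominant entry, at \<open>m j\<close>; for \<open>j \<ge> N\<close> the dominant columns are distinct.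
  Summing the squares of all entries once over the rows and once over the columns shows that
  exactly \<open>N\<close> columns are left over, so \<open>m\<close> restricted to \<open>j \<ge> N\<close> extends to a permutation.\<close>

lemma almost_diagonal_permutation:
  fixes e f :: "nat \<Rightarrow> 'a::{real_inner, complete_space}"
  assumes e: "onb e" and f: "onb f" and rows: "\<And>j. (\<lambda>i. \<bar>f j \<bullet> e i\<bar>) sums \<sigma> j"
    and C: "\<And>n. (\<Sum>j<n. \<sigma> j - 1) \<le> C"
  shows "\<exists>p T. bij p \<and> offdiag_le f (e \<circ> p) T"
proof -
  define U where "U j i = \<bar>f j \<bullet> e i\<bar>" for j i
  have norm1: "norm (f j) = 1" for j using f by (simp add: norm_eq_sqrt_inner onb_inner)
  have U01: "0 \<le> U j i" "U j i \<le> 1" for i j unfolding U_def using onb_abs_inner_le[OF f e] by simp_all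
  have Usq: "(U j i)\<^sup>2 \<le> U j i" for i j
    using mult_left_mono[OF U01(2)[of j i] U01(1)[of j i]] by (simp add: power2_eq_square)
  have Usums: "U j sums \<sigma> j" for j using rows[of j] unfolding U_def[abs_def] .
  have row_sq: "(\<lambda>i. (U j i)\<^sup>2) sums 1" for j
    using onb_parseval[OF e, of "f j" "f j"] by (simp add: onb_inner[OF f] U_def power2_eq_square)
  have col_sq: "(\<lambda>j. (U j i)\<^sup>2) sums 1" for i
    using onb_parseval[OF f, of "e i" "e i"]
    by (simp add: onb_inner[OF e] U_def power2_eq_square inner_commute)
  have row_le: "(\<Sum>i\<in>F. (U j i)\<^sup>2) \<le> 1" if "finite F" for F j
    using sum_le_suminf[OF sums_summable[OF row_sq] that] sums_unique[OF row_sq] by auto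
  have col_le: "(\<Sum>j\<in>F. (U j i)\<^sup>2) \<le> 1" if "finite F" for F i
    using sum_le_suminf[OF sums_summable[OF col_sq] that] sums_unique[OF col_sq] by auto
  have \<sigma>1: "1 \<le> \<sigma> j" for j using large_entry(2)[OF e norm1 rows] .
  obtain m where m: "\<And>j. 1 / \<sigma> j \<le> U j (m j)"
    using large_entry(1)[OF e norm1 rows] unfolding U_def by metis
  define r where "r j = \<sigma> j - U j (m j)" for j
  \<comment> \<open>\<open>r j\<close> is the mass of row \<open>j\<close> away from its dominant
    entry, at most \<open>\<sigma> j - 1 / \<sigma> j\<close>; the bound is
    \<open>(\<sigma> j - 1)\<^sup>2 \<ge> 0\<close> rearranged.\<close>
  have r_le: "r j \<le> 2 * (\<sigma> j - 1)" for j
  proof -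
    have "0 \<le> (\<sigma> j - 1)\<^sup>2 / \<sigma> j" using \<sigma>1[of j] by simp
    also have "(\<sigma> j - 1)\<^sup>2 / \<sigma> j = \<sigma> j - 2 + 1 / \<sigma> j"
      using \<sigma>1[of j] by (simp add: power2_eq_square field_simps)
    finally show ?thesis using m[of j] by (simp add: r_def)
  qed
  have rest: "(\<Sum>i\<in>F. U j i) \<le> r j" if "finite F" "m j \<notin> F" for F j
  proof -
    have "U j (m j) + (\<Sum>i\<in>F. U j i) = (\<Sum>i\<in>insert (m j) F. U j i)" using that by simp
    also have "\<dots> \<le> \<sigma> j"
      using sum_le_suminf[OF sums_summable[OF Usums], of "insert (m j) F" j] U01(1) that(1)
        sums_unique[OF Usums, of j] by auto
    finally show ?thesis by (simp add: r_def)
  qed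
  have r0: "0 \<le> r j" for j using rest[of "{}" j] by simp
  have r_sum: "(\<Sum>j<n. r j) \<le> 2 * C" for n
  proof -
    have "(\<Sum>j<n. r j) \<le> (\<Sum>j<n. 2 * (\<sigma> j - 1))" by (intro sum_mono r_le)
    also have "\<dots> = 2 * (\<Sum>j<n. \<sigma> j - 1)" by (rule sum_distrib_left[symmetric])
    also have "\<dots> \<le> 2 * C" using C[of n] by simp
    finally show ?thesis .
  qed
  have "summable r" by (rule summableI_nonneg_bounded[OF r0 r_sum])
  \<comment> \<open>With 1/4 the dominant entries are at least 3/4, and two of them do not fit into
    one column because 2 * 9/16 > 1. The two counts below then hold up to errors 1/4 and 1/2; these
    are below 1, so the counts are exact for integers.\<close>
  then obtain N where N: "\<And>m n. m \<ge> N \<Longrightarrow> norm (\<Sum>j\<in>{m..<n}. r j) < 1/4"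
    unfolding summable_Cauchy by (metis zero_less_divide_1_iff zero_less_numeral)
  have r_tail: "(\<Sum>j\<in>K. r j) \<le> 1/4" if "finite K" "\<And>k. k \<in> K \<Longrightarrow> N \<le> k" for K
  proof -
    obtain n where "K \<subseteq> {..<n}" using \<open>finite K\<close> finite_nat_iff_bounded by blast
    then have "K \<subseteq> {N..<n}" using that(2) by auto
    then have "(\<Sum>j\<in>K. r j) \<le> (\<Sum>j\<in>{N..<n}. r j)" by (intro sum_mono2) (auto simp: r0)
    then show ?thesis using N[of N n] by simp
  qed
  have dom: "3/4 \<le> U j (m j)" if "N \<le> j" for j
    using r_tail[of "{j}"] that \<sigma>1[of j] by (simp add: r_def)
  have inj: "inj_on m {N..}"
  proof (rule inj_onI, rule ccontr)
    fix j k assume *: "j \<in> {N..}" "k \<in> {N..}" "m j = m k" "j \<noteq> k"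
    have "(U j (m j))\<^sup>2 + (U k (m j))\<^sup>2 \<le> 1" using col_le[of "{j, k}" "m j"] *(4) by simp
    moreover have "(3/4)\<^sup>2 \<le> (U j (m j))\<^sup>2" "(3/4)\<^sup>2 \<le> (U k (m j))\<^sup>2"
      using dom[of j] dom[of k] * by (auto intro!: power_mono)
    ultimately show False by (simp add: power2_eq_square)
  qed
  define H where "H = - (m ` {N..})"
  \<comment> \<open>The squares in the columns of \<open>G\<close> total \<open>card G\<close>. The
    first \<open>N\<close> rows contribute at most \<open>N\<close>, and the later rows, whose
    dominant entries lie outside \<open>G\<close>, at most their rest \<open>r j\<close>.\<close>
  have card_le: "card G \<le> N" if G: "finite G" "G \<subseteq> H" for G
  proof -
    have "(\<Sum>j<n. \<Sum>i\<in>G. (U j i)\<^sup>2) \<le> real N + 1/4" for n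
    proof -
      have "(\<Sum>j<n. \<Sum>i\<in>G. (U j i)\<^sup>2) \<le> (\<Sum>j<n. if j < N then 1 else r j)"
      proof (rule sum_mono)
        fix j
        show "(\<Sum>i\<in>G. (U j i)\<^sup>2) \<le> (if j < N then 1 else r j)"
        proof (cases "j < N")
          case True
          then show ?thesis using row_le[OF G(1)] by simp
        next
          case False
          then have "m j \<notin> G" using G(2) by (auto simp: H_def)
          moreover have "(\<Sum>i\<in>G. (U j i)\<^sup>2) \<le> (\<Sum>i\<in>G. U j i)" by (intro sum_mono Usq)
          ultimately show ?thesis using rest[OF G(1), of j] False by simp
        qed
      qed
      also have "\<dots> = (\<Sum>j\<in>{..<n} \<inter> {..<N}. 1) + (\<Sum>j\<in>{..<n} - {..<N}. r j)"
        by (simp add: sum.If_cases lessThan_def Diff_eq)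
      also have "\<dots> \<le> real N + 1/4"
      proof (rule add_mono)
        have "card ({..<n} \<inter> {..<N}) \<le> card {..<N}" by (intro card_mono) auto
        then show "(\<Sum>j\<in>{..<n} \<inter> {..<N}. 1) \<le> real N" by simp
        show "(\<Sum>j\<in>{..<n} - {..<N}. r j) \<le> 1/4" by (intro r_tail) auto
      qed
      finally show ?thesis .
    qed
    moreover have "(\<lambda>n. \<Sum>i\<in>G. \<Sum>j<n. (U j i)\<^sup>2) \<longlonglongrightarrow> (\<Sum>i\<in>G. 1)"
      using col_sq unfolding sums_def by (intro tendsto_sum) auto
    then have "(\<lambda>n. \<Sum>j<n. \<Sum>i\<in>G. (U j i)\<^sup>2) \<longlonglongrightarrow> real (card G)"
      by (subst sum.swap) simp
    ultimately have "real (card G) \<le> real N + 1/4" by (intro LIMSEQ_le_const2) auto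
    then show ?thesis by linarith
  qed
  have finH: "finite H"
  proof (rule ccontr)
    assume "infinite H"
    then obtain G where "finite G" "card G = Suc N" "G \<subseteq> H"
      using infinite_arbitrarily_large by blast
    then show False using card_le by fastforce
  qed
  \<comment> \<open>The reverse count: the squares in the first \<open>N\<close> rows total
    \<open>N\<close>. Each column of \<open>H\<close> contributes at most 1, and a column
    \<open>m k\<close> with \<open>k \<ge> N\<close> at most what its dominant entry leaves,
    \<open>1 - (U k (m k))\<^sup>2 \<le> 2 * r k\<close>.\<close>
  have "real N \<le> real (card H) + 1/2"
  proof -
    have "(\<Sum>j<N. \<Sum>i<n. (U j i)\<^sup>2) \<le> real (card H) + 1/2" for n
    proof -
      define K where "K = {k. N \<le> k \<and> m k < n}"
      have mK: "m ` K = {..<n} - H" by (auto simp: K_def H_def)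
      have injK: "inj_on m K" by (rule inj_on_subset[OF inj]) (auto simp: K_def)
      have finK: "finite K" using finite_imageD[OF _ injK] mK by simp
      have "(\<Sum>j<N. \<Sum>i<n. (U j i)\<^sup>2) = (\<Sum>i<n. \<Sum>j<N. (U j i)\<^sup>2)" by (rule sum.swap)
      also have "\<dots> \<le> (\<Sum>i\<in>H \<union> m ` K. \<Sum>j<N. (U j i)\<^sup>2)"
        using finH finK mK by (intro sum_mono2) (auto intro: sum_nonneg)
      also have "\<dots> \<le> (\<Sum>i\<in>H. \<Sum>j<N. (U j i)\<^sup>2) + (\<Sum>i\<in>m ` K. \<Sum>j<N. (U j i)\<^sup>2)"
        using finH finK mK by (subst sum.union_disjoint) auto
      also have "\<dots> \<le> (\<Sum>i\<in>H. 1) + (\<Sum>k\<in>K. 2 * r k)"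
      proof (rule add_mono)
        show "(\<Sum>i\<in>H. \<Sum>j<N. (U j i)\<^sup>2) \<le> (\<Sum>i\<in>H. 1)" by (intro sum_mono col_le) simp
        have "(\<Sum>i\<in>m ` K. \<Sum>j<N. (U j i)\<^sup>2) = (\<Sum>k\<in>K. \<Sum>j<N. (U j (m k))\<^sup>2)"
          using injK by (simp add: sum.reindex)
        also have "\<dots> \<le> (\<Sum>k\<in>K. 2 * r k)"
        proof (rule sum_mono)
          fix k assume "k \<in> K"
          then have "k \<notin> {..<N}" by (simp add: K_def)
          then have 1: "(U k (m k))\<^sup>2 + (\<Sum>j<N. (U j (m k))\<^sup>2) \<le> 1"
            using col_le[of "insert k {..<N}" "m k"] by simp
          have "0 \<le> (1 - U k (m k))\<^sup>2" by simp
          then have "1 - (U k (m k))\<^sup>2 \<le> 2 * (1 - U k (m k)) + 0"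
            by (simp add: power2_eq_square algebra_simps)
          then have "1 - (U k (m k))\<^sup>2 \<le> 2 * r k" using \<sigma>1[of k] by (simp add: r_def)
          then show "(\<Sum>j<N. (U j (m k))\<^sup>2) \<le> 2 * r k" using 1 by linarith
        qed
        finally show "(\<Sum>i\<in>m ` K. \<Sum>j<N. (U j i)\<^sup>2) \<le> (\<Sum>k\<in>K. 2 * r k)" .
      qed
      also have "\<dots> \<le> real (card H) + 1/2"
        using r_tail[OF finK] by (simp add: sum_distrib_left[symmetric] K_def)
      finally show ?thesis .
    qed
    moreover have "(\<lambda>n. \<Sum>j<N. \<Sum>i<n. (U j i)\<^sup>2) \<longlonglongrightarrow> (\<Sum>j<N. 1)"
      using row_sq unfolding sums_def by (intro tendsto_sum) auto
    ultimately have "(\<Sum>j<N. 1) \<le> real (card H) + 1/2" by (intro LIMSEQ_le_const2) auto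
    then show ?thesis by simp
  qed
  then have "N \<le> card H" by linarith
  then have "card {..<N} = card H" using card_le[OF finH] by simp
  then obtain \<beta> where \<beta>: "bij_betw \<beta> {..<N} H"
    using finH finite_same_card_bij by blast
  define p where "p j = (if j < N then \<beta> j else m j)" for j
  have "bij_betw p ({..<N} \<union> {N..}) (H \<union> m ` {N..})"
  proof (rule bij_betw_combine)
    show "bij_betw p {..<N} H" using \<beta> by (rule bij_betw_cong[THEN iffD1, rotated]) (simp add: p_def)
    have "bij_betw m {N..} (m ` {N..})" using inj by (rule inj_on_imp_bij_betw)
    then show "bij_betw p {N..} (m ` {N..})" by (rule bij_betw_cong[THEN iffD1, rotated]) (simp add: p_def)
    show "H \<inter> m ` {N..} = {}" by (auto simp: H_def)
  qed
  moreover have "{..<N} \<union> {N..} = UNIV" "H \<union> m ` {N..} = UNIV" by (auto simp: H_def)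
  ultimately have p: "bij p" by simp
  \<comment> \<open>The first \<open>N\<close> rows are matched with \<open>H\<close> arbitrarily,
    so each of them is charged its full sum \<open>\<sigma> j\<close>; the other rows cost only
    \<open>r j\<close>.\<close>
  have "offdiag_le f (e \<circ> p) ((\<Sum>j<N. \<sigma> j) + 2 * C)"
    unfolding offdiag_le_def
  proof
    fix n
    have "(\<Sum>i<n. offdiag f (e \<circ> p) j i) \<le> (if j < N then \<sigma> j else 0) + r j" for j
    proof -
      have "(\<Sum>i<n. offdiag f (e \<circ> p) j i) = (\<Sum>i\<in>{..<n} - {j}. U j (p i))"
        by (intro sum.mono_neutral_cong_right) (auto simp: offdiag_def U_def)
      also have "\<dots> = (\<Sum>i\<in>p ` ({..<n} - {j}). U j i)"
        using bij_is_inj[OF p] by (subst sum.reindex) (auto intro: inj_on_subset)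
      also have "\<dots> \<le> (if j < N then \<sigma> j else 0) + r j"
      proof (cases "j < N")
        case True
        have "(\<Sum>i\<in>p ` ({..<n} - {j}). U j i) \<le> \<sigma> j"
          using sum_le_suminf[OF sums_summable[OF Usums], of "p ` ({..<n} - {j})" j] U01(1)
            sums_unique[OF Usums, of j] by auto
        then show ?thesis using True r0[of j] by simp
      next
        case False
        then have "m j \<notin> p ` ({..<n} - {j})"
          using bij_is_inj[OF p] by (auto simp: inj_eq dest: sym[of "m j"]) (metis injD p_def)
        then show ?thesis using rest[of "p ` ({..<n} - {j})" j] False by simp
      qed
      finally show ?thesis .
    qed
    then have "(\<Sum>j<n. \<Sum>i<n. offdiag f (e \<circ> p) j i) \<le> (\<Sum>j<n. (if j < N then \<sigma> j else 0) + r j)"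
      by (rule sum_mono)
    also have "\<dots> = (\<Sum>j<n. if j < N then \<sigma> j else 0) + (\<Sum>j<n. r j)" by (rule sum.distrib)
    also have "(\<Sum>j<n. if j < N then \<sigma> j else 0) = (\<Sum>j\<in>{..<n} \<inter> {..<N}. \<sigma> j)"
      by (simp add: sum.inter_restrict)
    also have "\<dots> \<le> (\<Sum>j<N. \<sigma> j)"
      using \<sigma>1 by (intro sum_mono2) (auto intro: order_trans[OF zero_le_one])
    finally show "(\<Sum>j<n. \<Sum>i<n. offdiag f (e \<circ> p) j i) \<le> (\<Sum>j<N. \<sigma> j) + 2 * C"
      using r_sum[of n] by linarith
  qed
  with p show ?thesis by blast
qed

section \<open>From the infinite product to the row sums\<close>

lemma ennreal_prodinf_ge:
  fixes S :: "nat \<Rightarrow> ennreal"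
  assumes "\<And>j. 1 \<le> S j"
  shows "(\<Prod>j\<le>n. S j) \<le> prodinf S"
proof -
  define X where "X n = (\<Prod>j\<le>n. S j)" for n
  have "incseq X"
    unfolding X_def
  proof (rule incseq_SucI)
    show "(\<Prod>j\<le>n. S j) \<le> (\<Prod>j\<le>Suc n. S j)" for n
      using mult_left_mono[OF assms[of "Suc n"], of "\<Prod>j\<le>n. S j"] by simp
  qed
  then have lim: "X \<longlonglongrightarrow> (SUP n. X n)" by (rule LIMSEQ_SUP)
  have upper: "X n \<le> (SUP n. X n)" for n by (rule SUP_upper) simp
  have "1 \<le> X 0" using assms by (simp add: X_def)
  then have "(SUP n. X n) \<noteq> 0" using upper[of 0] by auto
  \<comment> \<open>Increasing partial products converge in \<open>ennreal\<close>, possibly to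
    infinity; the limit only has to be nonzero to count as a product.\<close>
  then have "S has_prod (SUP n. X n)"
    using lim unfolding has_prod_def raw_has_prod_def X_def[abs_def] by simp
  moreover have "q = (SUP n. X n)" if q: "S has_prod q" for q
  proof -
    \<comment> \<open>Without zero factors the second alternative of \<open>has_prod\<close> is
      excluded. Uniqueness is required because \<open>prodinf\<close> is a definite
      description.\<close>
    have "S i \<noteq> 0" for i using assms[of i] by auto
    then have "X \<longlonglongrightarrow> q"
      using q unfolding has_prod_def raw_has_prod_def X_def[abs_def] by simp
    then show ?thesis using lim by (rule LIMSEQ_unique)
  qed
  ultimately have "prodinf S = (SUP n. X n)"
    unfolding prodinf_def by (intro the_equality)
  then show ?thesis using upper unfolding X_def by simp
qed

text \<open>By Parseval every row sum is at least 1, so a single infinite row sum would already make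
  the product infinite. The excesses over 1 are summable because their sum is at most the product of
  the row sums.\<close>

lemma finite_product_rows:
  fixes e f :: "nat \<Rightarrow> 'a::{real_inner, complete_space}"
  assumes e: "onb e" and f: "onb f"
    and fin: "(\<Prod>j. \<Sum>i. ennreal \<bar>e i \<bullet> f j\<bar>) < \<infinity>"
  obtains \<sigma> C where "\<And>j. (\<lambda>i. \<bar>f j \<bullet> e i\<bar>) sums \<sigma> j" "\<And>n. (\<Sum>j<n. \<sigma> j - 1) \<le> C"
proof -
  define S where "S j = (\<Sum>i. ennreal \<bar>e i \<bullet> f j\<bar>)" for j
  have norm1: "norm (f j) = 1" for j using f by (simp add: norm_eq_sqrt_inner onb_inner)
  have S1: "1 \<le> S j" for j
  proof -
    have "(\<lambda>i. (f j \<bullet> e i) * (f j \<bullet> e i)) sums 1"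
      using onb_parseval[OF e, of "f j" "f j"] by (simp add: onb_inner[OF f])
    then have "(\<lambda>i. ennreal ((f j \<bullet> e i) * (f j \<bullet> e i))) sums ennreal 1"
      by (subst sums_ennreal) auto
    then have "1 = (\<Sum>i. ennreal ((f j \<bullet> e i) * (f j \<bullet> e i)))" by (simp add: sums_iff)
    also have "\<dots> \<le> S j"
      unfolding S_def
    proof (intro suminf_le ennreal_leI)
      show "(f j \<bullet> e i) * (f j \<bullet> e i) \<le> \<bar>e i \<bullet> f j\<bar>" for i
        using mult_left_mono[OF onb_abs_inner_le[OF f e, of j i], of "\<bar>f j \<bullet> e i\<bar>"]
        by (simp add: inner_commute)
    qed auto
    finally show ?thesis .
  qed
  have finS: "prodinf S < \<infinity>" using fin unfolding S_def[abs_def] .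
  have le: "(\<Prod>j\<le>n. S j) \<le> prodinf S" for n by (rule ennreal_prodinf_ge[OF S1])
  have Sfin: "S j \<noteq> top" for j
  proof -
    have "1 \<le> (\<Prod>i<j. S i)" by (intro prod_ge_1) (use S1 in auto)
    then have "S j \<le> (\<Prod>i<j. S i) * S j" using mult_right_mono[of 1 "\<Prod>i<j. S i" "S j"] by simp
    also have "\<dots> = (\<Prod>i\<le>j. S i)" by (simp add: lessThan_Suc_atMost[symmetric])
    also have "\<dots> \<le> prodinf S" by (rule le)
    also have "\<dots> < top" using finS by simp
    finally show ?thesis by simp
  qed
  define \<sigma> where "\<sigma> j = enn2real (S j)" for j
  have \<sigma>: "ennreal (\<sigma> j) = S j" for j using Sfin[of j] by (simp add: \<sigma>_def less_top)
  have \<sigma>1: "1 \<le> \<sigma> j" for j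
    using S1[of j] unfolding \<sigma>[symmetric] by (simp add: ennreal_le_iff2 flip: ennreal_1)
  have \<sigma>0: "0 \<le> \<sigma> j" for j using \<sigma>1[of j] by simp
  have "(\<lambda>i. \<bar>f j \<bullet> e i\<bar>) sums \<sigma> j" for j
  proof -
    have "(\<lambda>i. ennreal \<bar>f j \<bullet> e i\<bar>) sums ennreal (\<sigma> j)"
      unfolding \<sigma> S_def by (simp add: inner_commute sums_iff)
    then show ?thesis using \<sigma>1[of j] by (subst (asm) sums_ennreal) auto
  qed
  moreover have "(\<Sum>j<n. \<sigma> j - 1) \<le> enn2real (prodinf S)" for n
  proof -
    have "(\<Sum>j<n. \<sigma> j - 1) \<le> (\<Prod>j<n. 1 + (\<sigma> j - 1))" using \<sigma>1 by (intro sum_le_prod) auto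
    also have "\<dots> = (\<Prod>j<n. \<sigma> j)" by simp
    also have "\<dots> \<le> (\<Prod>j\<le>n. \<sigma> j)"
      using \<sigma>1 by (intro prod_mono2) (auto intro: order_trans[OF zero_le_one])
    also have "\<dots> = enn2real (\<Prod>j\<le>n. S j)"
      using \<sigma>0 unfolding \<sigma>[symmetric] by (simp add: prod_ennreal prod_nonneg)
    also have "\<dots> \<le> enn2real (prodinf S)"
      using le[of n] finS by (intro enn2real_mono) auto
    finally show ?thesis .
  qed
  ultimately show ?thesis by (rule that)
qed

theorem theorem4p9:
  fixes e f :: "nat \<Rightarrow> 'a::{real_inner, complete_space, second_countable_topology}"
  assumes infinite_dim: "\<nexists>B :: 'a set. finite B \<and> span B = UNIV"
    and basis_e: "orthonormal_basis e"
    and basis_f: "orthonormal_basis f"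
    and finite_product: "(\<Prod>j. \<Sum>i. ennreal \<bar>e i \<bullet> f j\<bar>) < \<infinity>"
  shows "(\<forall>Q\<in>measurable_rectangles f.
            Q \<in> completed_ring e \<and> completed_measure e Q = completed_measure f Q) \<and>
         (\<forall>P\<in>measurable_rectangles e.
            P \<in> completed_ring f \<and> completed_measure f P = completed_measure e P)"
proof -
  note e = orthonormal_basis_onb[OF basis_e] and f = orthonormal_basis_onb[OF basis_f]
  obtain \<sigma> C where "\<And>j. (\<lambda>i. \<bar>f j \<bullet> e i\<bar>) sums \<sigma> j" "\<And>n. (\<Sum>j<n. \<sigma> j - 1) \<le> C"
    using finite_product_rows[OF e f finite_product] by blast
  from almost_diagonal_permutation[OF e f this]
  obtain p T where "bij p" "offdiag_le f (e \<circ> p) T" by blast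
  note ref = refines_if_offdiag_le_permute[OF e f this]
  show ?thesis
    using refines_completion[OF onb_l2_coordinates[OF e] onb_l2_coordinates[OF f] ref(1)]
      refines_completion[OF onb_l2_coordinates[OF f] onb_l2_coordinates[OF e] ref(2)] by blast
qed

end
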